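(* The following five problems have the same degree of discontinuity: $$\mathrm{ZCorr} \equiv_2 \mathrm{Corr} \equiv_2 \mathrm{ZNash} \equiv_2 \mathrm{Nash} \equiv_2 \lceil \langle \mathrm{rDiv} \rangle^n \rceil_{n \in \mathbb{N}}.$$ Here $\mathrm{Corr}$ and $\mathrm{Nash}$ are the problems of finding a correlated, respectively a Nash, equilibrium of a given bi-matrix game of arbitrary size; $\mathrm{ZCorr}$ and $\mathrm{ZNash}$ are their restrictions to zero-sum games; and $\mathrm{rDiv}$ is robust division of real numbers.
   Context: Representation of reals. Fix a bijection $\nu:\mathbb{N}\to\mathbb{Q}$ with $\nu(0)=0$ such that the usual operations on $\mathbb{Q}$ are computable with respect to $\nu$. A sequence $w\in\mathbb{N}^{\mathbb{N}}$ is a $\rho$-name of $x\in\mathbb{R}$, written $\rho(w)=x$, if $|\nu(w(i))-x|\le 2^{-i}$ for all $i\in\mathbb{N}$. Problems and reducibility. $\mathbb{N}^{\mathbb{N}}$ carries its usual (Baire) topology, countable sets such as $\mathbb{N}$ or finite sets are discrete, products carry the product topology. A problem (multi-valued function) $P$ has a domain $\mathrm{dom}(P)$ of inputs (names) and assigns to each input a nonempty set of admissible outputs (names); $P$ is identified with the set of its choice functions, i.e. all functions $f$ on $\mathrm{dom}(P)$ with $f(w)$ admissible for every $w$. $P\le_2 Q$ holds iff there are continuous partial functions $F,G$ such that for each $g\in Q$ the function $w\mapsto F(w,g(G(w)))$ belongs to $P$ (in particular is defined on $\mathrm{dom}(P)$). $P\equiv_2 Q$ means $P\le_2 Q$ and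 $Q\le_2 P$. Products and suprema. $\langle P,Q\rangle$ is the problem with inputs $(x,u)\in \mathrm{dom}(P)\times\mathrm{dom}(Q)$ and admissible outputs all pairs $(y,v)$ with $y$ admissible for $x$ in $P$ and $v$ admissible for $u$ in $Q$; $\langle P\rangle^1=P$, $\langle P\rangle^{n+1}=\langle P,\langle P\rangle^n\rangle$, $n\ge 1$. For a countable family $(P_i)$, $\lceil P_i\rceil_i$ denotes its supremum with respect to $\le_2$, realized by the problem with inputs $(i,w)$, $w\in\mathrm{dom}(P_i)$, and the admissible outputs of $P_i$ on $w$. Robust division. $\mathrm{rDiv}$ is the set of functions $d$ defined on $\{(u,v)\mid 0\le\rho(u)\le\rho(v)\}$ (pairs of $\rho$-names), whose values are $\rho$-names of real numbers, satisfying $\rho(d(u,v))=\rho(u)/\rho(v)$ whenever $\rho(v)>0$ (the value is an arbitrary real if $\rho(v)=0$). Games. An $n\times m$ bi-matrix game is a pair $(A,B)$ of real $n\times m$ matrices; it is zero-sum if $B=-A$. $S^k$ is the set of vectors in $\mathbb{R}^k$ with non-negative entries summing to $1$. A Nash equilibrium is $(\hat x,\hat y)\in S^n\times S^m$ with $\hat x^TA\hat y\ge x^TA\hat y$ for all $x\in S^n$ and $\hat x^TB\hat y\ge\hat x^TBy$ for all $y\in S^m$. A correlated equilibrium is a real $n\times m$ matrix $C$ with non-negative entries summing to $1$ such that $\sum_{j}A_{ij}C_{ij}\ge\sum_{j}A_{lj}C_{ij}$ for all $i,l\in\{1,\dots,n\}$ and $\sum_iB_{ij}C_{ij}\ge\sum_iB_{ik}C_{ij}$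 for all $j,k\in\{1,\dots,m\}$. A name of a game consists of the size $(n,m)$ followed by $\rho$-names of all entries of $A$ and $B$ (combined by standard tupling of sequences); names of Nash and correlated equilibria consist of $\rho$-names of all their entries. $\mathrm{Nash}_{nm}$ (resp. $\mathrm{Corr}_{nm}$) is the problem: given a name of an $n\times m$ game, produce a name of some Nash (resp. correlated) equilibrium; $\mathrm{ZNash}_{nm},\mathrm{ZCorr}_{nm}$ are the restrictions to zero-sum games. $\mathrm{Nash},\mathrm{Corr},\mathrm{ZNash},\mathrm{ZCorr}$ are the versions without fixed size, i.e. the suprema over $n,m\ge1$. *)

theory Defs
  imports
    "HOL-Analysis.Function_Topology"
    "HOL-Library.FuncSet"
    "Jordan_Normal_Form.Matrix"
begin

section \<open>Total recursive functions and numberings of the rationals\<close>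

text \<open>
  \<open>recursive k f\<close>: the restriction of \<open>f\<close> to lists of length \<open>k\<close> is a total recursive function
  of \<open>k\<close> arguments. Values of \<open>f\<close> on lists of other lengths are irrelevant. Minimization is only
  applied to regular functions, which suffices to generate all total recursive functions.
\<close>

inductive recursive :: "nat \<Rightarrow> (nat list \<Rightarrow> nat) \<Rightarrow> bool" where
  zero: "recursive k (\<lambda>xs. 0)"
| succ: "recursive 1 (\<lambda>xs. Suc (xs ! 0))"
| proj: "i < k \<Longrightarrow> recursive k (\<lambda>xs. xs ! i)"
| comp: "recursive (length gs) f \<Longrightarrow> \<forall>g\<in>set gs. recursive k g \<Longrightarrow>
    recursive k (\<lambda>xs. f (map (\<lambda>g. g xs) gs))"
| prim: "recursive k f \<Longrightarrow> recursive (k + 2) g \<Longrightarrow>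
    recursive (k + 1) (\<lambda>xs. rec_nat (f (tl xs)) (\<lambda>n r. g (n # r # tl xs)) (hd xs))"
| mini: "recursive (k + 1) f \<Longrightarrow> \<forall>xs. length xs = k \<longrightarrow> (\<exists>n. f (n # xs) = 0) \<Longrightarrow>
    recursive k (\<lambda>xs. LEAST n. f (n # xs) = 0)"

definition computable_op :: "(nat \<Rightarrow> rat) \<Rightarrow> (rat \<Rightarrow> rat \<Rightarrow> rat) \<Rightarrow> bool" where
  "computable_op \<nu> h \<longleftrightarrow> (\<exists>f. recursive 2 f \<and> (\<forall>a b. \<nu> (f [a, b]) = h (\<nu> a) (\<nu> b)))"

text \<open>
  Division is total here (\<open>x / 0 = 0\<close>). Since \<open>0\<close> has exactly one index, computability of this total
  extension is equivalent to computability of division as a partial operation.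
\<close>

definition rat_numbering :: "(nat \<Rightarrow> rat) \<Rightarrow> bool" where
  "rat_numbering \<nu> \<longleftrightarrow> bij \<nu> \<and> \<nu> 0 = 0 \<and>
     computable_op \<nu> (+) \<and> computable_op \<nu> (-) \<and> computable_op \<nu> (*) \<and> computable_op \<nu> (/)"


section \<open>Names of real numbers and tuples of names\<close>

text \<open>
  The topology on \<^typ>\<open>nat \<Rightarrow> nat\<close> is the library's product topology of the discrete
  topology on \<^typ>\<open>nat\<close>, that is, the Baire topology.
\<close>

type_synonym baire = "nat \<Rightarrow> nat"

definition real_name :: "(nat \<Rightarrow> rat) \<Rightarrow> baire \<Rightarrow> real \<Rightarrow> bool" where
  "real_name \<nu> w x \<longleftrightarrow> (\<forall>i. \<bar>real_of_rat (\<nu> (w i)) - x\<bar> \<le> (1 / 2) ^ i)"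

text \<open>
  Tupling interleaves \<open>k\<close> sequences. For \<open>k > 0\<close> it is a homeomorphism from the \<open>k\<close>-fold power of
  Baire space onto Baire space whose inverse is given by the components, so every
  sequence is a tuple and all conditions on tuples can be phrased in terms of components.
\<close>

definition tuple :: "nat \<Rightarrow> (nat \<Rightarrow> baire) \<Rightarrow> baire" where
  "tuple k f = (\<lambda>i. f (i mod k) (i div k))"

definition component :: "nat \<Rightarrow> nat \<Rightarrow> baire \<Rightarrow> baire" where
  "component k j w = (\<lambda>i. w (k * i + j))"

lemma component_tuple: "j < k \<Longrightarrow> component k j (tuple k f) = f j"
  by (simp add: component_def tuple_def)

lemma tuple_component: "tuple k (\<lambda>j. component k j w) = w"
  by (simp add: component_def tuple_def)


section \<open>Problems and continuous reducibility\<close>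

text \<open>
  The domain is an explicit part of a problem, so that for instance the problem of finding Nash
  equilibria has all names of games as inputs by definition.
\<close>

record ('a, 'b) problem =
  inputs :: "'a set"
  outputs :: "'a \<Rightarrow> 'b set"

definition choice_functions :: "('a, 'b) problem \<Rightarrow> ('a \<Rightarrow> 'b) set" where
  "choice_functions P = Pi\<^sub>E (inputs P) (outputs P)"

text \<open>
  Continuous partial functions are given by a domain and a function that is continuous on it.
\<close>

definition reducible ::
  "('a::topological_space, 'b::topological_space) problem \<Rightarrow>
   ('c::topological_space, 'd::topological_space) problem \<Rightarrow> bool" (infix \<open>\<le>\<^sub>2\<close> 50) where
  "P \<le>\<^sub>2 Q \<longleftrightarrow>
    (\<exists>(D :: ('a \<times> 'd) set) (F :: 'a \<times> 'd \<Rightarrow> 'b) (E :: 'a set) (G :: 'a \<Rightarrow> 'c).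
      continuous_on D F \<and> continuous_on E G \<and>
      (\<forall>g\<in>choice_functions Q.
        (\<forall>w\<in>inputs P. w \<in> E \<and> G w \<in> inputs Q \<and> (w, g (G w)) \<in> D) \<and>
        (\<lambda>w\<in>inputs P. F (w, g (G w))) \<in> choice_functions P))"

definition equivalent ::
  "('a::topological_space, 'b::topological_space) problem \<Rightarrow>
   ('c::topological_space, 'd::topological_space) problem \<Rightarrow> bool" (infix \<open>\<equiv>\<^sub>2\<close> 50) where
  "P \<equiv>\<^sub>2 Q \<longleftrightarrow> P \<le>\<^sub>2 Q \<and> Q \<le>\<^sub>2 P"

text \<open>
  Pairs of names are coded by sequences, so that all powers of a problem have the same type.
\<close>

definition problem_product :: "(baire, baire) problem \<Rightarrow> (baire, baire) problem \<Rightarrow> (baire, baire) problem"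
  where
  "problem_product P Q =
    \<lparr>inputs = {w. component 2 0 w \<in> inputs P \<and> component 2 1 w \<in> inputs Q},
     outputs = (\<lambda>w. {z. component 2 0 z \<in> outputs P (component 2 0 w) \<and>
                        component 2 1 z \<in> outputs Q (component 2 1 w)})\<rparr>"

text \<open>The power with exponent \<open>0\<close> is left unspecified.\<close>

fun problem_power :: "(baire, baire) problem \<Rightarrow> nat \<Rightarrow> (baire, baire) problem" where
  "problem_power P (Suc 0) = P"
| "problem_power P (Suc (Suc n)) = problem_product P (problem_power P (Suc n))"

text \<open>
  The supremum of the problems \<open>P i\<close> for \<open>i \<in> I\<close>. The index types used below are \<^typ>\<open>nat\<close> and
  \<^typ>\<open>nat \<times> nat\<close>, whose topologies are discrete.
\<close>

definition problem_supremum :: "'i set \<Rightarrow> ('i \<Rightarrow> ('a, 'b) problem) \<Rightarrow> ('i \<times> 'a, 'b) problem" where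
  "problem_supremum I P =
    \<lparr>inputs = {(i, w). i \<in> I \<and> w \<in> inputs (P i)},
     outputs = (\<lambda>(i, w). outputs (P i) w)\<rparr>"

definition restriction :: "('a, 'b) problem \<Rightarrow> 'a set \<Rightarrow> ('a, 'b) problem" where
  "restriction P D = \<lparr>inputs = inputs P \<inter> D, outputs = outputs P\<rparr>"


section \<open>Robust division\<close>

definition rDiv :: "(nat \<Rightarrow> rat) \<Rightarrow> (baire, baire) problem" where
  "rDiv \<nu> =
    \<lparr>inputs = {w. \<exists>x y. real_name \<nu> (component 2 0 w) x \<and> real_name \<nu> (component 2 1 w) y \<and>
                       0 \<le> x \<and> x \<le> y},
     outputs = (\<lambda>w. {z. \<exists>x y r. real_name \<nu> (component 2 0 w) x \<and>
                       real_name \<nu> (component 2 1 w) y \<and>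
                       real_name \<nu> z r \<and> (y > 0 \<longrightarrow> r = x / y)})\<rparr>"


section \<open>Bi-matrix games\<close>

text \<open>Rows and columns are indexed from \<open>0\<close>.\<close>

definition mixed_strategies :: "nat \<Rightarrow> real vec set" where
  "mixed_strategies k = {x \<in> carrier_vec k. (\<forall>i<k. 0 \<le> x $ i) \<and> (\<Sum>i<k. x $ i) = 1}"

definition nash_equilibrium ::
  "nat \<Rightarrow> nat \<Rightarrow> real mat \<Rightarrow> real mat \<Rightarrow> real vec \<Rightarrow> real vec \<Rightarrow> bool" where
  "nash_equilibrium n m A B x y \<longleftrightarrow>
     x \<in> mixed_strategies n \<and> y \<in> mixed_strategies m \<and>
     (\<forall>x'\<in>mixed_strategies n. scalar_prod x (A *\<^sub>v y) \<ge> scalar_prod x' (A *\<^sub>v y)) \<and>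
     (\<forall>y'\<in>mixed_strategies m. scalar_prod x (B *\<^sub>v y) \<ge> scalar_prod x (B *\<^sub>v y'))"

definition correlated_equilibrium ::
  "nat \<Rightarrow> nat \<Rightarrow> real mat \<Rightarrow> real mat \<Rightarrow> real mat \<Rightarrow> bool" where
  "correlated_equilibrium n m A B C \<longleftrightarrow>
     C \<in> carrier_mat n m \<and> (\<forall>i<n. \<forall>j<m. 0 \<le> C $$ (i, j)) \<and>
     (\<Sum>i<n. \<Sum>j<m. C $$ (i, j)) = 1 \<and>
     (\<forall>i<n. \<forall>l<n. (\<Sum>j<m. A $$ (i, j) * C $$ (i, j)) \<ge> (\<Sum>j<m. A $$ (l, j) * C $$ (i, j))) \<and>
     (\<forall>j<m. \<forall>k<m. (\<Sum>i<n. B $$ (i, j) * C $$ (i, j)) \<ge> (\<Sum>i<n. B $$ (i, k) * C $$ (i, j)))"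

text \<open>
  A name of a game is the sequence \<open>n, m, w\<^sub>0, w\<^sub>1, \<dots>\<close> where \<open>w\<close> is the tuple of \<open>2 * n * m\<close> names of
  reals: those of the entries of \<open>A\<close>, row by row, and then those of the entries of \<open>B\<close>.
\<close>

definition game_name :: "(nat \<Rightarrow> rat) \<Rightarrow> nat \<Rightarrow> nat \<Rightarrow> baire \<Rightarrow> real mat \<Rightarrow> real mat \<Rightarrow> bool" where
  "game_name \<nu> n m w A B \<longleftrightarrow>
     A \<in> carrier_mat n m \<and> B \<in> carrier_mat n m \<and> w 0 = n \<and> w 1 = m \<and>
     (\<forall>i<n. \<forall>j<m.
        real_name \<nu> (component (2 * n * m) (i * m + j) (\<lambda>k. w (k + 2))) (A $$ (i, j)) \<and>
        real_name \<nu> (component (2 * n * m) (n * m + (i * m + j)) (\<lambda>k. w (k + 2))) (B $$ (i, j)))"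

definition strategies_name ::
  "(nat \<Rightarrow> rat) \<Rightarrow> nat \<Rightarrow> nat \<Rightarrow> baire \<Rightarrow> real vec \<Rightarrow> real vec \<Rightarrow> bool" where
  "strategies_name \<nu> n m z x y \<longleftrightarrow>
     (\<forall>i<n. real_name \<nu> (component (n + m) i z) (x $ i)) \<and>
     (\<forall>j<m. real_name \<nu> (component (n + m) (n + j) z) (y $ j))"

definition matrix_name :: "(nat \<Rightarrow> rat) \<Rightarrow> nat \<Rightarrow> nat \<Rightarrow> baire \<Rightarrow> real mat \<Rightarrow> bool" where
  "matrix_name \<nu> n m z C \<longleftrightarrow>
     (\<forall>i<n. \<forall>j<m. real_name \<nu> (component (n * m) (i * m + j) z) (C $$ (i, j)))"

definition Nash_size :: "(nat \<Rightarrow> rat) \<Rightarrow> nat \<Rightarrow> nat \<Rightarrow> (baire, baire) problem" where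
  "Nash_size \<nu> n m =
    \<lparr>inputs = {w. \<exists>A B. game_name \<nu> n m w A B},
     outputs = (\<lambda>w. {z. \<exists>A B x y. game_name \<nu> n m w A B \<and> nash_equilibrium n m A B x y \<and>
                                  strategies_name \<nu> n m z x y})\<rparr>"

definition Corr_size :: "(nat \<Rightarrow> rat) \<Rightarrow> nat \<Rightarrow> nat \<Rightarrow> (baire, baire) problem" where
  "Corr_size \<nu> n m =
    \<lparr>inputs = {w. \<exists>A B. game_name \<nu> n m w A B},
     outputs = (\<lambda>w. {z. \<exists>A B C. game_name \<nu> n m w A B \<and> correlated_equilibrium n m A B C \<and>
                                matrix_name \<nu> n m z C})\<rparr>"

definition zero_sum_names :: "(nat \<Rightarrow> rat) \<Rightarrow> nat \<Rightarrow> nat \<Rightarrow> baire set" where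
  "zero_sum_names \<nu> n m = {w. \<exists>A. game_name \<nu> n m w A (- A)}"

definition ZNash_size :: "(nat \<Rightarrow> rat) \<Rightarrow> nat \<Rightarrow> nat \<Rightarrow> (baire, baire) problem" where
  "ZNash_size \<nu> n m = restriction (Nash_size \<nu> n m) (zero_sum_names \<nu> n m)"

definition ZCorr_size :: "(nat \<Rightarrow> rat) \<Rightarrow> nat \<Rightarrow> nat \<Rightarrow> (baire, baire) problem" where
  "ZCorr_size \<nu> n m = restriction (Corr_size \<nu> n m) (zero_sum_names \<nu> n m)"

definition Nash :: "(nat \<Rightarrow> rat) \<Rightarrow> ((nat \<times> nat) \<times> baire, baire) problem" where
  "Nash \<nu> = problem_supremum ({1..} \<times> {1..}) (\<lambda>(n, m). Nash_size \<nu> n m)"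

definition Corr :: "(nat \<Rightarrow> rat) \<Rightarrow> ((nat \<times> nat) \<times> baire, baire) problem" where
  "Corr \<nu> = problem_supremum ({1..} \<times> {1..}) (\<lambda>(n, m). Corr_size \<nu> n m)"

definition ZNash :: "(nat \<Rightarrow> rat) \<Rightarrow> ((nat \<times> nat) \<times> baire, baire) problem" where
  "ZNash \<nu> = problem_supremum ({1..} \<times> {1..}) (\<lambda>(n, m). ZNash_size \<nu> n m)"

definition ZCorr :: "(nat \<Rightarrow> rat) \<Rightarrow> ((nat \<times> nat) \<times> baire, baire) problem" where
  "ZCorr \<nu> = problem_supremum ({1..} \<times> {1..}) (\<lambda>(n, m). ZCorr_size \<nu> n m)"

end

theory Submission
  imports Defs "HOL-Analysis.Brouwer_Fixpoint" "HOL-Analysis.Continuous_Extension" "HOL-Analysis.Function_Metric"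
begin

unbundle no vec_syntax

text \<open>The reductions close up into a cycle. Powers of \<open>rDiv\<close> reduce to zero-sum correlated
  equilibria: \<open>a / (\<alpha> + a)\<close> is a marginal of every equilibrium of the \<open>2 \<times> 2\<close> game with
  diagonal \<open>\<alpha>, a\<close>, and a game on bit strings that adds up the payoffs of \<open>N\<close> such games solves \<open>N\<close>
  divisions at once. A Nash equilibrium is a correlated equilibrium by taking products.

  Conversely, the equilibria with given supports form a polytope \<open>P p\<close> that depends on the payoffs
  \<open>p\<close> through linear inequalities. Counting which systems of active constraints are solvable or
  degenerate yields an upper semicontinuous level, and \<open>P p\<close> is the hull of continuous vertices where
  the level is constant. Robust divisions supply these vertices for all levels in parallel; the
  answers for too low levels are junk, but nearest-point projections onto the answers in ascending
  order still depend continuously on the data and end in \<open>P p\<close>. A knockout with further divisions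
  finds supports for which \<open>P p\<close> is nonempty. Only the existence of equilibria enters, by Brouwer.\<close>

section \<open>Continuous reductions and names of reals\<close>

text \<open>A reduction poses its single question before any answer is known, so a power of
  \<open>rDiv\<close> cannot be used adaptively: the divisions for all pairs of supports and all
  levels are asked together. A quotient with vanishing denominator comes back as an arbitrary real
  that cannot be recognised as such. Sets built from answers must therefore make sense for all
  reals, and correctness may rest only on quotients whose denominators are positive at the given
  parameter. In the selection these denominators are distances to closed sets of bad parameters,
  which is why the relevant conditions are arranged to be closed. Fixing supports replaces the
  bilinear equilibrium conditions by linear ones; the number of divisions then depends on the size
  of the game alone, which is discrete data. A single vertex cannot be followed where constraints
  degenerate; the polytope as a whole has a closed graph, and a nearest point of a compact convex
  set is unique. In the other direction, \<open>\<alpha> = a = 0\<close> leaves the marginal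
  undetermined, which matches the freedom of \<open>rDiv\<close> at 0/0.\<close>

definition reduction ::
  "('a::topological_space, 'b::topological_space) problem \<Rightarrow>
   ('c::topological_space, 'd::topological_space) problem \<Rightarrow>
   ('a \<times> 'd) set \<Rightarrow> ('a \<times> 'd \<Rightarrow> 'b) \<Rightarrow> 'a set \<Rightarrow> ('a \<Rightarrow> 'c) \<Rightarrow> bool" where
  "reduction P Q D F E G \<longleftrightarrow> continuous_on D F \<and> continuous_on E G \<and>
    (\<forall>g\<in>choice_functions Q.
      (\<forall>w\<in>inputs P. w \<in> E \<and> G w \<in> inputs Q \<and> (w, g (G w)) \<in> D \<and> F (w, g (G w)) \<in> outputs P w))"

text \<open>A restricted function is extensional by construction, so membership in
  \<open>choice_functions P\<close> amounts to a condition at each input; \<open>reduction\<close>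
  records this pointwise form.\<close>

lemma reducible_iff: "P \<le>\<^sub>2 Q \<longleftrightarrow> (\<exists>D F E G. reduction P Q D F E G)"
  unfolding reducible_def reduction_def choice_functions_def
  by (intro ex_cong1 conj_cong refl ball_cong) (auto simp: PiE_iff)

lemma reducibleI:
  assumes "continuous_on (inputs P) G" "\<And>w. w \<in> inputs P \<Longrightarrow> G w \<in> inputs Q"
    and "continuous_on {(w, z). w \<in> inputs P \<and> z \<in> outputs Q (G w)} F"
    and "\<And>w z. w \<in> inputs P \<Longrightarrow> z \<in> outputs Q (G w) \<Longrightarrow> F (w, z) \<in> outputs P w"
  shows "P \<le>\<^sub>2 Q"
  unfolding reducible_iff reduction_def choice_functions_def
  by (intro exI[of _ "{(w, z). w \<in> inputs P \<and> z \<in> outputs Q (G w)}"] exI[of _ F]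
      exI[of _ "inputs P"] exI[of _ G]) (use assms in \<open>auto simp: PiE_iff\<close>)

lemma reducible_trans:
  assumes "P \<le>\<^sub>2 Q" "Q \<le>\<^sub>2 R"
  shows "P \<le>\<^sub>2 R"
proof -
  obtain D F E G D' F' E' G' where 1: "reduction P Q D F E G" and 2: "reduction Q R D' F' E' G'"
    using assms unfolding reducible_iff by blast
  define D'' where "D'' = {(w, z). w \<in> E \<and> (G w, z) \<in> D' \<and> (w, F' (G w, z)) \<in> D}"
  define E'' where "E'' = {w \<in> E. G w \<in> E'}"
  define F'' where "F'' = (\<lambda>(w, z). F (w, F' (G w, z)))"
  have cont: "continuous_on D F" "continuous_on E G" "continuous_on D' F'" "continuous_on E' G'"
    using 1 2 by (auto simp: reduction_def)
  have G: "continuous_on D'' (\<lambda>x. G (fst x))"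
  proof (rule continuous_on_compose2[OF cont(2)])
    show "continuous_on D'' fst" by (intro continuous_intros)
  qed (auto simp: D''_def)
  have F': "continuous_on D'' (\<lambda>x. F' (G (fst x), snd x))"
  proof (rule continuous_on_compose2[OF cont(3)])
    show "continuous_on D'' (\<lambda>x. (G (fst x), snd x))" by (intro continuous_intros G)
  qed (auto simp: D''_def)
  have "continuous_on D'' F''" unfolding F''_def case_prod_beta
  proof (rule continuous_on_compose2[OF cont(1)])
    show "continuous_on D'' (\<lambda>x. (fst x, F' (G (fst x), snd x)))" by (intro continuous_intros F')
  qed (auto simp: D''_def)
  moreover have "continuous_on E'' (\<lambda>w. G' (G w))"
    by (rule continuous_on_compose2[OF cont(4)])
       (auto simp: E''_def intro: continuous_on_subset[OF cont(2)])
  moreover have "w \<in> E'' \<and> G' (G w) \<in> inputs R \<and> (w, g (G' (G w))) \<in> D'' \<and> F'' (w, g (G' (G w))) \<in> outputs P w"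
    if g: "g \<in> choice_functions R" and w: "w \<in> inputs P" for g w
  proof -
    \<comment> \<open>Answering \<open>Q\<close> through the second reduction yields one particular
      choice function of \<open>Q\<close>; the first reduction works for all of them, hence for this
      one.\<close>
    define h where "h = (\<lambda>u\<in>inputs Q. F' (u, g (G' u)))"
    have h: "h \<in> choice_functions Q" using 2 g by (auto simp: reduction_def choice_functions_def h_def)
    have "w \<in> E \<and> G w \<in> inputs Q \<and> (w, h (G w)) \<in> D \<and> F (w, h (G w)) \<in> outputs P w"
      using 1 h w unfolding reduction_def by blast
    moreover have "u \<in> E' \<and> G' u \<in> inputs R \<and> (u, g (G' u)) \<in> D'" if "u \<in> inputs Q" for u
      using 2 g that unfolding reduction_def by blast
    ultimately show ?thesis by (auto simp: h_def D''_def E''_def F''_def)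
  qed
  ultimately have "reduction P R D'' F'' E'' (\<lambda>w. G' (G w))" unfolding reduction_def by blast
  then show ?thesis unfolding reducible_iff by blast
qed

text \<open>Since \<open>{i} \<times> A\<close> is open for open \<open>A\<close>, open sets chosen
  separately for each \<open>i\<close> can be joined.\<close>

lemma continuous_on_discrete_fst:
  fixes f :: "'i::topological_space \<times> 'a::topological_space \<Rightarrow> 'b::topological_space"
  assumes disc: "\<And>i::'i. open {i}" and cont: "\<And>i. continuous_on {w. (i, w) \<in> S} (\<lambda>w. f (i, w))"
  shows "continuous_on S f"
  unfolding continuous_on_open_invariant
proof (intro allI impI)
  fix B :: "'b set" assume "open B"
  then have "\<forall>i. \<exists>A. open A \<and> A \<inter> {w. (i, w) \<in> S} = (\<lambda>w. f (i, w)) -` B \<inter> {w. (i, w) \<in> S}"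
    using cont unfolding continuous_on_open_invariant by blast
  then obtain A where A: "\<And>i. open (A i)"
      "\<And>i. A i \<inter> {w. (i, w) \<in> S} = (\<lambda>w. f (i, w)) -` B \<inter> {w. (i, w) \<in> S}"
    by metis
  have "open (\<Union>i. {i} \<times> A i)" using A(1) disc by (intro open_UN ballI open_Times)
  moreover have "(\<Union>i. {i} \<times> A i) \<inter> S = f -` B \<inter> S" using A(2) by fastforce
  ultimately show "\<exists>A. open A \<and> A \<inter> S = f -` B \<inter> S" by blast
qed

text \<open>The index map and the family of reductions are picked by choice: on a discrete index set
  every map is continuous, so no uniformity in \<open>i\<close> is required.\<close>

lemma reducible_supremum:
  fixes P :: "'i::topological_space \<Rightarrow> ('a::topological_space, 'b::topological_space) problem"
    and Q :: "'j::topological_space \<Rightarrow> ('c::topological_space, 'd::topological_space) problem"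
  assumes disc: "\<And>i::'i. open {i}" and j: "\<And>i. i \<in> I \<Longrightarrow> \<exists>j\<in>J. P i \<le>\<^sub>2 Q j"
  shows "problem_supremum I P \<le>\<^sub>2 problem_supremum J Q"
proof -
  have "\<forall>i. \<exists>j D F E G. i \<in> I \<longrightarrow> j \<in> J \<and> reduction (P i) (Q j) D F E G"
    using j unfolding reducible_iff by blast
  then obtain j D F E G where red: "\<And>i. i \<in> I \<Longrightarrow> j i \<in> J"
      "\<And>i. i \<in> I \<Longrightarrow> reduction (P i) (Q (j i)) (D i) (F i) (E i) (G i)"
    by metis
  define D' where "D' = {((i, w), z). i \<in> I \<and> (w, z) \<in> D i}"
  define F' where "F' = (\<lambda>((i, w), z). F i (w, z))"
  define E' where "E' = {(i, w). i \<in> I \<and> w \<in> E i}"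
  define G' where "G' = (\<lambda>(i, w). (j i, G i w))"
  have cont: "continuous_on (D i) (F i)" "continuous_on (E i) (G i)" if "i \<in> I" for i
    using red(2)[OF that] by (auto simp: reduction_def)
  have F: "continuous_on {(i, x). i \<in> I \<and> x \<in> D i} (\<lambda>(i, x). F i x)"
  proof (rule continuous_on_discrete_fst[OF disc])
    fix i show "continuous_on {w. (i, w) \<in> {(i, x). i \<in> I \<and> x \<in> D i}} (\<lambda>w. case (i, w) of (i, x) \<Rightarrow> F i x)"
      by (cases "i \<in> I") (simp_all add: cont)
  qed
  have "continuous_on D' (\<lambda>x. case (fst (fst x), snd (fst x), snd x) of (i, x) \<Rightarrow> F i x)"
  proof (rule continuous_on_compose2[OF F])
    show "continuous_on D' (\<lambda>x. (fst (fst x), snd (fst x), snd x))" by (intro continuous_intros)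
  qed (auto simp: D'_def)
  then have "continuous_on D' F'" by (simp add: F'_def case_prod_beta)
  moreover have "continuous_on E' G'"
  proof (rule continuous_on_discrete_fst[OF disc])
    fix i show "continuous_on {w. (i, w) \<in> E'} (\<lambda>w. G' (i, w))"
      by (cases "i \<in> I") (simp_all add: E'_def G'_def cont continuous_on_Pair)
  qed
  moreover have "x \<in> E' \<and> G' x \<in> inputs (problem_supremum J Q) \<and> (x, g (G' x)) \<in> D' \<and>
      F' (x, g (G' x)) \<in> outputs (problem_supremum I P) x"
    if g: "g \<in> choice_functions (problem_supremum J Q)" and x: "x \<in> inputs (problem_supremum I P)" for g x
  proof -
    obtain i w where x': "x = (i, w)" "i \<in> I" "w \<in> inputs (P i)" using x by (auto simp: problem_supremum_def)
    have "(\<lambda>u\<in>inputs (Q (j i)). g (j i, u)) \<in> choice_functions (Q (j i))"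
      using g red(1)[OF x'(2)] by (auto simp: choice_functions_def problem_supremum_def PiE_iff)
    with red(2)[OF x'(2)] x'(3) have "w \<in> E i \<and> G i w \<in> inputs (Q (j i)) \<and> (w, g (j i, G i w)) \<in> D i \<and>
        F i (w, g (j i, G i w)) \<in> outputs (P i) w"
      unfolding reduction_def by fastforce
    then show ?thesis using x' red(1)[OF x'(2)]
      by (auto simp: E'_def G'_def D'_def F'_def problem_supremum_def)
  qed
  ultimately show ?thesis unfolding reducible_iff reduction_def by blast
qed

section \<open>Countable clopen bases and the continuous choice of names\<close>

definition clopen_base :: "(nat \<Rightarrow> 'a::topological_space set) \<Rightarrow> bool" where
  "clopen_base C \<longleftrightarrow> (\<forall>k. open (C k) \<and> closed (C k)) \<and>
     (\<forall>U x. open U \<longrightarrow> x \<in> U \<longrightarrow> (\<exists>k. x \<in> C k \<and> C k \<subseteq> U))"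

text \<open>Cylinders given by finite words: fixing finitely many entries is both an open and a
  closed condition, and there are countably many words.\<close>

lemma clopen_base_baire: "\<exists>C :: nat \<Rightarrow> baire set. clopen_base C"
proof -
  define cyl :: "nat list \<Rightarrow> baire set" where "cyl s = {w. \<forall>i<length s. w i = s ! i}" for s
  have cyl_Int: "cyl s = (\<Inter>i\<in>{..<length s}. {w. w i \<in> {s ! i}})" for s by (auto simp: cyl_def)
  have open1: "open {w::baire. w i \<in> A}" for i A
    using open_vimage[of A "\<lambda>w::baire. w i"] by (simp add: vimage_def open_discrete)
  have closed1: "closed {w::baire. w i \<in> A}" for i A
    using open1[of i "- A"] by (simp add: closed_def Collect_neg_eq[symmetric])
  have "open (cyl s) \<and> closed (cyl s)" for s
    unfolding cyl_Int by (intro conjI open_INT closed_INT ballI open1 closed1) auto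
  moreover have "\<exists>s. x \<in> cyl s \<and> cyl s \<subseteq> U" if "open U" "x \<in> U" for U x
  proof -
    have "openin (product_topology (\<lambda>i::nat. euclidean :: nat topology) UNIV) U"
      using that by (simp add: euclidean_product_topology)
    from product_topology_open_contains_basis[OF this that(2)]
    obtain X where X: "x \<in> PiE UNIV X" "finite {i. X i \<noteq> UNIV}" "PiE UNIV X \<subseteq> U" by auto
    \<comment> \<open>\<open>n\<close> bounds all coordinates that the basic open set restricts; the
      inserted \<open>0\<close> keeps \<open>Max\<close> meaningful when there are none.\<close>
    define n where "n = Suc (Max (insert 0 {i. X i \<noteq> UNIV}))"
    have n: "X i = UNIV" if "i \<ge> n" for i
    proof (rule ccontr)
      assume "X i \<noteq> UNIV"
      then have "i \<le> Max (insert 0 {i. X i \<noteq> UNIV})" using X(2) by (intro Max_ge) auto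
      with that show False by (simp add: n_def)
    qed
    have "cyl (map x [0..<n]) \<subseteq> PiE UNIV X"
    proof
      fix w assume w: "w \<in> cyl (map x [0..<n])"
      have "w i \<in> X i" for i
        using w X(1) n[of i] by (cases "i < n") (auto simp: cyl_def PiE_iff)
      then show "w \<in> PiE UNIV X" by auto
    qed
    moreover have "x \<in> cyl (map x [0..<n])" by (simp add: cyl_def)
    ultimately show ?thesis using X(3) by blast
  qed
  ultimately have "clopen_base (\<lambda>k. cyl (from_nat k))"
    unfolding clopen_base_def by (metis from_nat_to_nat)
  then show ?thesis by blast
qed

lemma clopen_base_Times:
  assumes "clopen_base C" "clopen_base C'"
  shows "clopen_base (\<lambda>k. C (fst (prod_decode k)) \<times> C' (snd (prod_decode k)))"
  unfolding clopen_base_def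
proof (intro conjI allI impI)
  fix k
  show "open (C (fst (prod_decode k)) \<times> C' (snd (prod_decode k)))"
    "closed (C (fst (prod_decode k)) \<times> C' (snd (prod_decode k)))"
    using assms by (auto simp: clopen_base_def intro!: open_Times closed_Times)
next
  fix U :: "('a \<times> 'b) set" and x assume "open U" "x \<in> U"
  then obtain A B where AB: "open A" "open B" "x \<in> A \<times> B" "A \<times> B \<subseteq> U" by (rule open_prod_elim)
  obtain k l where "fst x \<in> C k" "C k \<subseteq> A" "snd x \<in> C' l" "C' l \<subseteq> B"
    using AB assms unfolding clopen_base_def by (metis mem_Times_iff)
  then show "\<exists>k. x \<in> C (fst (prod_decode k)) \<times> C' (snd (prod_decode k)) \<and>
      C (fst (prod_decode k)) \<times> C' (snd (prod_decode k)) \<subseteq> U"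
    using AB(4) by (intro exI[of _ "prod_encode (k, l)"]) (auto simp: mem_Times_iff)
qed

lemma continuous_on_locally_constant:
  fixes f :: "'a::topological_space \<Rightarrow> 'b::topological_space"
  assumes "\<And>x. x \<in> S \<Longrightarrow> \<exists>W. open W \<and> x \<in> W \<and> (\<forall>y\<in>W \<inter> S. f y = f x)"
  shows "continuous_on S f"
  unfolding continuous_on_topological using assms by (metis IntI)

lemma nat_valued_locally_constant:
  fixes f :: "'a::topological_space \<Rightarrow> nat"
  assumes "continuous_on S f" "x \<in> S"
  shows "\<exists>W. open W \<and> x \<in> W \<and> (\<forall>y\<in>W \<inter> S. f y = f x)"
proof -
  have "open {f x}" by (rule open_discrete)
  then show ?thesis using assms unfolding continuous_on_topological
    by (metis IntE insertI1 singletonD)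
qed

lemma real_name_unique:
  assumes "real_name \<nu> w x" "real_name \<nu> w y"
  shows "x = y"
proof (rule ccontr)
  assume "x \<noteq> y"
  then have "\<bar>x - y\<bar> / 2 > 0" by simp
  then obtain i where i: "(1/2)^i < \<bar>x - y\<bar> / 2"
    using real_arch_pow_inv[of "\<bar>x - y\<bar> / 2" "1/2"] by auto
  have "\<bar>real_of_rat (\<nu> (w i)) - x\<bar> \<le> (1/2)^i" "\<bar>real_of_rat (\<nu> (w i)) - y\<bar> \<le> (1/2)^i"
    using assms by (auto simp: real_name_def)
  moreover have "\<bar>x - y\<bar> \<le> \<bar>real_of_rat (\<nu> (w i)) - x\<bar> + \<bar>real_of_rat (\<nu> (w i)) - y\<bar>" by simp
  ultimately show False using i by argo
qed

text \<open>Names agreeing at the single entry \<open>i\<close> have values within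
  \<open>2 * (1/2)^i\<close> of each other, and one entry of a continuously varying name is locally
  constant.\<close>

lemma continuous_on_named_value:
  fixes h :: "'a::topological_space \<Rightarrow> real"
  assumes N: "continuous_on S N" and name: "\<And>x. x \<in> S \<Longrightarrow> real_name \<nu> (N x) (h x)"
  shows "continuous_on S h"
  unfolding continuous_on_def
proof (intro ballI tendstoI)
  fix x and e :: real assume x: "x \<in> S" and e: "e > 0"
  obtain i where i: "(1/2)^i < e / 2" using real_arch_pow_inv[of "e / 2" "1/2"] e by auto
  obtain W where W: "open W" "x \<in> W" "\<forall>y\<in>W \<inter> S. N y i = N x i"
    using nat_valued_locally_constant[OF continuous_on_product_then_coordinatewise[OF N, of i] x] by blast
  show "\<forall>\<^sub>F y in at x within S. dist (h y) (h x) < e"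
    unfolding eventually_at_topological
  proof (intro exI[of _ W] conjI W ballI impI)
    fix y assume "y \<in> W" "y \<in> S"
    then have "\<bar>real_of_rat (\<nu> (N x i)) - h y\<bar> \<le> (1/2)^i"
      using name[of y] W(3) by (metis IntI real_name_def)
    moreover have "\<bar>real_of_rat (\<nu> (N x i)) - h x\<bar> \<le> (1/2)^i"
      using name[OF x] by (simp add: real_name_def)
    ultimately show "dist (h y) (h x) < e" using i unfolding dist_real_def by linarith
  qed
qed

text \<open>In a space with a countable base of clopen sets the least index of a sufficiently small
  basic set around \<open>x\<close>, together with an approximation valid on it, is locally constant in \<open>x\<close>.\<close>

lemma continuous_name:
  fixes h :: "'a::topological_space \<Rightarrow> real" and C :: "nat \<Rightarrow> 'a set"
  assumes \<nu>: "surj \<nu>" and C: "clopen_base C" and h: "continuous_on S h"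
  obtains N where "continuous_on S N" "\<And>x. x \<in> S \<Longrightarrow> real_name \<nu> (N x) (h x)"
proof -
  define good where "good i e \<longleftrightarrow> (\<forall>y\<in>S \<inter> C (fst (prod_decode e)).
      \<bar>real_of_rat (\<nu> (snd (prod_decode e))) - h y\<bar> \<le> (1/2)^i)" for i e
  define lst where "lst i x = (LEAST e. x \<in> C (fst (prod_decode e)) \<and> good i e)" for i x
  define N where "N x i = snd (prod_decode (lst i x))" for x i
  have ex: "\<exists>e. x \<in> C (fst (prod_decode e)) \<and> good i e" if x: "x \<in> S" for x i
  proof -
    \<comment> \<open>The tolerance \<open>(1/2)^i\<close> is split into halves: one for
      approximating \<open>h x\<close> by a rational, one for the variation of \<open>h\<close> on
      the basic set.\<close>
    define d :: real where "d = (1/2)^i / 2"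
    have d: "d > 0" by (simp add: d_def)
    obtain q :: rat where "h x - d < real_of_rat q" "real_of_rat q < h x + d"
      using of_rat_dense[of "h x - d" "h x + d"] d by auto
    then have q: "\<bar>real_of_rat q - h x\<bar> < d" by (simp add: abs_less_iff)
    obtain m where m: "\<nu> m = q" using \<nu> by (metis surjD)
    obtain U where U: "open U" "U \<inter> S = h -` ball (h x) d \<inter> S"
      using h unfolding continuous_on_open_invariant by (metis open_ball)
    then have "x \<in> U" using x d by (metis IntD1 IntI centre_in_ball vimageI2)
    then obtain k where k: "x \<in> C k" "C k \<subseteq> U" using C U(1) unfolding clopen_base_def by blast
    have "\<bar>real_of_rat q - h y\<bar> \<le> (1/2)^i" if "y \<in> S \<inter> C k" for y
    proof -
      have "y \<in> h -` ball (h x) d \<inter> S" using that k(2) U(2) by blast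
      then have "\<bar>h x - h y\<bar> < d" by (simp add: dist_real_def)
      moreover have "\<bar>real_of_rat q - h y\<bar> \<le> \<bar>real_of_rat q - h x\<bar> + \<bar>h x - h y\<bar>" by arith
      moreover have "d + d = (1/2)^i" by (simp add: d_def)
      ultimately show ?thesis using q by linarith
    qed
    then show ?thesis using k(1) m by (intro exI[of _ "prod_encode (k, m)"]) (auto simp: good_def)
  qed
  have lst: "x \<in> C (fst (prod_decode (lst i x))) \<and> good i (lst i x)" if "x \<in> S" for x i
    using LeastI_ex[OF ex[OF that, of i]] unfolding lst_def .
  have lst_least: "\<not> (x \<in> C (fst (prod_decode e)) \<and> good i e)" if "e < lst i x" for x i e
    using not_less_Least[OF that[unfolded lst_def]] .
  have "continuous_on S N"
  proof (intro continuous_on_coordinatewise_then_product continuous_on_locally_constant)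
    fix i x assume x: "x \<in> S"
    \<comment> \<open>Smaller good indices have basic sets that miss \<open>x\<close>. These sets
      are closed and finitely many, so removing them leaves an open set, on which the least index
      cannot change.\<close>
    define W where "W = C (fst (prod_decode (lst i x))) \<inter>
        (\<Inter>e\<in>{e. e < lst i x \<and> good i e}. - C (fst (prod_decode e)))"
    have "open W" unfolding W_def
      using C by (intro open_Int open_INT) (auto simp: clopen_base_def)
    moreover have "x \<in> W"
      unfolding W_def using lst[OF x, of i] lst_least by blast
    moreover have same: "lst i y = lst i x" if "y \<in> W" for y
      unfolding lst_def[of i y]
    proof (rule Least_equality)
      show "y \<in> C (fst (prod_decode (lst i x))) \<and> good i (lst i x)"
        using that lst[OF x, of i] unfolding W_def by blast
      fix e assume e: "y \<in> C (fst (prod_decode e)) \<and> good i e"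
      show "lst i x \<le> e"
      proof (rule ccontr)
        assume "\<not> lst i x \<le> e"
        then have "e \<in> {e. e < lst i x \<and> good i e}" using e by simp
        then have "y \<notin> C (fst (prod_decode e))" using that unfolding W_def by blast
        with e show False by blast
      qed
    qed
    moreover have "\<forall>y\<in>W \<inter> S. N y i = N x i" unfolding N_def using same by (metis IntE)
    ultimately show "\<exists>W. open W \<and> x \<in> W \<and> (\<forall>y\<in>W \<inter> S. N y i = N x i)" by blast
  qed
  moreover have "real_name \<nu> (N x) (h x)" if x: "x \<in> S" for x
    unfolding real_name_def
  proof
    fix i
    have "good i (lst i x)" "x \<in> S \<inter> C (fst (prod_decode (lst i x)))" using lst[OF x, of i] x by simp_all
    then show "\<bar>real_of_rat (\<nu> (N x i)) - h x\<bar> \<le> (1/2)^i"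
      unfolding N_def good_def by (rule bspec)
  qed
  ultimately show thesis by (rule that)
qed

lemma continuous_on_component: "continuous_on S N \<Longrightarrow> continuous_on S (\<lambda>x. component k j (N x))"
  unfolding component_def
  by (intro continuous_on_coordinatewise_then_product) (rule continuous_on_product_then_coordinatewise)

lemma continuous_on_tuple: "(\<And>j. continuous_on S (\<lambda>x. f x j)) \<Longrightarrow> continuous_on S (\<lambda>x. tuple k (f x))"
  unfolding tuple_def
  by (intro continuous_on_coordinatewise_then_product) (rule continuous_on_product_then_coordinatewise)

lemma continuous_tuple_name:
  fixes h :: "nat \<Rightarrow> 'a::topological_space \<Rightarrow> real" and C :: "nat \<Rightarrow> 'a set"
  assumes \<nu>: "surj \<nu>" and C: "clopen_base C" and h: "\<And>j. j < k \<Longrightarrow> continuous_on S (h j)"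
  obtains N where "continuous_on S N" "\<And>x j. x \<in> S \<Longrightarrow> j < k \<Longrightarrow> real_name \<nu> (component k j (N x)) (h j x)"
proof -
  have "\<exists>N. continuous_on S N \<and> (j < k \<longrightarrow> (\<forall>x\<in>S. real_name \<nu> (N x) (h j x)))" for j
  proof (cases "j < k")
    case True
    then show ?thesis using continuous_name[OF \<nu> C h] by metis
  qed (auto intro!: exI[of _ "\<lambda>_ _. 0"] continuous_on_const)
  then obtain N where N: "\<And>j. continuous_on S (N j)"
      "\<And>j x. j < k \<Longrightarrow> x \<in> S \<Longrightarrow> real_name \<nu> (N j x) (h j x)" by metis
  show thesis
    by (rule that[of "\<lambda>x. tuple k (\<lambda>j. N j x)"])
       (use N in \<open>auto intro!: continuous_on_tuple simp: component_tuple\<close>)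
qed

section \<open>Coordinates of powers of a problem\<close>

fun slot :: "nat \<Rightarrow> nat \<Rightarrow> baire \<Rightarrow> baire" where
  "slot (Suc (Suc N)) 0 w = component 2 0 w"
| "slot (Suc (Suc N)) (Suc k) w = slot (Suc N) k (component 2 1 w)"
| "slot N k w = w"

text \<open>\<open>slot\<close> and \<open>pack\<close> follow the right-nested pairs of
  \<open>problem_power\<close>. The innermost factor stands unpaired, which is why the patterns
  separate one remaining factor from two or more.\<close>

fun pack :: "nat \<Rightarrow> (nat \<Rightarrow> baire) \<Rightarrow> baire" where
  "pack (Suc (Suc N)) f = tuple 2 (\<lambda>j. if j = 0 then f 0 else pack (Suc N) (\<lambda>k. f (Suc k)))"
| "pack N f = f 0"

lemma slot_pack: "k < N \<Longrightarrow> slot N k (pack N f) = f k"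
  by (induction N k "pack N f" arbitrary: f rule: slot.induct) (auto simp: component_tuple less_Suc_eq)

lemma power_slots:
  "N > 0 \<Longrightarrow> w \<in> inputs (problem_power P N) \<longleftrightarrow> (\<forall>k<N. slot N k w \<in> inputs P)"
  "N > 0 \<Longrightarrow> z \<in> outputs (problem_power P N) w \<longleftrightarrow> (\<forall>k<N. slot N k z \<in> outputs P (slot N k w))"
proof (induction P N arbitrary: w z rule: problem_power.induct)
  case (2 P N)
  { case 1 then show ?case using 2[of "component 2 1 w"] by (simp add: problem_product_def All_less_Suc2) }
  { case 2 then show ?case using "2.IH"(2)[of "component 2 1 z" "component 2 1 w"]
      by (simp add: problem_product_def All_less_Suc2) }
qed auto

lemma continuous_on_slot: "continuous_on S f \<Longrightarrow> continuous_on S (\<lambda>x. slot N k (f x))"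
proof (induction N arbitrary: k f)
  case (Suc N)
  then show ?case
    by (cases N; cases k) (simp_all add: continuous_on_component)
qed simp

lemma continuous_on_pack: "(\<And>k. continuous_on S (\<lambda>x. f x k)) \<Longrightarrow> continuous_on S (\<lambda>x. pack N (f x))"
proof (induction N arbitrary: f)
  case (Suc N)
  show ?case
  proof (cases N)
    case (Suc N')
    have "continuous_on S (\<lambda>x. pack N (\<lambda>k. f x (Suc k)))" by (rule Suc.IH) (rule Suc.prems)
    then have "continuous_on S (\<lambda>x. if j = 0 then f x 0 else pack N (\<lambda>k. f x (Suc k)))" for j :: nat
      using Suc.prems by (cases "j = 0") auto
    then show ?thesis unfolding Suc pack.simps by (rule continuous_on_tuple)
  qed (simp add: Suc.prems)
qed simp

text \<open>Decoding is made total so that values can be written as functions of the name; the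
  result is unspecified off the set of names.\<close>

definition name_value :: "(nat \<Rightarrow> rat) \<Rightarrow> baire \<Rightarrow> real" where
  "name_value \<nu> w = (THE x. real_name \<nu> w x)"

lemma name_value: "real_name \<nu> w x \<Longrightarrow> name_value \<nu> w = x"
  unfolding name_value_def using real_name_unique by blast

lemma continuous_on_name_value:
  assumes "continuous_on S N" "\<And>x. x \<in> S \<Longrightarrow> \<exists>y. real_name \<nu> (N x) y"
  shows "continuous_on S (\<lambda>x. name_value \<nu> (N x))"
  by (rule continuous_on_named_value[where \<nu> = \<nu>, OF assms(1)]) (use assms(2) name_value in metis)

section \<open>Projections onto hulls\<close>

lemma tendsto_fun_iff:
  fixes f :: "'a \<Rightarrow> 'i \<Rightarrow> 'b::topological_space"
  shows "(f \<longlongrightarrow> l) F \<longleftrightarrow> (\<forall>i. ((\<lambda>x. f x i) \<longlongrightarrow> l i) F)"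
  using limitin_componentwise[of "\<lambda>_. euclidean" UNIV f l F]
  by (simp add: euclidean_product_topology)

lemma compact_fun_box:
  fixes K :: "'i \<Rightarrow> 'b::topological_space set"
  assumes "\<And>i. compact (K i)"
  shows "compact {z. \<forall>i. z i \<in> K i}"
proof -
  have "compactin (product_topology (\<lambda>i. euclidean) UNIV) (PiE UNIV K)"
    unfolding compactin_PiE using assms by simp
  moreover have "PiE UNIV K = {z. \<forall>i. z i \<in> K i}" by (auto simp: PiE_def)
  ultimately show ?thesis by (simp add: euclidean_product_topology)
qed

text \<open>Witnesses need neither be unique nor depend continuously on \<open>x\<close>. If
  continuity failed, witnesses along a bad sequence would accumulate at some \<open>l\<close> in the
  compact set; closedness makes \<open>l\<close> a witness at the limit, and every witness there
  computes the same value \<open>f x\<close>. Serves for nearest points and for vertices.\<close>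

lemma continuous_on_compact_witness:
  fixes f :: "'a::metric_space \<Rightarrow> 'b::metric_space" and g :: "'a \<times> 'c::metric_space \<Rightarrow> 'b"
  assumes L: "compact L" and ex: "\<And>x. x \<in> S \<Longrightarrow> \<exists>l\<in>L. R x l"
    and closed: "\<And>xs x ls l. \<lbrakk>\<And>k. xs k \<in> S; \<And>k. ls k \<in> L; \<And>k. R (xs k) (ls k); x \<in> S; l \<in> L;
      xs \<longlonglongrightarrow> x; ls \<longlonglongrightarrow> l\<rbrakk> \<Longrightarrow> R x l"
    and gf: "\<And>x l. x \<in> S \<Longrightarrow> l \<in> L \<Longrightarrow> R x l \<Longrightarrow> g (x, l) = f x"
    and g: "continuous_on (S \<times> L) g"
  shows "continuous_on S f"
proof (rule continuous_on_sequentiallyI)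
  fix xs x assume xs: "\<forall>n. xs n \<in> S" and x: "x \<in> S" and lim: "xs \<longlonglongrightarrow> x"
  show "(\<lambda>n. f (xs n)) \<longlonglongrightarrow> f x"
  proof (rule ccontr)
    assume "\<not> ?thesis"
    then obtain e where e: "e > 0" "\<exists>\<^sub>F n in sequentially. dist (f (xs n)) (f x) \<ge> e"
      unfolding tendsto_iff by (auto simp: frequently_def not_le)
    obtain r :: "nat \<Rightarrow> nat" where r: "strict_mono r" "\<And>n. dist (f (xs (r n))) (f x) \<ge> e"
      using e(2) unfolding cofinite_eq_sequentially[symmetric] frequently_cofinite
      using infinite_enumerate by blast
    have "\<forall>n. \<exists>l\<in>L. R (xs (r n)) l" using ex xs by blast
    then obtain ls where ls: "\<And>n. ls n \<in> L" "\<And>n. R (xs (r n)) (ls n)" by metis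
    obtain l s where l: "l \<in> L" "strict_mono s" "(ls \<circ> s) \<longlonglongrightarrow> l"
      using L ls(1) unfolding compact_eq_seq_compact_metric by (metis seq_compactE)
    have lim': "(\<lambda>n. xs (r (s n))) \<longlonglongrightarrow> x"
      using LIMSEQ_subseq_LIMSEQ[OF LIMSEQ_subseq_LIMSEQ[OF lim r(1)] l(2)] by (simp add: o_def)
    have R: "R x l"
      by (rule closed[of "\<lambda>n. xs (r (s n))" "\<lambda>n. ls (s n)"]) (use xs ls x l lim' in \<open>auto simp: o_def\<close>)
    have "(\<lambda>n. g (xs (r (s n)), ls (s n))) \<longlonglongrightarrow> g (x, l)"
      by (rule continuous_on_tendsto_compose[OF g tendsto_Pair[OF lim']])
         (use xs ls x l in \<open>auto simp: o_def\<close>)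
    then have "(\<lambda>n. f (xs (r (s n)))) \<longlonglongrightarrow> f x" using gf xs ls x l(1) R by simp
    then obtain n where "dist (f (xs (r (s n)))) (f x) < e"
      using e(1) by (metis (no_types, lifting) LIMSEQ_iff_nz lim_sequentially order_refl)
    with r(2)[of "s n"] show False by simp
  qed
qed

section \<open>Fattened hulls and their nearest points\<close>

definition simplex :: "nat \<Rightarrow> (nat \<Rightarrow> real) set" where
  "simplex B = {w. (\<forall>b. 0 \<le> w b) \<and> (\<forall>b\<ge>B. w b = 0) \<and> (\<Sum>b<B. w b) = 1}"

lemma compact_simplex: "compact (simplex B)"
proof -
  let ?A = "{w. \<forall>b. w b \<in> {0..if b < B then 1 else 0::real}}"
  have "simplex B = ?A \<inter> {w. (\<Sum>b<B. w b) = 1}"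
  proof (rule Set.set_eqI)
    fix w :: "nat \<Rightarrow> real"
    have "w b \<le> 1" if "\<forall>b. 0 \<le> w b" "(\<Sum>b<B. w b) = 1" "b < B" for b
      using member_le_sum[of b "{..<B}" w] that by auto
    then show "w \<in> simplex B \<longleftrightarrow> w \<in> ?A \<inter> {w. (\<Sum>b<B. w b) = 1}"
      by (auto simp: simplex_def antisym not_less split: if_splits)
  qed
  moreover have "closed {w::nat \<Rightarrow> real. (\<Sum>b<B. w b) = 1}"
    by (intro closed_Collect_eq continuous_on_sum continuous_on_product_coordinates continuous_on_const)
  moreover have "compact ?A" by (rule compact_fun_box) auto
  ultimately show ?thesis by (simp add: compact_Int_closed)
qed

lemma simplex_mid: "w \<in> simplex B \<Longrightarrow> w' \<in> simplex B \<Longrightarrow> (\<lambda>b. (w b + w' b) / 2) \<in> simplex B"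
  by (auto simp: simplex_def sum.distrib sum_divide_distrib[symmetric])

text \<open>A vector \<open>\<xi>\<close> encodes the convex set of all points whose maximum distance to the hull of
  \<open>B\<close> points of \<open>\<real>\<^sup>n\<close> is at most \<open>\<xi> 0\<close>. Every vector is a code, which
  makes the projection onto the encoded set meaningful for arbitrary answers of robust division.\<close>

definition blend :: "nat \<Rightarrow> nat \<Rightarrow> (nat \<Rightarrow> real) \<Rightarrow> (nat \<Rightarrow> real) \<times> (nat \<Rightarrow> real) \<Rightarrow> nat \<Rightarrow> real" where
  "blend n B \<xi> l = (\<lambda>i. if i < n then (\<Sum>b<B. fst l b * \<xi> (Suc (b * n + i))) + \<xi> 0 * snd l i else 0)"

definition weights :: "nat \<Rightarrow> ((nat \<Rightarrow> real) \<times> (nat \<Rightarrow> real)) set" where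
  "weights B = simplex B \<times> {s. \<forall>i. s i \<in> {-1..1}}"

text \<open>As \<open>\<xi>\<close> varies, the set is parametrised over the fixed compact space
  \<open>weights B\<close>, where minima and limits can be taken. Entry \<open>b * n + i\<close>
  after the radius is coordinate \<open>i\<close> of point \<open>b\<close>; the symmetric range of
  the displacements makes a negative radius harmless.\<close>

definition fat_hull :: "nat \<Rightarrow> nat \<Rightarrow> (nat \<Rightarrow> real) \<Rightarrow> (nat \<Rightarrow> real) set" where
  "fat_hull n B \<xi> = blend n B \<xi> ` weights B"

text \<open>The Euclidean distance is strictly convex, which makes nearest points unique, although
  the fattening is measured in the maximum norm.\<close>

definition sqdist :: "nat \<Rightarrow> (nat \<Rightarrow> real) \<Rightarrow> (nat \<Rightarrow> real) \<Rightarrow> real" where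
  "sqdist n x y = (\<Sum>i<n. (x i - y i)\<^sup>2)"

definition nearest :: "nat \<Rightarrow> nat \<Rightarrow> (nat \<Rightarrow> real) \<times> (nat \<Rightarrow> real) \<Rightarrow> nat \<Rightarrow> real" where
  "nearest n B = (\<lambda>(\<xi>, z). SOME y. y \<in> fat_hull n B \<xi> \<and> (\<forall>y'\<in>fat_hull n B \<xi>. sqdist n z y \<le> sqdist n z y'))"

lemma compact_weights: "compact (weights B)"
  unfolding weights_def by (intro compact_Times compact_simplex compact_fun_box) auto

lemma weights_nonempty: "B > 0 \<Longrightarrow> weights B \<noteq> {}"
proof -
  assume "B > 0"
  then have "((\<lambda>b. if b = 0 then 1 else 0), (\<lambda>_. 0)) \<in> weights B"
    by (auto simp: weights_def simplex_def)
  then show ?thesis by blast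
qed

lemma continuous_on_blend:
  assumes "continuous_on S \<xi>" "continuous_on S l"
  shows "continuous_on S (\<lambda>x. blend n B (\<xi> x) (l x))"
proof (rule continuous_on_coordinatewise_then_product)
  fix i
  have "continuous_on S (\<lambda>x. \<xi> x c)" "continuous_on S (\<lambda>x. fst (l x) c)"
    "continuous_on S (\<lambda>x. snd (l x) c)" for c
    using assms by (auto intro!: continuous_on_product_then_coordinatewise continuous_on_fst continuous_on_snd)
  then show "continuous_on S (\<lambda>x. blend n B (\<xi> x) (l x) i)"
    by (cases "i < n") (auto simp: blend_def intro!: continuous_intros)
qed

lemma continuous_on_sqdist:
  assumes "continuous_on S f" "continuous_on S g"
  shows "continuous_on S (\<lambda>x. sqdist n (f x) (g x))"
proof -
  have "continuous_on S (\<lambda>x. f x i)" "continuous_on S (\<lambda>x. g x i)" for i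
    using assms by (auto intro!: continuous_on_product_then_coordinatewise)
  then show ?thesis unfolding sqdist_def by (intro continuous_intros)
qed

lemma nearest_exists:
  assumes "B > 0"
  shows "\<exists>l\<in>weights B. \<forall>l'\<in>weights B. sqdist n z (blend n B \<xi> l) \<le> sqdist n z (blend n B \<xi> l')"
  by (rule continuous_attains_inf[OF compact_weights weights_nonempty[OF assms]])
     (intro continuous_on_sqdist continuous_on_blend continuous_intros)

text \<open>Averaging weights and displacements averages the blended points. Midpoints are all the
  convexity that uniqueness of nearest points requires.\<close>

lemma fat_hull_mid:
  assumes "y \<in> fat_hull n B \<xi>" "y' \<in> fat_hull n B \<xi>"
  shows "(\<lambda>i. (y i + y' i) / 2) \<in> fat_hull n B \<xi>"
proof -
  obtain w s w' s' where *: "y = blend n B \<xi> (w, s)" "y' = blend n B \<xi> (w', s')"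
    "(w, s) \<in> weights B" "(w', s') \<in> weights B"
    using assms by (auto simp: fat_hull_def)
  have "((\<lambda>b. (w b + w' b) / 2), (\<lambda>i. (s i + s' i) / 2)) \<in> weights B"
    using *(3,4) simplex_mid by (auto simp: weights_def) (smt (verit) field_sum_of_halves)+
  moreover have "(\<lambda>i. (y i + y' i) / 2) =
      blend n B \<xi> ((\<lambda>b. (w b + w' b) / 2), (\<lambda>i. (s i + s' i) / 2))"
    by (auto simp: * blend_def fun_eq_iff field_simps sum.distrib sum_divide_distrib[symmetric] sum_distrib_left)
  ultimately show ?thesis by (auto simp: fat_hull_def)
qed

lemma fat_hull_zero: "y \<in> fat_hull n B \<xi> \<Longrightarrow> i \<ge> n \<Longrightarrow> y i = 0"
  by (auto simp: fat_hull_def blend_def)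

text \<open>Parallelogram law: the midpoint \<open>m\<close> of two distinct minimisers would lie
  strictly closer to \<open>z\<close>. Hull points vanish from coordinate \<open>n\<close> on, so
  agreement below \<open>n\<close> suffices.\<close>

lemma nearest_unique:
  assumes y: "y \<in> fat_hull n B \<xi>" "\<And>v. v \<in> fat_hull n B \<xi> \<Longrightarrow> sqdist n z y \<le> sqdist n z v"
    and y': "y' \<in> fat_hull n B \<xi>" "\<And>v. v \<in> fat_hull n B \<xi> \<Longrightarrow> sqdist n z y' \<le> sqdist n z v"
  shows "y = y'"
proof -
  define m where "m = (\<lambda>i. (y i + y' i) / 2)"
  have "sqdist n y y' = 2 * sqdist n z y + 2 * sqdist n z y' - 4 * sqdist n z m"
    unfolding sqdist_def sum_distrib_left sum.distrib[symmetric] sum_subtractf[symmetric] m_def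
    by (intro sum.cong refl) (simp add: power2_eq_square field_simps)
  moreover have "sqdist n z y \<le> sqdist n z m" "sqdist n z y' \<le> sqdist n z m"
    using assms fat_hull_mid[OF y(1) y'(1)] by (auto simp: m_def)
  moreover have "sqdist n z y = sqdist n z y'" using y y' by (intro antisym) auto
  ultimately have "sqdist n y y' \<le> 0" by simp
  then have "(\<Sum>i<n. (y i - y' i)\<^sup>2) = 0" unfolding sqdist_def by (intro antisym sum_nonneg) auto
  then have "\<forall>i<n. y i = y' i" by (subst (asm) sum_nonneg_eq_0_iff) auto
  then show ?thesis using fat_hull_zero[OF y(1)] fat_hull_zero[OF y'(1)]
    by (metis linorder_not_le ext)
qed

lemma nearest:
  assumes "B > 0"
  shows "nearest n B (\<xi>, z) \<in> fat_hull n B \<xi>"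
    and "v \<in> fat_hull n B \<xi> \<Longrightarrow> sqdist n z (nearest n B (\<xi>, z)) \<le> sqdist n z v"
proof -
  have "\<exists>y. y \<in> fat_hull n B \<xi> \<and> (\<forall>y'\<in>fat_hull n B \<xi>. sqdist n z y \<le> sqdist n z y')"
    using nearest_exists[OF assms, of n z \<xi>] by (auto simp: fat_hull_def)
  from someI_ex[OF this]
  show "nearest n B (\<xi>, z) \<in> fat_hull n B \<xi>"
    "v \<in> fat_hull n B \<xi> \<Longrightarrow> sqdist n z (nearest n B (\<xi>, z)) \<le> sqdist n z v"
    by (auto simp: nearest_def)
qed

lemma nearest_fixed_iff:
  assumes "B > 0"
  shows "nearest n B (\<xi>, z) = z \<longleftrightarrow> z \<in> fat_hull n B \<xi>"
proof
  assume z: "z \<in> fat_hull n B \<xi>"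
  show "nearest n B (\<xi>, z) = z"
    by (rule nearest_unique[of _ n B \<xi> z]) (use nearest[OF assms] z in \<open>auto simp: sqdist_def intro: sum_nonneg\<close>)
qed (use nearest(1)[OF assms] in metis)

text \<open>The minimising weights may be ambiguous but the nearest point is not, so compactness of
  \<open>weights B\<close> gives continuity jointly in the code and in the projected point.\<close>

lemma continuous_on_nearest:
  assumes B: "B > 0"
  shows "continuous_on UNIV (nearest n B)"
proof (rule continuous_on_compact_witness[OF compact_weights[of B],
      where R = "\<lambda>x l. \<forall>l'\<in>weights B. sqdist n (snd x) (blend n B (fst x) l)
          \<le> sqdist n (snd x) (blend n B (fst x) l')"
        and g = "\<lambda>x. blend n B (fst (fst x)) (snd x)"])
  fix x :: "(nat \<Rightarrow> real) \<times> (nat \<Rightarrow> real)"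
  show "\<exists>l\<in>weights B. \<forall>l'\<in>weights B. sqdist n (snd x) (blend n B (fst x) l)
          \<le> sqdist n (snd x) (blend n B (fst x) l')"
    using nearest_exists[OF B] by blast
next
  fix x :: "(nat \<Rightarrow> real) \<times> (nat \<Rightarrow> real)" and l
  assume "l \<in> weights B" "\<forall>l'\<in>weights B. sqdist n (snd x) (blend n B (fst x) l)
          \<le> sqdist n (snd x) (blend n B (fst x) l')"
  then show "blend n B (fst (fst (x, l))) (snd (x, l)) = nearest n B x"
    using nearest[OF B, where n = n and \<xi> = "fst x" and z = "snd x"]
    by (intro nearest_unique[of _ n B "fst x" "snd x"]) (auto simp: fat_hull_def)
next
  show "continuous_on (UNIV \<times> weights B) (\<lambda>x. blend n B (fst (fst x)) (snd x))"
    by (intro continuous_on_blend continuous_intros)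
next
  fix xs :: "nat \<Rightarrow> (nat \<Rightarrow> real) \<times> (nat \<Rightarrow> real)" and x ls l
  assume *: "\<And>k. \<forall>l'\<in>weights B. sqdist n (snd (xs k)) (blend n B (fst (xs k)) (ls k))
      \<le> sqdist n (snd (xs k)) (blend n B (fst (xs k)) l')"
    and lim: "xs \<longlonglongrightarrow> x" "ls \<longlonglongrightarrow> l"
  have cont: "continuous_on UNIV (\<lambda>(x, l). sqdist n (snd x) (blend n B (fst x) l))"
    unfolding case_prod_beta by (intro continuous_on_sqdist continuous_on_blend continuous_intros)
  show "\<forall>l'\<in>weights B. sqdist n (snd x) (blend n B (fst x) l)
      \<le> sqdist n (snd x) (blend n B (fst x) l')"
  proof
    fix l' assume l': "l' \<in> weights B"
    show "sqdist n (snd x) (blend n B (fst x) l) \<le> sqdist n (snd x) (blend n B (fst x) l')"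
    proof (rule LIMSEQ_le)
      show "(\<lambda>k. sqdist n (snd (xs k)) (blend n B (fst (xs k)) (ls k)))
          \<longlonglongrightarrow> sqdist n (snd x) (blend n B (fst x) l)"
        using continuous_on_tendsto_compose[OF cont tendsto_Pair[OF lim]] by simp
      show "(\<lambda>k. sqdist n (snd (xs k)) (blend n B (fst (xs k)) l'))
          \<longlonglongrightarrow> sqdist n (snd x) (blend n B (fst x) l')"
        using continuous_on_tendsto_compose[OF cont tendsto_Pair[OF lim(1) tendsto_const[of l']]] by simp
      show "\<exists>N. \<forall>k\<ge>N. sqdist n (snd (xs k)) (blend n B (fst (xs k)) (ls k))
          \<le> sqdist n (snd (xs k)) (blend n B (fst (xs k)) l')"
        using * l' by blast
    qed
  qed
qed

text \<open>A summable family of Urysohn functions turns the pointwise condition near \<open>A\<close> into a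
  continuous majorant that vanishes on \<open>A\<close>.\<close>

lemma continuous_gauge:
  fixes Q :: "'a::metric_space \<Rightarrow> real \<Rightarrow> bool"
  assumes mono: "\<And>q s t. q \<in> U \<Longrightarrow> Q q s \<Longrightarrow> s \<le> t \<Longrightarrow> Q q t" and one: "\<And>q. q \<in> U \<Longrightarrow> Q q 1"
    and A: "closedin (top_of_set U) A"
    and near: "\<And>a e. a \<in> A \<Longrightarrow> e > 0 \<Longrightarrow> \<exists>d>0. \<forall>q\<in>U. dist q a < d \<longrightarrow> Q q e"
  obtains h where "continuous_on U h" "\<And>q. h q \<in> {0..1}" "\<And>a. a \<in> A \<Longrightarrow> h a = 0"
    "\<And>q. q \<in> U - A \<Longrightarrow> Q q (h q)"
proof -
  \<comment> \<open>The parameters where the tolerance \<open>(1/2)^k\<close> is too small.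
    Assumption \<open>near\<close> keeps even the closure of this set away from
    \<open>A\<close>.\<close>
  define C where "C k = {q \<in> U. \<not> Q q ((1/2)^k)}" for k :: nat
  \<comment> \<open>The default 1 matters, because \<open>infdist\<close> to the empty set is
    0.\<close>
  define D where "D S p = (if S = {} then 1 else infdist p S)" for S :: "'a set" and p
  have D: "D S p \<ge> 0" "D S p = 0 \<longleftrightarrow> p \<in> closure S" for S p
    using in_closure_iff_infdist_zero[of S p] by (simp_all add: D_def infdist_nonneg)
  have contD: "continuous_on T (D S)" for S T
    unfolding D_def by (cases "S = {}") (simp_all add: continuous_on_infdist)
  have disj: "p \<notin> closure (C k)" if pA: "p \<in> A" for p k
  proof
    assume "p \<in> closure (C k)"
    moreover obtain d where "d > 0" "\<forall>q\<in>U. dist q p < d \<longrightarrow> Q q ((1/2)^k)"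
      using near[OF pA, of "(1/2)^k"] by auto
    ultimately show False unfolding closure_approachable C_def by blast
  qed
  have clA: "p \<in> A" if "p \<in> U" "p \<in> closure A" for p
    using A that by (metis Int_iff closedin_closed closure_minimal inf.cobounded2 subsetD)
  have pos: "D A p + D (C k) p > 0" if "p \<in> U" for p k
    using D[of A p] D[of "C k" p] clA[OF that] disj by (metis add_nonneg_eq_0_iff add_nonneg_nonneg less_eq_real_def)
  define th where "th k p = D A p / (D A p + D (C k) p)" for k p
  have th01: "th k p \<in> {0..1}" if "p \<in> U" for k p
    using D(1)[of A p] D(1)[of "C k" p] pos[OF that, of k] by (simp add: th_def divide_le_eq)
  have thA: "th k p = 0" if "p \<in> A" for k p
    using that D(2)[of A p] closure_subset[of A] by (auto simp: th_def)
  have thC: "th k p = 1" if "p \<in> C k" for k p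
    using that D(2)[of "C k" p] closure_subset[of "C k"] pos[of p k] by (auto simp: th_def C_def)
  have thpos: "th k p > 0" if "p \<in> U - A" for k p
    using that D[of A p] clA pos[of p k] by (auto simp: th_def intro!: divide_pos_pos)
  have contth: "continuous_on U (th k)" for k
    unfolding th_def using pos by (intro continuous_intros contD) (metis less_irrefl)
  define g where "g p = (\<Sum>k. (1/2)^k * th k p)" for p
  have sumg: "summable (\<lambda>k. (1/2::real)^k)" by (simp add: summable_geometric)
  have bound: "norm ((1/2)^k * th k p) \<le> (1/2::real)^k" if "p \<in> U" for k p
    using th01[OF that, of k] by (simp add: abs_mult mult_left_le)
  have summ: "summable (\<lambda>k. (1/2)^k * th k p)" if "p \<in> U" for p
    by (rule summable_comparison_test'[OF sumg, of 0]) (use bound[OF that] in auto)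
  have contg: "continuous_on U g"
    unfolding g_def
    by (rule uniform_limit_theorem[OF _ Weierstrass_m_test[where M = "\<lambda>k. (1/2)^k"]])
       (use bound sumg in \<open>auto intro!: always_eventually continuous_intros contth\<close>)
  have gnn: "g p \<ge> 0" if "p \<in> U" for p
    unfolding g_def using th01[OF that] by (intro suminf_nonneg[OF summ[OF that]]) auto
  define h where "h p = (if p \<in> U then min 1 (g p) else 0)" for p
  show thesis
  proof
    have "continuous_on U (\<lambda>p. min 1 (g p))" by (intro continuous_intros contg)
    then show "continuous_on U h" by (rule continuous_on_eq) (simp add: h_def)
    show "h q \<in> {0..1}" for q using gnn by (auto simp: h_def)
    show "h a = 0" if "a \<in> A" for a
      using thA[OF that] by (auto simp: h_def g_def)
    fix q assume q: "q \<in> U - A"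
    have gpos: "g q > 0"
      unfolding g_def using th01 q thpos[OF q]
      by (intro suminf_pos2[OF summ, of _ 0]) auto
    show "Q q (h q)"
    proof (cases "\<exists>k. \<not> Q q ((1/2)^k)")
      case False
      \<comment> \<open>If no power of 1/2 fails at \<open>q\<close>, every positive tolerance is
        valid there, and \<open>g q\<close> is positive off \<open>A\<close>.\<close>
      obtain k where "(1/2)^k < h q"
        using real_arch_pow_inv[of "h q" "1/2"] gpos q by (auto simp: h_def)
      then show ?thesis using mono[of q "(1/2)^k" "h q"] False q by auto
    next
      case True
      \<comment> \<open>\<open>(1/2)^i\<close> with \<open>i = j - 1\<close> is the last power known
        to be valid. By monotonicity \<open>(1/2)^k\<close> fails for all \<open>k \<ge> j\<close>,
        so these terms of the series are full and add up to
        \<open>2 * (1/2)^j = (1/2)^i\<close>.\<close>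
      define j where "j = (LEAST k. \<not> Q q ((1/2)^k))"
      have j: "\<not> Q q ((1/2)^j)" unfolding j_def using True by (rule LeastI_ex)
      have "j \<noteq> 0" using j one[of q] q by (cases j) auto
      then obtain i where i: "j = Suc i" by (cases j) auto
      have Qi: "Q q ((1/2)^i)" using not_less_Least[of i "\<lambda>k. \<not> Q q ((1/2)^k)"] i by (auto simp: j_def)
      have nQ: "\<not> Q q ((1/2)^(k + j))" for k
        using j mono[of q "(1/2)^(k+j)" "(1/2)^j"] q power_decreasing[of j "k+j" "1/2::real"] by auto
      then have "th (k + j) q = 1" for k using q by (intro thC) (auto simp: C_def)
      then have "(\<Sum>k. (1/2)^(k+j) * th (k + j) q) = (\<Sum>k. (1/2)^j * (1/2::real)^k)"
        by (simp add: power_add mult.commute)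
      also have "\<dots> = (1/2)^j * 2"
        by (subst suminf_mult[OF sumg]) (simp add: suminf_geometric)
      also have "\<dots> = (1/2)^i" by (simp add: i)
      finally have "(1/2)^i = (\<Sum>k. (1/2)^(k+j) * th (k + j) q)" by simp
      also have "\<dots> = g q - (\<Sum>k<j. (1/2)^k * th k q)"
        unfolding g_def using suminf_minus_initial_segment[OF summ, of q j] q by auto
      also have "\<dots> \<le> g q" using th01[of q] q by (auto intro!: sum_nonneg)
      finally have "(1/2)^i \<le> h q" using q by (auto simp: h_def power_le_one)
      then show ?thesis using mono Qi q by blast
    qed
  qed
qed

text \<open>Off the closed set \<open>C\<close> the function \<open>\<phi>\<close> is recovered by robust division; multiplying it
  with the distance to \<open>C\<close> makes it continuous everywhere.\<close>

lemma robust_fraction: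
  fixes f :: "'a::metric_space \<Rightarrow> real"
  assumes C: "closed C" and f: "continuous_on (- C) f" "\<And>p. p \<notin> C \<Longrightarrow> f p \<in> {0..1}"
  obtains u v where "continuous_on UNIV u" "continuous_on UNIV v" "\<And>p. 0 \<le> u p" "\<And>p. u p \<le> v p"
    "\<And>p. p \<notin> C \<Longrightarrow> v p > 0 \<and> u p / v p = f p"
proof -
  \<comment> \<open>For empty \<open>C\<close> the denominator has to be positive everywhere, hence
    the default 1.\<close>
  define v where "v p = (if C = {} then 1 else infdist p C)" for p
  define u where "u p = (if p \<in> C then 0 else v p * f p)" for p
  have contv: "continuous_on UNIV v" unfolding v_def by (cases "C = {}") (simp_all add: continuous_on_infdist)
  have v0: "v p \<ge> 0" for p by (simp add: v_def infdist_nonneg)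
  have vC: "v p = 0 \<longleftrightarrow> p \<in> C" for p
    using in_closed_iff_infdist_zero[OF C, of p] by (simp add: v_def)
  have uv: "0 \<le> u p" "u p \<le> v p" for p
    using f(2)[of p] v0[of p] by (auto simp: u_def mult_left_le)
  have "isCont u p" for p
  proof (cases "p \<in> C")
    case True
    have "(u \<longlongrightarrow> 0) (at p)"
    proof (rule tendsto_sandwich[of "\<lambda>_. 0" _ _ v])
      show "(v \<longlongrightarrow> 0) (at p)"
        using contv True vC by (metis continuous_on_eq_continuous_at isCont_def open_UNIV UNIV_I)
    qed (use uv in auto)
    then show ?thesis using True by (simp add: isCont_def u_def)
  next
    case False
    have "continuous_on (- C) (\<lambda>p. v p * f p)"
      by (intro continuous_intros f continuous_on_subset[OF contv]) auto
    then have "continuous_on (- C) u" by (rule continuous_on_eq) (simp add: u_def)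
    then show ?thesis using False C by (simp add: continuous_on_eq_continuous_at open_Compl)
  qed
  then have "continuous_on UNIV u" by (simp add: continuous_at_imp_continuous_on)
  moreover have "v p > 0 \<and> u p / v p = f p" if "p \<notin> C" for p
    using that vC[of p] v0[of p] by (auto simp: u_def)
  ultimately show thesis using that contv uv by blast
qed

section \<open>Selection on strata\<close>

text \<open>For a nonnegative radius the displacement can be solved for: divide the deviation by
  \<open>\<xi> 0\<close>, or take 0 when the radius vanishes.\<close>

lemma fat_hull_iff:
  assumes "0 \<le> \<xi> 0"
  shows "z \<in> fat_hull n B \<xi> \<longleftrightarrow> (\<forall>i\<ge>n. z i = 0) \<and>
    (\<exists>w\<in>simplex B. \<forall>i<n. \<bar>z i - (\<Sum>b<B. w b * \<xi> (Suc (b * n + i)))\<bar> \<le> \<xi> 0)" (is "_ \<longleftrightarrow> ?R")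
proof
  assume "z \<in> fat_hull n B \<xi>"
  then obtain w t where "w \<in> simplex B" and t: "\<forall>i. t i \<in> {-1..1::real}" and z: "z = blend n B \<xi> (w, t)"
    by (auto simp: fat_hull_def weights_def)
  moreover have "\<bar>\<xi> 0 * t i\<bar> \<le> \<xi> 0" for i
    using t assms by (auto simp: abs_mult abs_le_iff intro!: mult_left_le)
  ultimately show ?R by (auto simp: z blend_def intro!: bexI[of _ w])
next
  assume ?R
  then obtain w where w: "w \<in> simplex B"
    "\<forall>i<n. \<bar>z i - (\<Sum>b<B. w b * \<xi> (Suc (b * n + i)))\<bar> \<le> \<xi> 0" and z: "\<forall>i\<ge>n. z i = 0" by blast
  define t where "t i = (if i < n then (z i - (\<Sum>b<B. w b * \<xi> (Suc (b * n + i)))) / \<xi> 0 else 0)" for i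
  have "t i \<in> {-1..1}" for i
  proof (cases "i < n \<and> \<xi> 0 \<noteq> 0")
    case True
    then show ?thesis using w(2)[rule_format, of i] assms
      by (auto simp: t_def abs_le_iff divide_le_eq le_divide_eq)
  qed (auto simp: t_def)
  moreover have "z = blend n B \<xi> (w, t)"
  proof
    fix i show "z i = blend n B \<xi> (w, t) i"
      using w(2)[rule_format, of i] z by (cases "\<xi> 0 = 0") (auto simp: blend_def t_def)
  qed
  ultimately show "z \<in> fat_hull n B \<xi>" using w(1)
    by (auto simp: fat_hull_def weights_def intro!: image_eqI[of _ _ "(w, t)"])
qed

lemma simplex_average:
  assumes "w \<in> simplex B" "\<And>b. b < B \<Longrightarrow> x b \<in> {0..1}"
  shows "(\<Sum>b<B. w b * x b) \<in> {0..1}"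
proof -
  have "(\<Sum>b<B. w b * x b) \<le> (\<Sum>b<B. w b)"
    using assms by (intro sum_mono mult_left_le) (auto simp: simplex_def)
  then show ?thesis using assms by (auto simp: simplex_def intro!: sum_nonneg)
qed

lemma code_index: "i < n \<Longrightarrow> (b * n + i) div n = b" "i < n \<Longrightarrow> (b * n + i) mod n = i" for b i n :: nat
  by auto

lemma code_index_le: "b < B \<Longrightarrow> i < n \<Longrightarrow> Suc (b * n + i) \<le> B * n" for b i n :: nat
proof -
  assume "b < B" "i < n"
  then have "b * n + n \<le> B * n" by (metis add.commute mult_Suc mult_le_mono1 Suc_leI)
  then show ?thesis using \<open>i < n\<close> by simp
qed

text \<open>The level \<open>lev p\<close> says which answers can be trusted: those at levels below \<open>lev p\<close> are
  arbitrary, the answer at level \<open>lev p\<close> encodes \<open>P p\<close>, and those above encode supersets of \<open>P p\<close>.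
  Projecting successively onto the sets at the levels \<open>0, \<dots>, lev p\<close> is continuous, because at a limit
  of parameters of smaller level \<open>i\<close> the projections above \<open>i\<close> have no effect.\<close>

lemma stratified_selection:
  fixes P :: "'x::{metric_space,second_countable_topology} \<Rightarrow> (nat \<Rightarrow> real) set"
    and lev :: "'x \<Rightarrow> nat" and V :: "'x \<Rightarrow> nat \<Rightarrow> nat \<Rightarrow> real"
  assumes B: "B > 0" and levR: "\<And>p. lev p \<le> R" and lev: "\<And>l. closed {p. l \<le> lev p}" and Z: "closed Z"
    and PV: "\<And>p. p \<in> Z \<Longrightarrow>
      P p = {z. \<exists>w\<in>simplex B. z = (\<lambda>i. if i < n then \<Sum>b<B. w b * V p b i else 0)}"
    and V01: "\<And>p b i. V p b i \<in> {0..1}"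
    and Vcont: "\<And>l b i. b < B \<Longrightarrow> i < n \<Longrightarrow> continuous_on {p \<in> Z. lev p = l} (\<lambda>p. V p b i)"
    and closedP: "\<And>ps zs p z. \<lbrakk>\<And>k. ps k \<in> Z; \<And>k. zs k \<in> P (ps k); ps \<longlonglongrightarrow> p; zs \<longlonglongrightarrow> z; p \<in> Z\<rbrakk> \<Longrightarrow> z \<in> P p"
  obtains u v :: "nat \<Rightarrow> nat \<Rightarrow> 'x \<Rightarrow> real" and F :: "'x \<times> (nat \<Rightarrow> nat \<Rightarrow> real) \<Rightarrow> nat \<Rightarrow> real"
  where "\<And>l c. continuous_on UNIV (u l c)" "\<And>l c. continuous_on UNIV (v l c)"
    "\<And>l c p. 0 \<le> u l c p" "\<And>l c p. u l c p \<le> v l c p"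
    "continuous_on {(p, r). p \<in> Z \<and> (\<forall>l\<le>R. \<forall>c\<le>B*n. v l c p > 0 \<longrightarrow> r l c = u l c p / v l c p)} F"
    "\<And>p r. p \<in> Z \<Longrightarrow> \<forall>l\<le>R. \<forall>c\<le>B*n. v l c p > 0 \<longrightarrow> r l c = u l c p / v l c p \<Longrightarrow> F (p, r) \<in> P p"
proof -
  define U where "U l = {p. lev p \<le> l}" for l
  define A where "A l = {p \<in> Z. lev p = l}" for l
  have U: "U l = - {p. Suc l \<le> lev p}" for l by (auto simp: U_def)
  \<comment> \<open>Within the open set \<open>U l\<close> the level \<open>l\<close> is the largest
    one, so attaining it is a closed condition.\<close>
  have clA: "closedin (top_of_set (U l)) (A l)" for l
  proof -
    have "A l = U l \<inter> (Z \<inter> {p. l \<le> lev p})" by (auto simp: A_def U_def)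
    then show ?thesis using closed_Int[OF Z lev[of l]] by (simp add: closedin_closed_Int)
  qed
  \<comment> \<open>The vertices on \<open>A l\<close> are extended to \<open>U l\<close> with
    values in the convex set \<open>{0..1}\<close>. Off \<open>A l\<close> the extension says
    nothing about \<open>P\<close>; the radius of the code has to compensate for that.\<close>
  define ext where "ext l b i f \<longleftrightarrow> continuous_on (U l) f \<and> f ` U l \<subseteq> {0..1::real} \<and> (\<forall>p\<in>A l. f p = V p b i)"
    for l b i f
  have ext: "\<exists>f. ext l b i f" if bi: "b < B" "i < n" for l b i
  proof -
    have cont: "continuous_on (A l) (\<lambda>p. V p b i)" using Vcont[OF bi] by (simp add: A_def)
    show ?thesis
      by (rule Dugundji[where C = "{0..1::real}", OF _ _ clA cont]) (use V01 in \<open>auto simp: ext_def\<close>)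
  qed
  define f where "f l b i = (SOME f. ext l b i f)" for l b i
  have fext: "ext l b i (f l b i)" if "b < B" "i < n" for l b i
    unfolding f_def using ext[OF that] by (rule someI_ex)
  have f: "b < B \<Longrightarrow> i < n \<Longrightarrow> continuous_on (U l) (f l b i)"
     "b < B \<Longrightarrow> i < n \<Longrightarrow> p \<in> U l \<Longrightarrow> f l b i p \<in> {0..1}"
     "b < B \<Longrightarrow> i < n \<Longrightarrow> p \<in> A l \<Longrightarrow> f l b i p = V p b i" for l b i p
    using fext[of b i l] by (auto simp: ext_def)
  define code where "code l h p c = (if c = 0 then h else if c \<le> B * n then
      f l ((c - 1) div n) ((c - 1) mod n) p else (0::real))" for l h p c
  have code_Suc: "code l h p (Suc (b * n + i)) = f l b i p" if "b < B" "i < n" for l h p b i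
    using code_index[OF that(2), of b] code_index_le[OF that] by (simp add: code_def)
  have code_pos: "(c - 1) div n < B \<and> (c - 1) mod n < n" if "c \<noteq> 0" "c \<le> B * n" for c
    using that by (cases "n = 0") (auto simp: less_mult_imp_div_less)
  have mem: "z \<in> fat_hull n B (code l h p) \<longleftrightarrow> (\<forall>i\<ge>n. z i = 0) \<and>
      (\<exists>w\<in>simplex B. \<forall>i<n. \<bar>z i - (\<Sum>b<B. w b * f l b i p)\<bar> \<le> h)" if "h \<ge> 0" for z l h p
  proof -
    have "(\<Sum>b<B. w b * code l h p (Suc (b * n + i))) = (\<Sum>b<B. w b * f l b i p)" if "i < n" for w i
      using that by (intro sum.cong) (auto simp: code_Suc)
    moreover have "code l h p 0 = h" by (simp add: code_def)
    ultimately show ?thesis using that by (simp add: fat_hull_iff cong: conj_cong)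
  qed
  have P01: "z i \<in> {0..1} \<and> (i \<ge> n \<longrightarrow> z i = 0)" if "z \<in> P p" "p \<in> Z" for z p i
    using that PV[OF that(2)] simplex_average[of _ B "\<lambda>b. V p b i"] V01 by auto
  have exact: "fat_hull n B (code l 0 p) = P p" if "p \<in> A l" for l p
  proof -
    have "z \<in> fat_hull n B (code l 0 p) \<longleftrightarrow> z \<in> P p" for z
    proof -
      have "p \<in> Z" using that by (simp add: A_def)
      have *: "(\<Sum>b<B. w b * f l b i p) = (\<Sum>b<B. w b * V p b i)" if "i < n" for i w
        using f(3)[OF _ that \<open>p \<in> A l\<close>] by (intro sum.cong) auto
      show ?thesis unfolding mem[OF order_refl] PV[OF \<open>p \<in> Z\<close>]
        by (auto simp: * fun_eq_iff not_less)
    qed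
    then show ?thesis by blast
  qed
  define Q where "Q l q t \<longleftrightarrow> 0 \<le> t \<and> (q \<in> Z \<longrightarrow> P q \<subseteq> fat_hull n B (code l t q))" for l q t
  have "\<exists>h. continuous_on (U l) h \<and> (\<forall>q. h q \<in> {0..1}) \<and> (\<forall>a\<in>A l. h a = 0) \<and> (\<forall>q\<in>U l - A l. Q l q (h q))" for l
  proof -
    have Qmono: "Q l q t" if "Q l q s" "s \<le> t" for q s t
      unfolding Q_def
    proof (intro conjI impI subsetI)
      show "0 \<le> t" using that by (simp add: Q_def)
      fix z assume "q \<in> Z" "z \<in> P q"
      then have "z \<in> fat_hull n B (code l s q)" "0 \<le> s" using that by (auto simp: Q_def)
      then obtain w where w: "w \<in> simplex B" "\<forall>i<n. \<bar>z i - (\<Sum>b<B. w b * f l b i q)\<bar> \<le> s" "\<forall>i\<ge>n. z i = 0"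
        using mem[of s z l q] by auto
      have "\<forall>i<n. \<bar>z i - (\<Sum>b<B. w b * f l b i q)\<bar> \<le> t" using w(2) that(2) order_trans by blast
      then show "z \<in> fat_hull n B (code l t q)" unfolding mem[OF \<open>0 \<le> t\<close>] using w(1,3) by blast
    qed
    \<comment> \<open>Radius 1 always suffices, as \<open>P q\<close> and all averages of the
      extended vertices lie in the unit cube.\<close>
    have Qone: "Q l q 1" if q: "q \<in> U l" for q
      unfolding Q_def
    proof (intro conjI impI subsetI)
      fix z assume z: "q \<in> Z" "z \<in> P q"
      obtain w where w: "w \<in> simplex B" using weights_nonempty[OF B] by (auto simp: weights_def)
      have "\<bar>z i - (\<Sum>b<B. w b * f l b i q)\<bar> \<le> 1" if "i < n" for i
        using P01[OF z(2,1), of i] simplex_average[OF w, of "\<lambda>b. f l b i q"] f(2)[OF _ that q]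
        by (auto simp: abs_le_iff)
      then show "z \<in> fat_hull n B (code l 1 q)" using w P01[OF z(2,1)] by (auto simp: mem)
    qed auto
    \<comment> \<open>Upper semicontinuity: points of \<open>P q\<close> outside the fattened hulls
      would accumulate, by compactness and the closed graph, at a point of \<open>P a\<close>. Its
      weights, applied to the extended vertices at nearby \<open>q\<close>, put those points within
      \<open>e\<close> after all.\<close>
    have near: "\<exists>d>0. \<forall>q\<in>U l. dist q a < d \<longrightarrow> Q l q e" if a: "a \<in> A l" and e: "e > 0" for a e
    proof (rule ccontr)
      assume "\<not> ?thesis"
      then have "\<exists>q\<in>U l. dist q a < inverse (real (Suc k)) \<and> \<not> Q l q e" for k by auto
      then obtain q where q: "\<And>k. q k \<in> U l" "\<And>k. dist (q k) a < inverse (real (Suc k))" "\<And>k. \<not> Q l (q k) e"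
        by metis
      have qa: "q \<longlonglongrightarrow> a"
        using q(2) by (intro metric_tendsto_imp_tendsto[OF LIMSEQ_inverse_real_of_nat]
            always_eventually allI) (simp add: less_imp_le del: of_nat_Suc)
      have "\<exists>z. q k \<in> Z \<and> z \<in> P (q k) \<and> z \<notin> fat_hull n B (code l e (q k))" for k
        using q(3)[of k] e by (auto simp: Q_def)
      then obtain z where z: "\<And>k. q k \<in> Z" "\<And>k. z k \<in> P (q k)"
          "\<And>k. z k \<notin> fat_hull n B (code l e (q k))"
        by metis
      have "compact {z::nat \<Rightarrow> real. \<forall>i. z i \<in> {0..1}}" by (rule compact_fun_box) auto
      moreover have "z k \<in> {z. \<forall>i. z i \<in> {0..1}}" for k using P01[OF z(2,1)] by blast
      ultimately obtain x s where xs: "strict_mono s" "(z \<circ> s) \<longlonglongrightarrow> x"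
        unfolding compact_eq_seq_compact_metric by (metis seq_compactE)
      have aZ: "a \<in> Z" using a by (simp add: A_def)
      have qs: "(\<lambda>k. q (s k)) \<longlonglongrightarrow> a" using LIMSEQ_subseq_LIMSEQ[OF qa xs(1)] by (simp add: o_def)
      have "x \<in> P a"
        by (rule closedP[OF _ _ qs]) (use z xs aZ in \<open>auto simp: o_def\<close>)
      then obtain w where w: "w \<in> simplex B" "x = (\<lambda>i. if i < n then \<Sum>b<B. w b * V a b i else 0)"
        using PV[OF aZ] by blast
      have ev: "\<forall>\<^sub>F k in sequentially. \<bar>z (s k) i - (\<Sum>b<B. w b * f l b i (q (s k)))\<bar> < e" if i: "i < n" for i
      proof -
        have "(\<lambda>k. f l b i (q (s k))) \<longlonglongrightarrow> f l b i a" if "b < B" for b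
          by (rule continuous_on_tendsto_compose[OF f(1)[OF that i] qs])
             (use q(1) a in \<open>auto simp: A_def U_def\<close>)
        then have "(\<lambda>k. \<bar>z (s k) i - (\<Sum>b<B. w b * f l b i (q (s k)))\<bar>)
            \<longlonglongrightarrow> \<bar>x i - (\<Sum>b<B. w b * f l b i a)\<bar>"
          using xs(2) by (intro tendsto_intros) (auto simp: tendsto_fun_iff o_def)
        moreover have "x i = (\<Sum>b<B. w b * f l b i a)" using w(2) i f(3)[OF _ i a] by simp
        ultimately show ?thesis using e by (simp add: order_tendstoD(2))
      qed
      have "\<forall>\<^sub>F k in sequentially. \<forall>i\<in>{..<n}. \<bar>z (s k) i - (\<Sum>b<B. w b * f l b i (q (s k)))\<bar> < e"
        using ev by (intro eventually_ball_finite) auto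
      then obtain k where "\<forall>i<n. \<bar>z (s k) i - (\<Sum>b<B. w b * f l b i (q (s k)))\<bar> < e"
        unfolding eventually_sequentially by (auto simp: Ball_def)
      then have "z (s k) \<in> fat_hull n B (code l e (q (s k)))"
        using w(1) e P01[OF z(2,1)] by (subst mem) (auto intro!: bexI[of _ w] less_imp_le)
      with z(3) show False by blast
    qed
    show ?thesis
      by (rule continuous_gauge[of "U l" "Q l" "A l"]) (use Qmono Qone clA near in blast)+
  qed
  then obtain h where h: "\<And>l. continuous_on (U l) (h l)" "\<And>l q. h l q \<in> {0..1::real}"
      "\<And>l a. a \<in> A l \<Longrightarrow> h l a = 0" "\<And>l q. q \<in> U l - A l \<Longrightarrow> Q l q (h l q)"
    by metis
  define \<psi> where "\<psi> l p = code l (h l p) p" for l p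
  have contpsi: "continuous_on (U l) (\<lambda>p. \<psi> l p c)" for l c
    by (cases "c = 0"; cases "c \<le> B * n") (use code_pos[of c] f(1) h(1) in \<open>auto simp: \<psi>_def code_def\<close>)
  have psi01: "\<psi> l p c \<in> {0..1}" if "p \<in> U l" for l p c
    using code_pos[of c] f(2) h(2)[of l p] that unfolding \<psi>_def code_def by auto
  have above: "P p \<subseteq> fat_hull n B (\<psi> l p)" if "p \<in> Z" "lev p \<le> l" for p l
    using h(3)[of p l] h(4)[of p l] exact[of p l] that by (cases "p \<in> A l") (auto simp: \<psi>_def Q_def U_def)
  have at: "fat_hull n B (\<psi> l p) = P p" if "p \<in> Z" "lev p = l" for p l
    using h(3)[of p l] exact[of p l] that by (auto simp: \<psi>_def A_def)
  \<comment> \<open>Level \<open>l\<close> is asked about at every parameter, but its answers are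
    binding only on \<open>U l\<close>, where \<open>lev p \<le> l\<close>.\<close>
  have "\<exists>u v. continuous_on UNIV u \<and> continuous_on UNIV v \<and> (\<forall>p. 0 \<le> u p) \<and> (\<forall>p. u p \<le> v p) \<and>
      (\<forall>p\<in>U l. v p > 0 \<and> u p / v p = \<psi> l p c)" for l c
  proof -
    have c: "continuous_on (- {p. Suc l \<le> lev p}) (\<lambda>p. \<psi> l p c)" using contpsi[of l c] U[of l] by simp
    have b: "\<psi> l p c \<in> {0..1}" if "p \<notin> {p. Suc l \<le> lev p}" for p
      using psi01[of p l c] U[of l] that by blast
    show ?thesis unfolding U by (rule robust_fraction[OF lev c b]) blast+
  qed
  then obtain u v where uv: "\<And>l c. continuous_on UNIV (u l c)" "\<And>l c. continuous_on UNIV (v l c)"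
      "\<And>l c p. 0 \<le> u l c p" "\<And>l c p. u l c p \<le> v l c p"
      "\<And>l c p. p \<in> U l \<Longrightarrow> v l c p > 0 \<and> u l c p / v l c p = \<psi> l p c"
    by metis
  define G where "G = rec_nat (\<lambda>r. nearest n B (r 0, (\<lambda>_. 0))) (\<lambda>l g r. nearest n B (r (Suc l), g r))"
  have G_0: "G 0 r = nearest n B (r 0, (\<lambda>_. 0))" for r by (simp add: G_def)
  have G_Suc: "G (Suc l) r = nearest n B (r (Suc l), G l r)" for l r by (simp add: G_def)
  have contG: "continuous_on UNIV (G l)" for l
  proof (induction l)
    case 0
    show ?case unfolding G_0
      by (rule continuous_on_compose2[OF continuous_on_nearest[OF B]])
         (auto intro!: continuous_on_Pair continuous_on_product_coordinates)
  next
    case (Suc l)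
    show ?case unfolding G_Suc
      by (rule continuous_on_compose2[OF continuous_on_nearest[OF B]]) (auto intro!: continuous_on_Pair continuous_on_product_coordinates Suc)
  qed
  have Gmem: "G l r \<in> fat_hull n B (r l)" for l r
    by (cases l) (auto simp: G_0 G_Suc nearest(1)[OF B])
  define valid where "valid p r \<longleftrightarrow> p \<in> Z \<and> (\<forall>l\<le>R. \<forall>c\<le>B*n. v l c p > 0 \<longrightarrow> r l c = u l c p / v l c p)" for p r
  have hull_valid: "fat_hull n B (r l) = fat_hull n B (\<psi> l p)" if "valid p r" "lev p \<le> l" "l \<le> R" for p r l
  proof -
    have "r l c = \<psi> l p c" if "c \<le> B * n" for c
      using uv(5)[of p l c] \<open>valid p r\<close> \<open>lev p \<le> l\<close> \<open>l \<le> R\<close> that by (auto simp: valid_def U_def)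
    then have "blend n B (r l) = blend n B (\<psi> l p)"
      using code_index_le by (auto simp: blend_def fun_eq_iff intro!: sum.cong)
    then show ?thesis by (simp add: fat_hull_def)
  qed
  have GP: "G (lev p) r \<in> P p" if "valid p r" for p r
    using Gmem[of "lev p" r] hull_valid[OF that order_refl levR] at[of p] that by (auto simp: valid_def)
  \<comment> \<open>The stopping index \<open>lev p\<close> jumps, so continuity of \<open>F\<close>
    does not follow from that of each \<open>G l\<close>.\<close>
  define F where "F = (\<lambda>(p, r). G (lev p) r)"
  have contF: "continuous_on {(p, r). valid p r} F"
  proof (rule continuous_on_sequentiallyI)
    fix xs x assume xs: "\<forall>k. xs k \<in> {(p, r). valid p r}" "x \<in> {(p, r). valid p r}" "xs \<longlonglongrightarrow> x"
    define p r where "p = fst x" and "r = snd x"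
    define ps rs where "ps k = fst (xs k)" and "rs k = snd (xs k)" for k
    have val: "valid p r" "\<And>k. valid (ps k) (rs k)"
      using xs(1,2) by (auto simp: p_def r_def ps_def rs_def case_prod_beta)
    have lim: "ps \<longlonglongrightarrow> p" "rs \<longlonglongrightarrow> r"
      unfolding ps_def rs_def p_def r_def by (auto intro!: tendsto_intros xs)
    have Glim: "(\<lambda>k. G i (rs k)) \<longlonglongrightarrow> G i r" for i
      by (rule continuous_on_tendsto_compose[OF contG lim(2)]) auto
    \<comment> \<open>If level \<open>i\<close> recurs along the sequence, then
      \<open>i \<le> lev p\<close>. For those members \<open>G i\<close> already lies in the sets at
      the higher levels, so the projections there fix it, and by continuity of
      \<open>nearest\<close> this survives in the limit.\<close>
    have key: "G i r = G (lev p) r" if fr: "\<exists>\<^sub>F k in sequentially. lev (ps k) = i" for i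
    proof -
      obtain s :: "nat \<Rightarrow> nat" where s: "strict_mono s" "\<And>k. lev (ps (s k)) = i"
        using fr unfolding cofinite_eq_sequentially[symmetric] frequently_cofinite
        using infinite_enumerate by blast
      have lims: "(\<lambda>k. ps (s k)) \<longlonglongrightarrow> p" "(\<lambda>k. rs (s k)) \<longlonglongrightarrow> r"
        using LIMSEQ_subseq_LIMSEQ[OF lim(1) s(1)] LIMSEQ_subseq_LIMSEQ[OF lim(2) s(1)] by (simp_all add: o_def)
      have i_le: "p \<in> {p. i \<le> lev p}"
        by (rule closed_sequentially[OF lev[of i] _ lims(1)]) (simp add: s)
      have steps: "i \<le> l \<longrightarrow> l \<le> lev p \<longrightarrow> G l r = G i r" for l
      proof (induction l)
        case (Suc l)
        have "nearest n B (r (Suc l), G i r) = G i r" if l: "i \<le> l" "Suc l \<le> lev p"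
        proof (rule LIMSEQ_unique)
          have "G i (rs (s k)) \<in> fat_hull n B (rs (s k) (Suc l))" for k
          proof -
            have Z: "ps (s k) \<in> Z" using val(2)[of "s k"] unfolding valid_def by (rule conjunct1)
            have le: "lev (ps (s k)) \<le> Suc l" "Suc l \<le> R" using s(2)[of k] l levR[of p] by linarith+
            have "G i (rs (s k)) \<in> P (ps (s k))" using GP[OF val(2)[of "s k"]] s(2)[of k] by simp
            also have "\<dots> \<subseteq> fat_hull n B (\<psi> (Suc l) (ps (s k)))" by (rule above[OF Z le(1)])
            also have "\<dots> = fat_hull n B (rs (s k) (Suc l))" using hull_valid[OF val(2)[of "s k"] le] by simp
            finally show ?thesis .
          qed
          then have *: "nearest n B (rs (s k) (Suc l), G i (rs (s k))) = G i (rs (s k))" for k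
            using nearest_fixed_iff[OF B] by blast
          have Gs: "(\<lambda>k. G i (rs (s k))) \<longlonglongrightarrow> G i r"
            by (rule continuous_on_tendsto_compose[OF contG lims(2)]) auto
          show "(\<lambda>k. nearest n B (rs (s k) (Suc l), G i (rs (s k)))) \<longlonglongrightarrow> nearest n B (r (Suc l), G i r)"
            by (rule continuous_on_tendsto_compose[OF continuous_on_nearest[OF B]])
               (use lims(2) Gs in \<open>auto intro!: tendsto_intros simp: tendsto_fun_iff[of rs]
                  tendsto_fun_iff[of "\<lambda>k. rs (s k)"]\<close>)
          show "(\<lambda>k. nearest n B (rs (s k) (Suc l), G i (rs (s k)))) \<longlonglongrightarrow> G i r"
            using Gs by (simp add: *)
        qed
        with Suc show ?case by (auto simp: G_Suc le_Suc_eq)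
      qed auto
      show ?thesis using steps[of "lev p"] i_le by simp
    qed
    have "(\<lambda>k. G (lev (ps k)) (rs k)) \<longlonglongrightarrow> G (lev p) r"
    proof (rule tendstoI)
      fix e :: real assume e: "e > 0"
      \<comment> \<open>Levels that recur are covered by \<open>key\<close>, the others eventually
        disappear, and there are only finitely many.\<close>
      have "\<forall>\<^sub>F k in sequentially. \<forall>i\<in>{..R}. lev (ps k) = i \<longrightarrow> dist (G i (rs k)) (G (lev p) r) < e"
      proof (rule eventually_ball_finite, safe)
        fix i
        show "\<forall>\<^sub>F k in sequentially. lev (ps k) = i \<longrightarrow> dist (G i (rs k)) (G (lev p) r) < e"
        proof (cases "\<exists>\<^sub>F k in sequentially. lev (ps k) = i")
          case True
          from tendstoD[OF Glim[of i] e] show ?thesis unfolding key[OF True] by (rule eventually_mono) simp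
        next
          case False
          then show ?thesis unfolding frequently_def by (auto elim!: eventually_mono)
        qed
      qed
      then show "\<forall>\<^sub>F k in sequentially. dist (G (lev (ps k)) (rs k)) (G (lev p) r) < e"
        by (rule eventually_mono) (use levR in auto)
    qed
    then show "(\<lambda>k. F (xs k)) \<longlonglongrightarrow> F x"
      by (simp add: F_def case_prod_beta ps_def rs_def p_def r_def)
  qed
  show thesis
  proof (rule that[where u = u and v = v and F = F])
    show "continuous_on {(p, r). p \<in> Z \<and> (\<forall>l\<le>R. \<forall>c\<le>B*n. v l c p > 0 \<longrightarrow> r l c = u l c p / v l c p)} F"
      using contF unfolding valid_def .
    fix p r assume "p \<in> Z" "\<forall>l\<le>R. \<forall>c\<le>B*n. v l c p > 0 \<longrightarrow> r l c = u l c p / v l c p"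
    then have "valid p r" unfolding valid_def by blast
    then show "F (p, r) \<in> P p" using GP by (simp add: F_def)
  qed (fact uv)+
qed

section \<open>Parametrised polytopes\<close>

text \<open>The signed excess of a constraint whose coefficients and bound are both functions of the
  parameter; admissible points have excess at most 0.\<close>

definition lin :: "nat \<Rightarrow> (nat \<Rightarrow> 'x \<Rightarrow> real) \<times> ('x \<Rightarrow> real) \<Rightarrow> 'x \<Rightarrow> (nat \<Rightarrow> real) \<Rightarrow> real" where
  "lin n c p z = (\<Sum>i<n. fst c i p * z i) - snd c p"

definition polyhedron :: "nat \<Rightarrow> ((nat \<Rightarrow> 'x \<Rightarrow> real) \<times> ('x \<Rightarrow> real)) list \<Rightarrow> 'x \<Rightarrow> (nat \<Rightarrow> real) set" where
  "polyhedron n cs p = {z. (\<forall>i\<ge>n. z i = 0) \<and> (\<forall>c\<in>set cs. lin n c p z \<le> 0)}"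

text \<open>Points over a convergent sequence accumulate inside the compact fibre. This makes the
  existence of a solution or of a kernel vector a closed condition on the parameter.\<close>

lemma closed_projection:
  fixes L :: "'a::metric_space set" and T :: "('a \<times> 'b::metric_space) set"
  assumes "compact L" "closed T"
  shows "closed {y. \<exists>x. x \<in> L \<and> (x, y) \<in> T}"
  unfolding closed_sequential_limits
proof safe
  fix ys y assume "\<forall>k. ys k \<in> {y. \<exists>x. x \<in> L \<and> (x, y) \<in> T}" and y: "ys \<longlonglongrightarrow> y"
  then obtain xs where xs: "\<And>k. xs k \<in> L" "\<And>k. (xs k, ys k) \<in> T" by simp metis
  obtain x s where x: "x \<in> L" "strict_mono s" "(xs \<circ> s) \<longlonglongrightarrow> x"
    using assms(1) xs(1) unfolding compact_eq_seq_compact_metric by (metis seq_compactE)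
  have "(x, y) \<in> T"
    by (rule closed_sequentially[OF assms(2), of "\<lambda>k. (xs (s k), ys (s k))"])
       (use xs x(3) LIMSEQ_subseq_LIMSEQ[OF y x(2)] in \<open>auto intro: tendsto_Pair simp: o_def\<close>)
  then show "\<exists>x. x \<in> L \<and> (x, y) \<in> T" using x(1) by blast
qed

lemma lin_affine: "lin n c p (\<lambda>i. z i + t * d i) = lin n c p z + t * (\<Sum>i<n. fst c i p * d i)"
  by (simp add: lin_def algebra_simps sum.distrib sum_distrib_left)

lemma lin_average:
  assumes "w \<in> simplex B"
  shows "lin n c p (\<lambda>i. if i < n then \<Sum>b<B. w b * V b i else 0) = (\<Sum>b<B. w b * lin n c p (V b))"
proof -
  have "(\<Sum>b<B. w b * lin n c p (V b)) = (\<Sum>b<B. \<Sum>i<n. w b * (fst c i p * V b i)) - (\<Sum>b<B. w b) * snd c p"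
    by (simp add: lin_def right_diff_distrib sum_subtractf sum_distrib_left sum_distrib_right)
  also have "(\<Sum>b<B. \<Sum>i<n. w b * (fst c i p * V b i)) = (\<Sum>i<n. fst c i p * (\<Sum>b<B. w b * V b i))"
    by (subst sum.swap) (simp add: sum_distrib_left mult.left_commute)
  finally show ?thesis using assms by (simp add: lin_def simplex_def)
qed

text \<open>At least \<open>l\<close> of finitely many conditions hold iff some
  \<open>l\<close>-element subfamily holds entirely: a finite union of finite intersections.\<close>

lemma closed_level:
  assumes "finite K" "\<And>k. k \<in> K \<Longrightarrow> closed (X k)"
  shows "closed {p. l \<le> card {k \<in> K. p \<in> X k}}"
proof -
  have "{p. l \<le> card {k \<in> K. p \<in> X k}} = (\<Union>S\<in>{S. S \<subseteq> K \<and> card S = l}. \<Inter>k\<in>S. X k)" (is "?L = ?R")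
  proof (intro equalityI subsetI)
    fix p assume "p \<in> ?L"
    then have "l \<le> card {k \<in> K. p \<in> X k}" by simp
    then obtain S where "S \<subseteq> {k \<in> K. p \<in> X k}" "card S = l"
      by (rule obtain_subset_with_card_n)
    then show "p \<in> ?R" by (intro UN_I[of S]) auto
  next
    fix p assume "p \<in> ?R"
    then obtain S where "S \<subseteq> {k \<in> K. p \<in> X k}" "card S = l" by auto
    then show "p \<in> ?L" using card_mono[of "{k \<in> K. p \<in> X k}" S] assms(1) by simp
  qed
  moreover have "finite {S. S \<subseteq> K \<and> card S = l}" using assms(1) by simp
  ultimately show ?thesis using assms(2) by (auto intro!: closed_UN closed_INT)
qed

text \<open>Conditions failing at \<open>p\<close> fail nearby, so the pattern can only shrink near
  \<open>p\<close>, and with equal cardinality it cannot shrink.\<close>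

lemma level_pattern:
  assumes "finite K" "\<And>k. k \<in> K \<Longrightarrow> closed (X k)"
  shows "\<exists>W. open W \<and> p \<in> W \<and> (\<forall>q\<in>W. card {k \<in> K. q \<in> X k} = card {k \<in> K. p \<in> X k} \<longrightarrow>
    {k \<in> K. q \<in> X k} = {k \<in> K. p \<in> X k})"
proof (intro exI[of _ "\<Inter>k\<in>{k \<in> K. p \<notin> X k}. - X k"] conjI ballI impI)
  show "open (\<Inter>k\<in>{k \<in> K. p \<notin> X k}. - X k)" using assms by (intro open_INT) auto
  fix q assume "q \<in> (\<Inter>k\<in>{k \<in> K. p \<notin> X k}. - X k)"
    and eq: "card {k \<in> K. q \<in> X k} = card {k \<in> K. p \<in> X k}"
  then have "{k \<in> K. q \<in> X k} \<subseteq> {k \<in> K. p \<in> X k}" by auto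
  then show "{k \<in> K. q \<in> X k} = {k \<in> K. p \<in> X k}" using eq assms(1) by (intro card_subset_eq) auto
qed auto

locale polyhedra =
  fixes n :: nat and cs :: "((nat \<Rightarrow> 'x::{metric_space,second_countable_topology} \<Rightarrow> real) \<times> ('x \<Rightarrow> real)) list"
  assumes cont: "\<And>c i. c \<in> set cs \<Longrightarrow> i < n \<Longrightarrow> continuous_on UNIV (fst c i)"
      "\<And>c. c \<in> set cs \<Longrightarrow> continuous_on UNIV (snd c)"
    and box: "\<And>p z i. z \<in> polyhedron n cs p \<Longrightarrow> z i \<in> {0..1}"
begin

abbreviation J where "J \<equiv> length cs"
abbreviation ker where "ker I p d \<equiv> (\<forall>i\<ge>n. d i = 0) \<and> (\<forall>j\<in>I. (\<Sum>i<n. fst (cs ! j) i p * d i) = 0)"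

text \<open>A set \<open>I\<close> of active constraints determines its solution \<open>vert I p\<close>, continuously in \<open>p\<close>, as long
  as it is not degenerate; \<open>basic p\<close> contains the sets that belong to the vertices at \<open>p\<close>.\<close>

definition tight where "tight I p z \<longleftrightarrow> z \<in> polyhedron n cs p \<and> (\<forall>j\<in>I. lin n (cs ! j) p z = 0)"
text \<open>\<open>feasible\<close> and \<open>degenerate\<close> are spelt as projections along a
  compact box so that \<open>closed_projection\<close> applies. Solutions lie in the box by
  \<open>box\<close>, normalised kernel vectors by their norm.\<close>

definition feasible where "feasible I = {p. \<exists>z. z \<in> {z. \<forall>i. z i \<in> {0..1}} \<and> (z, p) \<in> {(z, p). tight I p z}}"
definition degenerate where
  "degenerate I = {p. \<exists>d. d \<in> {d. \<forall>i. d i \<in> {-1..1}} \<and> (d, p) \<in> {(d, p). ker I p d \<and> (\<Sum>i<n. (d i)\<^sup>2) = 1}}"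
definition vert where "vert I p = (SOME z. tight I p z)"
definition basic where "basic p = {I. I \<subseteq> {..<J} \<and> p \<in> feasible I \<and> p \<notin> degenerate I}"

lemma cont_m: "c \<in> set cs \<Longrightarrow> i < n \<Longrightarrow> continuous_on S f \<Longrightarrow> continuous_on S (\<lambda>x. fst c i (f x))"
  by (rule continuous_on_compose2[OF cont(1)]) auto

lemma cont_lin:
  assumes "c \<in> set cs" "continuous_on S f" "continuous_on S g"
  shows "continuous_on S (\<lambda>x. lin n c (f x) (g x))"
  unfolding lin_def using assms
  by (intro continuous_on_diff continuous_on_sum continuous_on_mult cont_m
      continuous_on_product_then_coordinatewise[OF assms(3)] continuous_on_compose2[OF cont(2) assms(2)]) auto

lemma closed_graph_polyhedron: "closed {(z, p). z \<in> polyhedron n cs p}"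
proof -
  have "{(z, p). z \<in> polyhedron n cs p} =
      (\<Inter>i\<in>{n..}. {x. fst x i = 0}) \<inter> (\<Inter>c\<in>set cs. {x. lin n c (snd x) (fst x) \<le> 0})"
    by (auto simp: polyhedron_def)
  moreover have "closed {x :: (nat \<Rightarrow> real) \<times> 'x. fst x i = 0}" for i
    by (intro closed_Collect_eq continuous_on_const
        continuous_on_product_then_coordinatewise[OF continuous_on_fst] continuous_on_id)
  moreover have "closed {x. lin n c (snd x) (fst x) \<le> 0}" if "c \<in> set cs" for c
    by (intro closed_Collect_le cont_lin that continuous_intros)
  ultimately show ?thesis by (metis (no_types, lifting) closed_Int closed_INT)
qed

lemma closed_tight:
  assumes "I \<subseteq> {..<J}"
  shows "closed {(z, p). tight I p z}"
proof -
  have "{(z, p). tight I p z} = {(z, p). z \<in> polyhedron n cs p} \<inter>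
      (\<Inter>j\<in>I. {x. lin n (cs ! j) (snd x) (fst x) = 0})"
    by (auto simp: tight_def)
  moreover have "closed {x. lin n (cs ! j) (snd x) (fst x) = 0}" if "j \<in> I" for j
    using that assms by (intro closed_Collect_eq cont_lin continuous_intros) auto
  ultimately show ?thesis using closed_graph_polyhedron by (metis (no_types, lifting) closed_Int closed_INT)
qed

lemma closed_feasible: "I \<subseteq> {..<J} \<Longrightarrow> closed (feasible I)"
  unfolding feasible_def by (intro closed_projection compact_fun_box closed_tight) auto

lemma closed_degenerate:
  assumes "I \<subseteq> {..<J}"
  shows "closed (degenerate I)"
proof -
  have "{(d, p). ker I p d \<and> (\<Sum>i<n. (d i)\<^sup>2) = 1} = (\<Inter>i\<in>{n..}. {x. fst x i = 0}) \<inter>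
      (\<Inter>j\<in>I. {x. (\<Sum>i<n. fst (cs ! j) i (snd x) * fst x i) = 0}) \<inter> {x. (\<Sum>i<n. (fst x i)\<^sup>2) = 1}"
    by auto
  moreover have coord: "continuous_on UNIV (\<lambda>x :: (nat \<Rightarrow> real) \<times> 'x. fst x i)" for i
    by (intro continuous_on_product_then_coordinatewise[OF continuous_on_fst] continuous_on_id)
  then have "closed {x :: (nat \<Rightarrow> real) \<times> 'x. fst x i = 0}" "closed {x :: (nat \<Rightarrow> real) \<times> 'x. (\<Sum>i<n. (fst x i)\<^sup>2) = 1}" for i
    by (auto intro!: closed_Collect_eq continuous_on_const continuous_on_sum continuous_on_power)
  moreover have "closed {x. (\<Sum>i<n. fst (cs ! j) i (snd x) * fst x i) = 0}" if "j \<in> I" for j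
    using that assms
    by (intro closed_Collect_eq continuous_on_sum continuous_on_mult cont_m coord
        continuous_on_snd continuous_on_id continuous_on_const) auto
  ultimately have "closed {(d, p). ker I p d \<and> (\<Sum>i<n. (d i)\<^sup>2) = 1}"
    by (metis (no_types, lifting) closed_Int closed_INT)
  then show ?thesis
    unfolding degenerate_def by (intro closed_projection compact_fun_box) auto
qed

lemma degenerateI:
  assumes d: "ker I p d" "d k \<noteq> 0"
  shows "p \<in> degenerate I"
proof -
  define s where "s = sqrt (\<Sum>i<n. (d i)\<^sup>2)"
  have k: "k < n" using d by (meson not_le)
  have le: "(d i)\<^sup>2 \<le> (\<Sum>i<n. (d i)\<^sup>2)" if "i < n" for i
    using member_le_sum[of i "{..<n}" "\<lambda>i. (d i)\<^sup>2"] that by simp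
  have "0 < (d k)\<^sup>2" using d(2) by simp
  then have pos: "(\<Sum>i<n. (d i)\<^sup>2) > 0" using le[OF k] by linarith
  then have s: "s > 0" "s\<^sup>2 = (\<Sum>i<n. (d i)\<^sup>2)" by (auto simp: s_def)
  have bound: "\<bar>d i\<bar> \<le> s" for i
  proof (cases "i < n")
    case True
    then show ?thesis using real_sqrt_le_mono[OF le[OF True]] by (simp add: s_def)
  qed (use d(1) s in auto)
  have "ker I p (\<lambda>i. d i / s)"
    using d(1) by (auto simp: sum_divide_distrib[symmetric])
  moreover have "(\<Sum>i<n. (d i / s)\<^sup>2) = 1"
    using s(1) by (simp add: power_divide sum_divide_distrib[symmetric] s(2)[symmetric])
  moreover have "d i / s \<in> {-1..1}" for i
    using bound[of i] s(1) by (auto simp: abs_le_iff divide_le_eq le_divide_eq)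
  ultimately show ?thesis unfolding degenerate_def by (intro CollectI exI[of _ "\<lambda>i. d i / s"]) auto
qed

lemma tight_unique:
  assumes "tight I p z" "tight I p z'" "p \<notin> degenerate I"
  shows "z = z'"
proof (rule ccontr)
  assume "z \<noteq> z'"
  then obtain k where k: "z k - z' k \<noteq> 0" by auto
  have "ker I p (\<lambda>i. z i - z' i)"
    using assms(1,2) by (auto simp: tight_def polyhedron_def lin_def right_diff_distrib sum_subtractf)
  from degenerateI[OF this k] assms(3) show False by blast
qed

lemma feasibleI:
  assumes "tight I p z"
  shows "p \<in> feasible I"
proof -
  have "\<forall>i. z i \<in> {0..1}" using assms box unfolding tight_def by blast
  then show ?thesis unfolding feasible_def using assms by (intro CollectI exI[of _ z] conjI) auto
qed

lemma vert: "p \<in> feasible I \<Longrightarrow> tight I p (vert I p)"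
  using someI_ex[of "tight I p"] by (auto simp: vert_def feasible_def)

text \<open>A feasible non-degenerate system has exactly one solution, so the choice in
  \<open>vert\<close> is forced, and a closed graph over a compact box gives continuity.\<close>

lemma continuous_on_vert:
  assumes I: "I \<subseteq> {..<J}"
  shows "continuous_on {p. I \<in> basic p} (vert I)"
proof (rule continuous_on_compact_witness[where L = "{z. \<forall>i. z i \<in> {0..1}}" and R = "tight I" and g = snd])
  show "compact {z::nat \<Rightarrow> real. \<forall>i. z i \<in> {0..1}}" by (rule compact_fun_box) auto
  show "\<exists>l\<in>{z. \<forall>i. z i \<in> {0..1}}. tight I x l" if "x \<in> {p. I \<in> basic p}" for x
    using that by (auto simp: basic_def feasible_def)
  show "snd (x, l) = vert I x" if "x \<in> {p. I \<in> basic p}" "tight I x l" for x l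
    using that tight_unique[OF that(2) vert] by (auto simp: basic_def)
  show "continuous_on ({p. I \<in> basic p} \<times> {z. \<forall>i. z i \<in> {0..1}}) (snd :: 'x \<times> (nat \<Rightarrow> real) \<Rightarrow> _)"
    by (intro continuous_intros)
next
  fix xs x ls l assume t: "\<And>k. tight I (xs k) (ls k)" and lim: "xs \<longlonglongrightarrow> x" "ls \<longlonglongrightarrow> (l :: nat \<Rightarrow> real)"
  have "(ls k, xs k) \<in> {(z, p). tight I p z}" for k using t by simp
  from closed_sequentially[OF closed_tight[OF I] this tendsto_Pair[OF lim(2,1)]]
  have "(l, x) \<in> {(z, p). tight I p z}" .
  then show "tight I x l" by simp
qed

section \<open>The polytope as the hull of its basic vertices\<close>

definition active where "active p z = {j. j < J \<and> lin n (cs ! j) p z = 0}"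

text \<open>Moving along the kernel of the active constraints keeps them active, and boundedness
  stops the motion. At the last admissible \<open>t\<close> a further constraint has become active;
  otherwise the inactive ones would stay negative slightly beyond \<open>t\<close>.\<close>

lemma push_to_face:
  assumes z: "z \<in> polyhedron n cs p" and d: "ker (active p z) p d" "d k \<noteq> 0"
  obtains t where "t > 0" "(\<lambda>i. z i + t * d i) \<in> polyhedron n cs p"
    "active p z \<subset> active p (\<lambda>i. z i + t * d i)"
proof -
  define T where "T = {t. t \<ge> 0 \<and> (\<lambda>i. z i + t * d i) \<in> polyhedron n cs p}"
  have mem: "(\<lambda>i. z i + t * d i) \<in> polyhedron n cs p \<longleftrightarrow>
      (\<forall>j<J. lin n (cs ! j) p z + t * (\<Sum>i<n. fst (cs ! j) i p * d i) \<le> 0)" for t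
    using z d(1) by (simp add: polyhedron_def lin_affine all_set_conv_all_nth)
  have "T = {0..} \<inter> (\<Inter>j\<in>{..<J}. {t. lin n (cs ! j) p z + t * (\<Sum>i<n. fst (cs ! j) i p * d i) \<le> 0})"
    by (auto simp: T_def mem)
  moreover have "closed {t. lin n (cs ! j) p z + t * (\<Sum>i<n. fst (cs ! j) i p * d i) \<le> 0}" for j
    by (intro closed_Collect_le continuous_intros)
  ultimately have clT: "closed T" by (simp add: closed_Int closed_INT)
  have zT: "0 \<in> T" using z by (simp add: T_def)
  have "t \<le> 1 / \<bar>d k\<bar>" if "t \<in> T" for t
  proof -
    have "z k + t * d k \<in> {0..1}" "z k \<in> {0..1}" using that box z by (auto simp: T_def dest: box)
    then have "\<bar>t * d k\<bar> \<le> 1" by (auto simp: abs_le_iff)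
    then show ?thesis using that d(2) by (auto simp: T_def abs_mult le_divide_eq)
  qed
  then have bdd: "bdd_above T" by (rule bdd_aboveI)
  define t where "t = Sup T"
  have tT: "t \<in> T" unfolding t_def using closed_contains_Sup[OF _ bdd clT] zT by blast
  have act: "active p z \<subseteq> active p (\<lambda>i. z i + t * d i)"
    using d(1) by (auto simp: active_def lin_affine)
  have ne: "active p (\<lambda>i. z i + t * d i) \<noteq> active p z"
  proof
    assume eq: "active p (\<lambda>i. z i + t * d i) = active p z"
    have ev: "\<forall>\<^sub>F s in at_right t. lin n (cs ! j) p z + s * (\<Sum>i<n. fst (cs ! j) i p * d i) \<le> 0" if j: "j < J" for j
    proof (cases "j \<in> active p z")
      case True
      then have "(\<Sum>i<n. fst (cs ! j) i p * d i) = 0" "lin n (cs ! j) p z = 0"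
        using d(1) unfolding active_def by blast+
      then show ?thesis by simp
    next
      case False
      then have "j \<notin> active p (\<lambda>i. z i + t * d i)" unfolding eq .
      then have "lin n (cs ! j) p z + t * (\<Sum>i<n. fst (cs ! j) i p * d i) \<noteq> 0"
        unfolding active_def lin_affine using j by simp
      moreover have "lin n (cs ! j) p z + t * (\<Sum>i<n. fst (cs ! j) i p * d i) \<le> 0"
        using tT j unfolding T_def mem by blast
      ultimately have neg: "lin n (cs ! j) p z + t * (\<Sum>i<n. fst (cs ! j) i p * d i) < 0" by linarith
      have "((\<lambda>s. lin n (cs ! j) p z + s * (\<Sum>i<n. fst (cs ! j) i p * d i)) \<longlongrightarrow>
          lin n (cs ! j) p z + t * (\<Sum>i<n. fst (cs ! j) i p * d i)) (at_right t)"
        by (intro tendsto_intros)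
      from order_tendstoD(2)[OF this neg] show ?thesis by (rule eventually_mono) (rule less_imp_le)
    qed
    have "\<forall>\<^sub>F s in at_right t. \<forall>j\<in>{..<J}. lin n (cs ! j) p z + s * (\<Sum>i<n. fst (cs ! j) i p * d i) \<le> 0"
      using ev by (intro eventually_ball_finite ballI) simp_all
    moreover have "\<forall>\<^sub>F s in at_right t. s > t" by (rule eventually_at_right_less)
    ultimately have "\<forall>\<^sub>F s in at_right t. s > t \<and> s \<in> T"
    proof eventually_elim
      case (elim s)
      moreover have "t \<ge> 0" using tT by (simp add: T_def)
      ultimately show ?case unfolding T_def mem mem_Collect_eq by auto
    qed
    then obtain s where "s > t" "s \<in> T"
      using eventually_happens[of _ "at_right t"] trivial_limit_at_right_real[of t] by blast
    then show False using cSup_upper[OF _ bdd, of s] unfolding t_def by linarith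
  qed
  then have "t \<noteq> 0" by auto
  then show thesis using that[of t] tT act ne by (auto simp: T_def)
qed

abbreviation NB :: nat where "NB \<equiv> 2 ^ J"
definition enum where "enum = (SOME h. bij_betw h {..<NB} (Pow {..<J}))"
text \<open>One slot for each set of constraints, so that the number of vertices is the same at
  every parameter. Slots of non-basic sets repeat a basic vertex whose index depends on
  \<open>basic p\<close> alone and is thus constant wherever \<open>basic\<close> is.\<close>

definition corner where "corner p b = (if basic p = {} then (\<lambda>_. 0)
    else vert (if enum b \<in> basic p then enum b else SOME I. I \<in> basic p) p)"

lemma enum: "bij_betw enum {..<NB} (Pow {..<J})"
proof -
  have "\<exists>h. bij_betw h {..<NB} (Pow {..<J})"
    by (intro finite_same_card_bij) (auto simp: card_Pow)
  then show ?thesis unfolding enum_def by (rule someI_ex)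
qed

lemma corner_cases:
  assumes "basic p \<noteq> {}"
  obtains I where "I \<in> basic p" "corner p b = vert I p"
proof -
  define I where "I = (if enum b \<in> basic p then enum b else SOME I. I \<in> basic p)"
  have "I \<in> basic p" using assms some_in_eq[of "basic p"] by (simp add: I_def)
  moreover have "corner p b = vert I p" using assms by (simp add: corner_def I_def)
  ultimately show thesis by (rule that)
qed

lemma corner_mem:
  assumes "basic p \<noteq> {}"
  shows "corner p b \<in> polyhedron n cs p"
proof -
  obtain I where "I \<in> basic p" "corner p b = vert I p" using corner_cases[OF assms] .
  then show ?thesis using vert[of p I] by (simp add: basic_def tight_def)
qed

definition corner_hull where
  "corner_hull p = {z. \<exists>w\<in>simplex (NB). z = (\<lambda>i. if i < n then \<Sum>b<NB. w b * corner p b i else 0)}"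

lemma corner_hull_convex:
  assumes "x \<in> corner_hull p" "y \<in> corner_hull p" "0 \<le> a" "a \<le> 1"
  shows "(\<lambda>i. a * x i + (1 - a) * y i) \<in> corner_hull p"
proof -
  obtain w w' where w: "w \<in> simplex (NB)" "w' \<in> simplex (NB)"
    "x = (\<lambda>i. if i < n then \<Sum>b<NB. w b * corner p b i else 0)"
    "y = (\<lambda>i. if i < n then \<Sum>b<NB. w' b * corner p b i else 0)"
    using assms(1,2) by (auto simp: corner_hull_def)
  have "(\<lambda>b. a * w b + (1 - a) * w' b) \<in> simplex (NB)"
    using w(1,2) assms(3,4) by (auto simp: simplex_def sum.distrib sum_distrib_left[symmetric])
  moreover have "(\<lambda>i. a * x i + (1 - a) * y i) =
      (\<lambda>i. if i < n then \<Sum>b<NB. (a * w b + (1 - a) * w' b) * corner p b i else 0)"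
    by (auto simp: w(3,4) distrib_right sum.distrib sum_distrib_left mult.assoc)
  ultimately show ?thesis by (auto simp: corner_hull_def)
qed

text \<open>Induction on the number of inactive constraints. With trivial kernel the point is the
  vertex of its active set; otherwise it lies between the two points reached by moving both ways
  along a kernel direction, each with more active constraints.\<close>

lemma polyhedron_subset_corner_hull:
  assumes "z \<in> polyhedron n cs p"
  shows "z \<in> corner_hull p \<and> basic p \<noteq> {}"
  using assms
proof (induction "J - card (active p z)" arbitrary: z rule: less_induct)
  case less
  have fin: "finite (active p y)" "active p y \<subseteq> {..<J}" for y by (auto simp: active_def)
  have tight: "tight (active p z) p z" using less.prems by (auto simp: tight_def active_def)
  then have feas: "p \<in> feasible (active p z)" by (rule feasibleI)
  show ?case
  proof (cases "p \<in> degenerate (active p z)")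
    case False
    then have I: "active p z \<in> basic p" using feas fin by (simp add: basic_def)
    obtain b where b: "b < NB" "enum b = active p z"
      using enum fin(2)[of z] unfolding bij_betw_def by (metis (no_types, lifting) PowI imageE lessThan_iff)
    have "corner p b = z" using I b(2) tight_unique[OF tight vert[OF feas] False] by (auto simp: corner_def)
    then have "z i = (\<Sum>b'<NB. (if b' = b then 1 else 0) * corner p b' i)" for i
      using b(1) by (simp add: if_distrib[of "\<lambda>x. x * _"] sum.delta cong: if_cong)
    moreover have "\<forall>i\<ge>n. z i = 0" using less.prems by (simp add: polyhedron_def)
    moreover have "(\<lambda>b'. if b' = b then 1 else 0) \<in> simplex (NB)" using b(1) by (auto simp: simplex_def)
    ultimately have "z \<in> corner_hull p" unfolding corner_hull_def by (intro CollectI bexI) (auto simp: fun_eq_iff)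
    then show ?thesis using I by blast
  next
    case True
    then obtain d where d: "ker (active p z) p d" "(\<Sum>i<n. (d i)\<^sup>2) = 1" by (auto simp: degenerate_def)
    have "\<exists>k. d k \<noteq> 0"
    proof (rule ccontr)
      assume "\<not> ?thesis"
      then show False using d(2) by simp
    qed
    then obtain k where k: "d k \<noteq> 0" by blast
    have d': "ker (active p z) p (\<lambda>i. - d i)" "- d k \<noteq> 0" using d(1) k by (auto simp: sum_negf)
    obtain t where t: "t > 0" "(\<lambda>i. z i + t * d i) \<in> polyhedron n cs p"
        "active p z \<subset> active p (\<lambda>i. z i + t * d i)"
      by (rule push_to_face[OF less.prems d(1) k])
    obtain s where s: "s > 0" "(\<lambda>i. z i + s * - d i) \<in> polyhedron n cs p"
        "active p z \<subset> active p (\<lambda>i. z i + s * - d i)"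
      by (rule push_to_face[OF less.prems d'])
    have IH: "y \<in> corner_hull p \<and> basic p \<noteq> {}" if "y \<in> polyhedron n cs p" "active p z \<subset> active p y" for y
    proof (rule less.hyps[OF _ that(1)])
      have "card (active p z) < card (active p y)" using psubset_card_mono[OF fin(1) that(2)] .
      moreover have "card (active p y) \<le> J" using card_mono[OF _ fin(2)[of y]] by simp
      ultimately show "J - card (active p y) < J - card (active p z)" by simp
    qed
    \<comment> \<open>The steps \<open>t\<close> and \<open>-s\<close> along \<open>d\<close> cancel
      under the weights \<open>s / (s + t)\<close> and \<open>t / (s + t)\<close>.\<close>
    have "(\<lambda>i. (s / (s + t)) * (z i + t * d i) + (1 - s / (s + t)) * (z i + s * - d i)) \<in> corner_hull p"
      using IH[OF t(2,3)] IH[OF s(2,3)] s(1) t(1) by (intro corner_hull_convex) (auto simp: divide_le_eq)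
    moreover have "(s / (s + t)) * (z i + t * d i) + (1 - s / (s + t)) * (z i + s * - d i) = z i" for i
    proof -
      have "1 - s / (s + t) = t / (s + t)" using s(1) t(1) by (simp add: field_simps)
      then have "(s / (s + t)) * (z i + t * d i) + (1 - s / (s + t)) * (z i + s * - d i) =
          (s * (z i + t * d i) + t * (z i + s * - d i)) / (s + t)" by (simp add: add_divide_distrib)
      also have "s * (z i + t * d i) + t * (z i + s * - d i) = (s + t) * z i" by (simp add: algebra_simps)
      finally show ?thesis using s(1) t(1) by simp
    qed
    ultimately show ?thesis using IH[OF t(2,3)] by simp
  qed
qed

lemma corner_hull_eq:
  assumes "polyhedron n cs p \<noteq> {}"
  shows "polyhedron n cs p = corner_hull p"
proof
  show "polyhedron n cs p \<subseteq> corner_hull p" using polyhedron_subset_corner_hull by blast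
  have ne: "basic p \<noteq> {}" using assms polyhedron_subset_corner_hull by blast
  show "corner_hull p \<subseteq> polyhedron n cs p"
  proof
    fix z assume "z \<in> corner_hull p"
    then obtain w where w: "w \<in> simplex (NB)" "z = (\<lambda>i. if i < n then \<Sum>b<NB. w b * corner p b i else 0)"
      by (auto simp: corner_hull_def)
    have "lin n c p z \<le> 0" if "c \<in> set cs" for c
    proof -
      have "lin n c p (corner p b) \<le> 0" for b using corner_mem[OF ne] that by (simp add: polyhedron_def)
      then show ?thesis unfolding w(2) lin_average[OF w(1)]
        using w(1) by (intro sum_nonpos mult_nonneg_nonpos) (auto simp: simplex_def)
    qed
    then show "z \<in> polyhedron n cs p" by (auto simp: polyhedron_def w(2))
  qed
qed

section \<open>The level and the continuity of the vertices\<close>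

definition family where "family = (\<lambda>(b, I). if b then feasible I else degenerate I)"
text \<open>Being basic combines a closed condition with the negation of another. Counting
  feasibility and degeneracy together keeps every counted condition closed, while the pattern still
  determines \<open>basic p\<close>.\<close>

definition level where "level p = card {k \<in> UNIV \<times> Pow {..<J}. p \<in> family k}"

lemma family_closed: "k \<in> UNIV \<times> Pow {..<J} \<Longrightarrow> closed (family k)"
  using closed_feasible closed_degenerate by (auto simp: family_def)

lemma finite_index: "finite ((UNIV :: bool set) \<times> Pow {..<J})"
  by (intro finite_cartesian_product) auto

text \<open>On a fixed level the pattern of \<open>family\<close> is locally constant, hence so is
  \<open>basic\<close>, and near each parameter with a basic set the corner is \<open>vert I\<close>
  for one fixed \<open>I\<close>.\<close>

lemma continuous_on_corner: "continuous_on {p. level p = l} (\<lambda>p. corner p b)"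
  unfolding continuous_on_def
proof
  fix p assume p: "p \<in> {p. level p = l}"
  define pat where "pat q = {k \<in> UNIV \<times> Pow {..<J}. q \<in> family k}" for q
  have "\<exists>W. open W \<and> p \<in> W \<and> (\<forall>q\<in>W. level q = level p \<longrightarrow> pat q = pat p)"
    unfolding level_def pat_def by (rule level_pattern[OF finite_index family_closed])
  then obtain W where W: "open W" "p \<in> W" "\<And>q. q \<in> W \<Longrightarrow> level q = level p \<Longrightarrow> pat q = pat p" by blast
  have same: "basic q = basic p" if q: "q \<in> W" "level q = level p" for q
  proof -
    have fam: "q \<in> family (b, I) \<longleftrightarrow> p \<in> family (b, I)" if "I \<subseteq> {..<J}" for b I
    proof -
      have "(b, I) \<in> pat q \<longleftrightarrow> (b, I) \<in> pat p" using W(3)[OF q] by simp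
      then show ?thesis using that by (simp add: pat_def)
    qed
    have "I \<in> basic q \<longleftrightarrow> I \<in> basic p" for I
      using fam[of I True] fam[of I False] by (auto simp: basic_def family_def)
    then show ?thesis by blast
  qed
  have ev: "\<forall>\<^sub>F q in at p within {p. level p = l}. basic q = basic p"
    unfolding eventually_at_topological
  proof (intro exI[of _ W] conjI W ballI impI)
    fix q assume "q \<in> W" "q \<in> {p. level p = l}"
    then show "basic q = basic p" using p by (intro same) simp_all
  qed
  show "((\<lambda>p. corner p b) \<longlongrightarrow> corner p b) (at p within {p. level p = l})"
  proof (cases "basic p = {}")
    case True
    show ?thesis
      by (rule Lim_transform_eventually[OF tendsto_const], rule eventually_mono[OF ev])
         (simp add: corner_def True)
  next
    case False
    define I where "I = (if enum b \<in> basic p then enum b else SOME I. I \<in> basic p)"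
    have I: "I \<in> basic p" using False some_in_eq[of "basic p"] by (simp add: I_def)
    have eq: "corner q b = vert I q" if "basic q = basic p" for q
      using False that by (simp add: corner_def I_def)
    have "continuous_on {q. I \<in> basic q} (vert I)"
      using I by (intro continuous_on_vert) (auto simp: basic_def)
    then have "(vert I \<longlongrightarrow> vert I p) (at p within {q. I \<in> basic q})"
      using I by (simp add: continuous_on_def)
    then have "(vert I \<longlongrightarrow> vert I p) (at p within {q. level q = l})"
    proof (rule tendsto_mono[rotated])
      show "at p within {q. level q = l} \<le> at p within {q. I \<in> basic q}"
        unfolding le_filter_def eventually_at_topological
      proof (intro allI impI)
        fix Q assume "\<exists>S. open S \<and> p \<in> S \<and> (\<forall>x\<in>S. x \<noteq> p \<longrightarrow> x \<in> {q. I \<in> basic q} \<longrightarrow> Q x)"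
        then obtain S where "open S" "p \<in> S" "\<forall>x\<in>S. x \<noteq> p \<longrightarrow> I \<in> basic x \<longrightarrow> Q x" by auto
        then show "\<exists>S. open S \<and> p \<in> S \<and> (\<forall>x\<in>S. x \<noteq> p \<longrightarrow> x \<in> {q. level q = l} \<longrightarrow> Q x)"
        proof (intro exI[of _ "S \<inter> W"] conjI ballI impI)
          fix x assume x: "x \<in> S \<inter> W" "x \<noteq> p" "x \<in> {q. level q = l}"
          then have "basic x = basic p" using p by (intro same) simp_all
          then show "Q x" using x I \<open>\<forall>x\<in>S. x \<noteq> p \<longrightarrow> I \<in> basic x \<longrightarrow> Q x\<close> by simp
        qed (use W(1,2) \<open>open S\<close> \<open>p \<in> S\<close> in auto)
      qed
    qed
    then show ?thesis unfolding eq[OF refl]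
      by (rule Lim_transform_eventually) (rule eventually_mono[OF ev], simp add: eq)
  qed
qed

lemma closed_nonempty: "closed {p. polyhedron n cs p \<noteq> {}}"
proof -
  have "polyhedron n cs p \<noteq> {} \<longleftrightarrow> p \<in> feasible {}" for p
  proof
    assume "polyhedron n cs p \<noteq> {}"
    then obtain z where "tight {} p z" unfolding tight_def by blast
    then show "p \<in> feasible {}" by (rule feasibleI)
  next
    assume "p \<in> feasible {}"
    then obtain z where "tight {} p z" unfolding feasible_def by blast
    then show "polyhedron n cs p \<noteq> {}" unfolding tight_def by blast
  qed
  then show ?thesis using closed_feasible[of "{}"] by simp
qed

lemma corner_box: "corner p b i \<in> {0..1}"
proof (cases "basic p = {}")
  case False
  from box[OF corner_mem[OF this]] show ?thesis .
qed (simp add: corner_def)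


end

section \<open>Existence of Nash equilibria\<close>

text \<open>The dimension is a number here, not a type. \<open>kuhn_lemma\<close> on grids of mesh
  \<open>1 / (k + 1)\<close> yields, near a common grid point, for each coordinate one point where
  \<open>f\<close> does not decrease it and one where \<open>f\<close> does not increase it; a limit
  of the grid points is fixed.\<close>

lemma brouwer_cube_fun:
  fixes f :: "(nat \<Rightarrow> real) \<Rightarrow> nat \<Rightarrow> real" and n :: nat
  defines "K \<equiv> {x :: nat \<Rightarrow> real. \<forall>i. x i \<in> (if i < n then {0..1} else {0})}"
  assumes cont: "\<And>i. i < n \<Longrightarrow> continuous_on K (\<lambda>x. f x i)"
    and f01: "\<And>x i. x \<in> K \<Longrightarrow> i < n \<Longrightarrow> f x i \<in> {0..1}"
  obtains x where "x \<in> K" "\<And>i. i < n \<Longrightarrow> f x i = x i"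
proof -
  have K: "x \<in> K \<longleftrightarrow> (\<forall>i<n. 0 \<le> x i \<and> x i \<le> 1) \<and> (\<forall>i\<ge>n. x i = 0)" for x
  proof -
    have *: "x i \<in> (if i < n then {0..1} else {0}) \<longleftrightarrow> (i < n \<longrightarrow> 0 \<le> x i \<and> x i \<le> 1) \<and> (i \<ge> n \<longrightarrow> x i = 0)" for i
      by (cases "i < n") auto
    show ?thesis unfolding K_def mem_Collect_eq * by blast
  qed
  have ex: "\<exists>a r s. a \<in> K \<and> (\<forall>i<n. r i \<in> K \<and> s i \<in> K \<and>
      (\<forall>j. \<bar>r i j - a j\<bar> \<le> inverse (real (Suc k))) \<and> (\<forall>j. \<bar>s i j - a j\<bar> \<le> inverse (real (Suc k))) \<and>
      r i i \<le> f (r i) i \<and> f (s i) i \<le> s i i)" for k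
  proof -
    define p where "p = Suc k"
    define pt :: "(nat \<Rightarrow> nat) \<Rightarrow> nat \<Rightarrow> real" where "pt x = (\<lambda>j. if j < n then x j / p else 0)" for x
    \<comment> \<open>Label 0 marks a coordinate that \<open>f\<close> does not decrease, label 1
      one that it does not increase. The values on the faces are those demanded by
      \<open>kuhn_lemma\<close>; they fit because \<open>f\<close> maps into the cube.\<close>
    define label :: "(nat \<Rightarrow> nat) \<Rightarrow> nat \<Rightarrow> nat" where
      "label x i = (if x i = 0 then 0 else if x i = p \<or> f (pt x) i < pt x i then 1 else 0)" for x i
    have ptK: "pt x \<in> K" if "\<forall>j<n. x j \<le> p" for x
      using that by (auto simp: K pt_def divide_le_eq p_def)
    have lab0: "pt x i \<le> f (pt x) i" if "label x i = 0" "i < n" "\<forall>j<n. x j \<le> p" for x i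
      using that f01[OF ptK[OF that(3)] that(2)] by (auto simp: label_def pt_def split: if_splits)
    have lab1: "f (pt x) i \<le> pt x i" if "label x i = 1" "i < n" "\<forall>j<n. x j \<le> p" for x i
      using that f01[OF ptK[OF that(3)] that(2)] by (auto simp: label_def pt_def p_def split: if_splits)
    have lab: "label x i = 0 \<or> label x i = 1" for x i by (auto simp: label_def)
    obtain q where q: "\<forall>i<n. q i < p"
      "\<forall>i<n. \<exists>r s. (\<forall>j<n. q j \<le> r j \<and> r j \<le> q j + 1) \<and> (\<forall>j<n. q j \<le> s j \<and> s j \<le> q j + 1) \<and> label r i \<noteq> label s i"
      by (rule kuhn_lemma[of p n label]) (auto simp: label_def p_def)
    have near: "\<bar>pt r j - pt q j\<bar> \<le> inverse (real (Suc k))" if "\<forall>j<n. q j \<le> r j \<and> r j \<le> q j + 1" for r j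
    proof (cases "j < n")
      case True
      then have "\<bar>real (r j) - real (q j)\<bar> \<le> 1" using that by (auto simp: abs_le_iff)
      then have "\<bar>real (r j) - real (q j)\<bar> / p \<le> 1 / p" by (intro divide_right_mono) auto
      then show ?thesis using True by (simp add: pt_def p_def diff_divide_distrib[symmetric] inverse_eq_divide)
    qed (simp add: pt_def)
    have "\<exists>r s. r \<in> K \<and> s \<in> K \<and> (\<forall>j. \<bar>r j - pt q j\<bar> \<le> inverse (real (Suc k))) \<and>
        (\<forall>j. \<bar>s j - pt q j\<bar> \<le> inverse (real (Suc k))) \<and> r i \<le> f r i \<and> f s i \<le> s i" if i: "i < n" for i
    proof -
      obtain r s where rs: "\<forall>j<n. q j \<le> r j \<and> r j \<le> q j + 1" "\<forall>j<n. q j \<le> s j \<and> s j \<le> q j + 1"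
          "label r i \<noteq> label s i"
        using q(2) i by blast
      have le: "\<forall>j<n. r j \<le> p" "\<forall>j<n. s j \<le> p" using rs(1,2) q(1) by (metis Suc_eq_plus1 Suc_leI order_trans)+
      consider "label r i = 0 \<and> label s i = 1" | "label s i = 0 \<and> label r i = 1" using lab rs(3) by metis
      then show ?thesis
      proof cases
        case 1
        then show ?thesis using lab0[of r i] lab1[of s i] le i near[OF rs(1)] near[OF rs(2)] ptK by metis
      next
        case 2
        then show ?thesis using lab0[of s i] lab1[of r i] le i near[OF rs(1)] near[OF rs(2)] ptK by metis
      qed
    qed
    then obtain r s where "\<forall>i<n. r i \<in> K \<and> s i \<in> K \<and>
      (\<forall>j. \<bar>r i j - pt q j\<bar> \<le> inverse (real (Suc k))) \<and> (\<forall>j. \<bar>s i j - pt q j\<bar> \<le> inverse (real (Suc k))) \<and>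
      r i i \<le> f (r i) i \<and> f (s i) i \<le> s i i" by metis
    moreover have "pt q \<in> K" using q(1) by (intro ptK) (auto intro: less_imp_le)
    ultimately show ?thesis by blast
  qed
  obtain a r s where a: "\<And>k. a k \<in> K" and rs: "\<And>k i. i < n \<Longrightarrow> r k i \<in> K \<and> s k i \<in> K \<and>
      (\<forall>j. \<bar>r k i j - a k j\<bar> \<le> inverse (real (Suc k))) \<and> (\<forall>j. \<bar>s k i j - a k j\<bar> \<le> inverse (real (Suc k))) \<and>
      r k i i \<le> f (r k i) i \<and> f (s k i) i \<le> s k i i"
    using ex by metis
  have "compact K" unfolding K_def by (rule compact_fun_box) auto
  then obtain x \<sigma> where x: "x \<in> K" "strict_mono \<sigma>" "(a \<circ> \<sigma>) \<longlonglongrightarrow> x"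
    using a unfolding compact_eq_seq_compact_metric by (metis seq_compactE)
  have small: "(\<lambda>k. inverse (real (Suc (\<sigma> k)))) \<longlonglongrightarrow> 0"
    using LIMSEQ_subseq_LIMSEQ[OF LIMSEQ_inverse_real_of_nat x(2)] by (simp add: o_def)
  have lim: "(\<lambda>k. b (\<sigma> k)) \<longlonglongrightarrow> x" if "\<And>k j. \<bar>b k j - a k j\<bar> \<le> inverse (real (Suc k))" for b
    unfolding tendsto_fun_iff
  proof
    fix j
    have "(\<lambda>k. b (\<sigma> k) j - a (\<sigma> k) j) \<longlonglongrightarrow> 0"
      by (rule Lim_null_comparison[OF _ small]) (use that in \<open>auto simp del: of_nat_Suc\<close>)
    moreover have "(\<lambda>k. a (\<sigma> k) j) \<longlonglongrightarrow> x j" using x(3) by (simp add: tendsto_fun_iff o_def)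
    ultimately have "(\<lambda>k. (b (\<sigma> k) j - a (\<sigma> k) j) + a (\<sigma> k) j) \<longlonglongrightarrow> 0 + x j" by (rule tendsto_add)
    then show "(\<lambda>k. b (\<sigma> k) j) \<longlonglongrightarrow> x j" by simp
  qed
  have "f x i = x i" if i: "i < n" for i
  proof (rule antisym)
    have lr: "(\<lambda>k. r (\<sigma> k) i) \<longlonglongrightarrow> x" using lim[of "\<lambda>k. r k i"] rs[OF i] by blast
    have ls: "(\<lambda>k. s (\<sigma> k) i) \<longlonglongrightarrow> x" using lim[of "\<lambda>k. s k i"] rs[OF i] by blast
    have "(\<lambda>k. f (r (\<sigma> k) i) i) \<longlonglongrightarrow> f x i"
      by (rule continuous_on_tendsto_compose[OF cont[OF i] lr x(1)]) (use rs[OF i] in auto)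
    moreover have "(\<lambda>k. r (\<sigma> k) i i) \<longlonglongrightarrow> x i" using lr by (simp add: tendsto_fun_iff)
    ultimately show "x i \<le> f x i" using rs[OF i] by (intro LIMSEQ_le[of _ "x i" _ "f x i"]) auto
    have "(\<lambda>k. f (s (\<sigma> k) i) i) \<longlonglongrightarrow> f x i"
      by (rule continuous_on_tendsto_compose[OF cont[OF i] ls x(1)]) (use rs[OF i] in auto)
    moreover have "(\<lambda>k. s (\<sigma> k) i i) \<longlonglongrightarrow> x i" using ls by (simp add: tendsto_fun_iff)
    ultimately show "f x i \<le> x i" using rs[OF i] by (intro LIMSEQ_le[of _ "f x i" _ "x i"]) auto
  qed
  with x(1) show thesis using that by blast
qed

text \<open>A retraction of nonnegative vectors onto the simplex: missing mass is distributed
  evenly, an excess is divided away.\<close>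

definition to_simplex :: "nat \<Rightarrow> (nat \<Rightarrow> real) \<Rightarrow> nat \<Rightarrow> real" where
  "to_simplex n x i = (x i + max 0 (1 - (\<Sum>k<n. x k)) / n) / max 1 (\<Sum>k<n. x k)"

lemma to_simplex:
  assumes "n > 0" "\<And>i. i < n \<Longrightarrow> 0 \<le> x i"
  shows "i < n \<Longrightarrow> 0 \<le> to_simplex n x i" "(\<Sum>i<n. to_simplex n x i) = 1"
    and "(\<Sum>i<n. x i) = 1 \<Longrightarrow> to_simplex n x i = x i"
proof -
  show "i < n \<Longrightarrow> 0 \<le> to_simplex n x i" using assms(2)[of i] by (auto simp: to_simplex_def)
  show "(\<Sum>i<n. x i) = 1 \<Longrightarrow> to_simplex n x i = x i" by (simp add: to_simplex_def)
  have "(\<Sum>i<n. to_simplex n x i) = ((\<Sum>k<n. x k) + max 0 (1 - (\<Sum>k<n. x k))) / max 1 (\<Sum>k<n. x k)"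
    using assms(1) by (simp add: to_simplex_def sum_divide_distrib[symmetric] sum.distrib)
  also have "\<dots> = 1" by (simp add: max_def)
  finally show "(\<Sum>i<n. to_simplex n x i) = 1" .
qed

text \<open>Nash's map: with payoffs \<open>c\<close>, each pure strategy gains weight according to
  its advantage over the current average.\<close>

definition improve :: "nat \<Rightarrow> (nat \<Rightarrow> real) \<Rightarrow> (nat \<Rightarrow> real) \<Rightarrow> nat \<Rightarrow> real" where
  "improve n c x i = (x i + max 0 (c i - (\<Sum>k<n. x k * c k))) / (1 + (\<Sum>l<n. max 0 (c l - (\<Sum>k<n. x k * c k))))"

lemma improve:
  assumes "\<And>i. i < n \<Longrightarrow> 0 \<le> x i" "(\<Sum>i<n. x i) = 1"
  shows "i < n \<Longrightarrow> improve n c x i \<in> {0..1}" "(\<Sum>i<n. improve n c x i) = 1"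
    and "(\<And>i. i < n \<Longrightarrow> improve n c x i = x i) \<Longrightarrow> i < n \<Longrightarrow> c i \<le> (\<Sum>k<n. x k * c k)"
proof -
  define v where "v = (\<Sum>k<n. x k * c k)"
  define g where "g l = max 0 (c l - v)" for l
  have G: "(\<Sum>l<n. g l) \<ge> 0" by (auto simp: g_def intro!: sum_nonneg)
  have imp: "improve n c x i = (x i + g i) / (1 + (\<Sum>l<n. g l))" for i by (simp add: improve_def g_def v_def)
  have "(\<Sum>i<n. improve n c x i) = ((\<Sum>i<n. x i) + (\<Sum>l<n. g l)) / (1 + (\<Sum>l<n. g l))"
    by (simp add: imp sum_divide_distrib[symmetric] sum.distrib)
  then show sum1: "(\<Sum>i<n. improve n c x i) = 1" using G assms(2) by simp
  have nn: "0 \<le> improve n c x i" if "i < n" for i using that assms(1) G by (simp add: imp g_def)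
  show "improve n c x i \<in> {0..1}" if "i < n"
    using member_le_sum[of i "{..<n}" "improve n c x"] that nn sum1 by auto
  assume fx: "\<And>i. i < n \<Longrightarrow> improve n c x i = x i" and i: "i < n"
  have gx: "g i = x i * (\<Sum>l<n. g l)" if "i < n" for i
    using fx[OF that] G by (simp add: imp divide_eq_eq algebra_simps)
  \<comment> \<open>Some strategy in use does no better than the average. Its gain is zero, so at a
    fixed point the normalising factor is 1 and all gains vanish.\<close>
  have "\<exists>k<n. x k > 0 \<and> c k \<le> v"
  proof (rule ccontr)
    assume *: "\<not> ?thesis"
    have le: "x k * v \<le> x k * c k" if "k < n" for k
      using * that assms(1)[OF that] by (cases "x k = 0") (auto intro!: mult_left_mono simp: not_le less_imp_le)
    obtain k where k: "k < n" "x k \<noteq> 0"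
      using assms(2) by (metis lessThan_iff sum.neutral zero_neq_one)
    then have "x k > 0" using assms(1)[of k] by simp
    then have "v < c k" using * k(1) not_le by blast
    then have "x k * v < x k * c k" using \<open>x k > 0\<close> by simp
    then have "(\<Sum>k<n. x k * v) < (\<Sum>k<n. x k * c k)"
      using le k(1) by (intro sum_strict_mono_ex1) auto
    then show False using assms(2) by (simp add: v_def sum_distrib_right[symmetric])
  qed
  then obtain k where "k < n" "x k > 0" "c k \<le> v" by blast
  then have "(\<Sum>l<n. g l) = 0" using gx[of k] by (simp add: g_def)
  then have "g i = 0" using gx[OF i] by simp
  then show "c i \<le> (\<Sum>k<n. x k * c k)" by (simp add: g_def v_def max_def split: if_splits)
qed

lemma continuous_on_to_simplex:
  assumes "\<And>k. k < n \<Longrightarrow> continuous_on S (\<lambda>z. x z k)" "i < n"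
  shows "continuous_on S (\<lambda>z. to_simplex n (x z) i)"
  unfolding to_simplex_def using assms
  by (intro continuous_on_divide continuous_on_add continuous_on_max continuous_on_sum continuous_on_const
      continuous_on_diff) auto

lemma continuous_on_improve:
  assumes "\<And>k. k < n \<Longrightarrow> continuous_on S (\<lambda>z. x z k)" "\<And>k. k < n \<Longrightarrow> continuous_on S (\<lambda>z. c z k)" "i < n"
  shows "continuous_on S (\<lambda>z. improve n (c z) (x z) i)"
proof -
  have "1 + (\<Sum>l<n. max 0 (c z l - (\<Sum>k<n. x z k * c z k))) \<noteq> 0" for z
  proof -
    have "(\<Sum>l<n. max 0 (c z l - (\<Sum>k<n. x z k * c z k))) \<ge> 0" by (intro sum_nonneg) auto
    then show ?thesis by linarith
  qed
  then show ?thesis unfolding improve_def using assms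
    by (intro continuous_on_divide continuous_on_add continuous_on_max continuous_on_sum continuous_on_const
      continuous_on_diff continuous_on_mult) auto
qed

text \<open>The map on the cube retracts both blocks of coordinates onto simplices before improving
  them. Its values are pairs of strategies, so a fixed point is one too and is left unchanged by the
  retraction.\<close>

theorem nash_exists:
  fixes A B :: "nat \<Rightarrow> nat \<Rightarrow> real"
  assumes "n > 0" "m > 0"
  obtains x y where "\<And>i. i < n \<Longrightarrow> 0 \<le> x i" "(\<Sum>i<n. x i) = 1" "\<And>j. j < m \<Longrightarrow> 0 \<le> y j" "(\<Sum>j<m. y j) = 1"
    "\<And>i. i < n \<Longrightarrow> (\<Sum>j<m. A i j * y j) \<le> (\<Sum>k<n. x k * (\<Sum>j<m. A k j * y j))"
    "\<And>j. j < m \<Longrightarrow> (\<Sum>i<n. B i j * x i) \<le> (\<Sum>k<m. y k * (\<Sum>i<n. B i k * x i))"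
proof -
  define K where "K = {z :: nat \<Rightarrow> real. \<forall>i. z i \<in> (if i < n + m then {0..1} else {0})}"
  define X where "X z = to_simplex n z" for z
  define Y where "Y z = to_simplex m (\<lambda>j. z (n + j))" for z :: "nat \<Rightarrow> real"
  define c where "c z i = (\<Sum>j<m. A i j * Y z j)" for z i
  define d where "d z j = (\<Sum>i<n. B i j * X z i)" for z j
  define f where "f z i = (if i < n then improve n (c z) (X z) i else improve m (d z) (Y z) (i - n))" for z i
  have Knn: "0 \<le> z i" if "z \<in> K" for z i
  proof -
    have "z i \<in> (if i < n + m then {0..1} else {0})" using that unfolding K_def by blast
    then show ?thesis by (auto split: if_splits)
  qed
  have X: "i < n \<Longrightarrow> 0 \<le> X z i" "(\<Sum>i<n. X z i) = 1" if "z \<in> K" for z i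
    using to_simplex[OF assms(1), of z] Knn[OF that] by (auto simp: X_def)
  have Y: "j < m \<Longrightarrow> 0 \<le> Y z j" "(\<Sum>j<m. Y z j) = 1" if "z \<in> K" for z j
    using to_simplex[OF assms(2), of "\<lambda>j. z (n + j)"] Knn[OF that] by (auto simp: Y_def)
  have coord: "continuous_on K (\<lambda>z. z i)" for i
    by (rule continuous_on_subset[OF continuous_on_product_coordinates]) auto
  have contX: "continuous_on K (\<lambda>z. X z i)" if "i < n" for i
    unfolding X_def by (intro continuous_on_to_simplex coord that)
  have contY: "continuous_on K (\<lambda>z. Y z j)" if "j < m" for j
    unfolding Y_def by (intro continuous_on_to_simplex coord that)
  have contc: "continuous_on K (\<lambda>z. c z i)" for i
    unfolding c_def by (intro continuous_on_sum continuous_on_mult continuous_on_const contY) auto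
  have contd: "continuous_on K (\<lambda>z. d z j)" for j
    unfolding d_def by (intro continuous_on_sum continuous_on_mult continuous_on_const contX) auto
  have contf: "continuous_on K (\<lambda>z. f z i)" if "i < n + m" for i
    using that contX contY contc contd by (cases "i < n") (auto simp: f_def intro!: continuous_on_improve)
  have f01: "f z i \<in> {0..1}" if "z \<in> K" "i < n + m" for z i
    using improve(1)[OF X(1)[OF that(1)] X(2)[OF that(1)], of i "c z"]
      improve(1)[OF Y(1)[OF that(1)] Y(2)[OF that(1)], of "i - n" "d z"] that(2)
    by (cases "i < n") (auto simp: f_def)
  obtain z where z: "z \<in> K" "\<And>i. i < n + m \<Longrightarrow> f z i = z i"
    using brouwer_cube_fun[of "n + m" f] contf f01 unfolding K_def by blast
  have zx: "improve n (c z) (X z) i = z i" if "i < n" for i using z(2)[of i] that by (simp add: f_def)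
  have zy: "improve m (d z) (Y z) j = z (n + j)" if "j < m" for j using z(2)[of "n + j"] that by (simp add: f_def)
  have "(\<Sum>i<n. z i) = 1" using improve(2)[OF X(1)[OF z(1)] X(2)[OF z(1)], of "c z"] zx by simp
  then have Xz: "X z i = z i" for i using to_simplex(3)[OF assms(1), of z] Knn[OF z(1)] by (simp add: X_def)
  have "(\<Sum>j<m. z (n + j)) = 1" using improve(2)[OF Y(1)[OF z(1)] Y(2)[OF z(1)], of "d z"] zy by simp
  then have Yz: "Y z j = z (n + j)" for j
    using to_simplex(3)[OF assms(2), of "\<lambda>j. z (n + j)"] Knn[OF z(1)] by (simp add: Y_def)
  have "c z i \<le> (\<Sum>k<n. X z k * c z k)" if "i < n" for i
    by (rule improve(3)[OF X(1)[OF z(1)] X(2)[OF z(1)]]) (use zx Xz that in metis)+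
  moreover have "d z j \<le> (\<Sum>k<m. Y z k * d z k)" if "j < m" for j
    by (rule improve(3)[OF Y(1)[OF z(1)] Y(2)[OF z(1)]]) (use zy Yz that in metis)+
  ultimately show thesis
    using that[of "X z" "Y z"] X[OF z(1)] Y[OF z(1)] by (simp add: c_def d_def)
qed

section \<open>Selection by robust division\<close>

definition division_answers ::
  "nat \<Rightarrow> (nat \<Rightarrow> 'x \<Rightarrow> real) \<Rightarrow> (nat \<Rightarrow> 'x \<Rightarrow> real) \<Rightarrow> 'x \<Rightarrow> (nat \<Rightarrow> real) \<Rightarrow> bool" where
  "division_answers N u v p r \<longleftrightarrow> (\<forall>k<N. v k p > 0 \<longrightarrow> r k = u k p / v k p)"

text \<open>The interface between polytopes and reductions. Numerators and denominators depend on
  the parameter alone, so that all questions can be posed at once.\<close>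

definition robust_selector :: "('x::topological_space \<Rightarrow> (nat \<Rightarrow> real) set) \<Rightarrow> nat \<Rightarrow>
    (nat \<Rightarrow> 'x \<Rightarrow> real) \<Rightarrow> (nat \<Rightarrow> 'x \<Rightarrow> real) \<Rightarrow> ('x \<times> (nat \<Rightarrow> real) \<Rightarrow> nat \<Rightarrow> real) \<Rightarrow> bool" where
  "robust_selector P N u v F \<longleftrightarrow>
    (\<forall>k. continuous_on UNIV (u k) \<and> continuous_on UNIV (v k) \<and> (\<forall>p. 0 \<le> u k p \<and> u k p \<le> v k p)) \<and>
    continuous_on {(p, r). P p \<noteq> {} \<and> division_answers N u v p r} F \<and>
    (\<forall>p r. P p \<noteq> {} \<longrightarrow> division_answers N u v p r \<longrightarrow> F (p, r) \<in> P p)"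

lemma (in polyhedra) robust_selector: "\<exists>N u v F. robust_selector (polyhedron n cs) N u v F"
proof -
  define R where "R = card ((UNIV :: bool set) \<times> Pow {..<J})"
  define Z where "Z = {p. polyhedron n cs p \<noteq> {}}"
  \<comment> \<open>Each level needs one radius and \<open>NB\<close> points with \<open>n\<close>
    coordinates; entry \<open>c\<close> of level \<open>l\<close> becomes division number
    \<open>l * M + c\<close>.\<close>
  define M where "M = Suc (NB * n)"
  have lev: "level p \<le> R" for p
    unfolding level_def R_def by (rule card_mono[OF finite_index]) auto
  have clev: "closed {p. l \<le> level p}" for l
    unfolding level_def by (rule closed_level[OF finite_index family_closed])
  have hull: "polyhedron n cs p = {z. \<exists>w\<in>simplex NB. z = (\<lambda>i. if i < n then \<Sum>b<NB. w b * corner p b i else 0)}"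
    if "p \<in> Z" for p
    using corner_hull_eq[of p] that unfolding corner_hull_def Z_def by blast
  have ccorner: "continuous_on {p \<in> Z. level p = l} (\<lambda>p. corner p b i)" for l b i
    by (rule continuous_on_subset[OF continuous_on_product_then_coordinatewise[OF continuous_on_corner[of l b]]]) auto
  have cgraph: "z \<in> polyhedron n cs p"
    if zs: "\<And>k. zs k \<in> polyhedron n cs (ps k)" and lim: "ps \<longlonglongrightarrow> p" "zs \<longlonglongrightarrow> z" for ps zs p z
  proof -
    have "(zs k, ps k) \<in> {(z, p). z \<in> polyhedron n cs p}" for k using zs by simp
    from closed_sequentially[OF closed_graph_polyhedron this tendsto_Pair[OF lim(2,1)]]
    have "(z, p) \<in> {(z, p). z \<in> polyhedron n cs p}" .
    then show ?thesis by simp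
  qed
  have "\<exists>(u :: nat \<Rightarrow> nat \<Rightarrow> 'x \<Rightarrow> real) (v :: nat \<Rightarrow> nat \<Rightarrow> 'x \<Rightarrow> real) F.
      (\<forall>l c. continuous_on UNIV (u l c)) \<and> (\<forall>l c. continuous_on UNIV (v l c)) \<and>
      (\<forall>l c p. 0 \<le> u l c p) \<and> (\<forall>l c p. u l c p \<le> v l c p) \<and>
      continuous_on {(p, r). p \<in> Z \<and> (\<forall>l\<le>R. \<forall>c\<le>NB*n. v l c p > 0 \<longrightarrow> r l c = u l c p / v l c p)} F \<and>
      (\<forall>p r. p \<in> Z \<longrightarrow> (\<forall>l\<le>R. \<forall>c\<le>NB*n. v l c p > 0 \<longrightarrow> r l c = u l c p / v l c p) \<longrightarrow>
        F (p, r) \<in> polyhedron n cs p)"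
  proof (rule stratified_selection[of NB level R Z "polyhedron n cs" n corner])
    show "0 < NB" by simp
    show "closed Z" unfolding Z_def by (rule closed_nonempty)
    show "level p \<le> R" for p by (rule lev)
    show "closed {p. l \<le> level p}" for l by (rule clev)
    show "polyhedron n cs p = {z. \<exists>w\<in>simplex NB. z = (\<lambda>i. if i < n then \<Sum>b<NB. w b * corner p b i else 0)}"
      if "p \<in> Z" for p by (rule hull[OF that])
    show "corner p b i \<in> {0..1}" for p b i by (rule corner_box)
    show "continuous_on {p \<in> Z. level p = l} (\<lambda>p. corner p b i)" for l b i by (rule ccorner)
    show "z \<in> polyhedron n cs p"
      if "\<And>k. zs k \<in> polyhedron n cs (ps k)" "ps \<longlonglongrightarrow> p" "zs \<longlonglongrightarrow> z" for ps zs p z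
      by (rule cgraph[OF that])
    fix u v :: "nat \<Rightarrow> nat \<Rightarrow> 'x \<Rightarrow> real" and F
    assume uvF: "\<And>l c. continuous_on UNIV (u l c)" "\<And>l c. continuous_on UNIV (v l c)"
      "\<And>l c p. 0 \<le> u l c p" "\<And>l c p. u l c p \<le> v l c p"
      "continuous_on {(p, r). p \<in> Z \<and> (\<forall>l\<le>R. \<forall>c\<le>NB*n. v l c p > 0 \<longrightarrow> r l c = u l c p / v l c p)} F"
      "\<And>p r. p \<in> Z \<Longrightarrow> \<forall>l\<le>R. \<forall>c\<le>NB*n. v l c p > 0 \<longrightarrow> r l c = u l c p / v l c p \<Longrightarrow> F (p, r) \<in> polyhedron n cs p"
    show ?thesis by (rule exI[of _ u], rule exI[of _ v], rule exI[of _ F]) (use uvF in blast)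
  qed
  then obtain u v :: "nat \<Rightarrow> nat \<Rightarrow> 'x \<Rightarrow> real" and F where uv: "\<And>l c. continuous_on UNIV (u l c)" "\<And>l c. continuous_on UNIV (v l c)"
      "\<And>l c p. 0 \<le> u l c p" "\<And>l c p. u l c p \<le> v l c p"
    and F: "continuous_on {(p, r). p \<in> Z \<and> (\<forall>l\<le>R. \<forall>c\<le>NB*n. v l c p > 0 \<longrightarrow> r l c = u l c p / v l c p)} F"
      "\<And>p r. p \<in> Z \<Longrightarrow> \<forall>l\<le>R. \<forall>c\<le>NB*n. v l c p > 0 \<longrightarrow> r l c = u l c p / v l c p \<Longrightarrow> F (p, r) \<in> polyhedron n cs p"
    by blast
  define N where "N = Suc R * M"
  define u' v' where "u' k = u (k div M) (k mod M)" and "v' k = v (k div M) (k mod M)" for k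
  define rr where "rr r l c = r (l * M + c)" for r :: "nat \<Rightarrow> real" and l c
  have ok: "\<forall>l\<le>R. \<forall>c\<le>NB*n. v l c p > 0 \<longrightarrow> rr r l c = u l c p / v l c p" if "division_answers N u' v' p r" for p r
  proof (intro allI impI)
    fix l c assume lc: "l \<le> R" "c \<le> NB * n" and pos: "v l c p > 0"
    have "c < M" using lc by (simp add: M_def)
    then have dm: "(l * M + c) div M = l" "(l * M + c) mod M = c" by auto
    have "l * M + c < Suc l * M" using \<open>c < M\<close> by simp
    also have "\<dots> \<le> N" unfolding N_def using lc by (intro mult_le_mono1) simp
    finally show "rr r l c = u l c p / v l c p"
      using that pos unfolding division_answers_def rr_def u'_def v'_def by (metis dm)
  qed
  have "robust_selector (polyhedron n cs) N u' v' (\<lambda>(p, r). F (p, rr r))"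
    unfolding robust_selector_def
  proof (intro conjI allI impI)
    let ?D = "{(p, r). polyhedron n cs p \<noteq> {} \<and> division_answers N u' v' p r}"
    have "continuous_on ?D (\<lambda>x. F (fst x, rr (snd x)))"
    proof (rule continuous_on_compose2[OF F(1)])
      have "continuous_on ?D (\<lambda>x. rr (snd x))" unfolding rr_def
        by (intro continuous_on_coordinatewise_then_product)
           (rule continuous_on_product_then_coordinatewise[OF continuous_on_snd[OF continuous_on_id]])
      then show "continuous_on ?D (\<lambda>x. (fst x, rr (snd x)))"
        by (intro continuous_on_Pair continuous_on_fst continuous_on_id)
    qed (use ok in \<open>auto simp: Z_def\<close>)
    then show "continuous_on ?D (\<lambda>(p, r). F (p, rr r))" by (simp add: case_prod_beta)
    fix p r assume "polyhedron n cs p \<noteq> {}" "division_answers N u' v' p r"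
    then show "(case (p, r) of (p, r) \<Rightarrow> F (p, rr r)) \<in> polyhedron n cs p"
      using F(2)[of p "rr r"] ok by (simp add: Z_def)
  qed (auto simp: u'_def v'_def uv)
  then show ?thesis by blast
qed

section \<open>Gluing selectors by a knockout\<close>

lemma continuous_on_if_const:
  "continuous_on S f \<Longrightarrow> continuous_on S g \<Longrightarrow> continuous_on S (\<lambda>x. if P then f x else g x)"
  by (cases P) simp_all

lemma continuous_on_pieces:
  fixes f :: "'k \<Rightarrow> 'a::topological_space \<Rightarrow> 'b::topological_space"
  assumes loc: "\<And>x. x \<in> S \<Longrightarrow> \<exists>W. open W \<and> x \<in> W \<and> (\<forall>y\<in>W \<inter> S. s y = s x)"
    and f: "\<And>x. x \<in> S \<Longrightarrow> continuous_on {y \<in> S. s y = s x} (f (s x))"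
  shows "continuous_on S (\<lambda>x. f (s x) x)"
  unfolding continuous_on_topological
proof (intro ballI allI impI)
  fix x B assume x: "x \<in> S" and B: "open B" "f (s x) x \<in> B"
  obtain W where W: "open W" "x \<in> W" "\<forall>y\<in>W \<inter> S. s y = s x" using loc[OF x] by blast
  have "x \<in> {y \<in> S. s y = s x}" using x by simp
  with f[OF x] B obtain A where A: "open A" "x \<in> A" "\<forall>y\<in>{y \<in> S. s y = s x}. y \<in> A \<longrightarrow> f (s x) y \<in> B"
    unfolding continuous_on_topological by blast
  show "\<exists>A. open A \<and> x \<in> A \<and> (\<forall>y\<in>S. y \<in> A \<longrightarrow> f (s y) y \<in> B)"
    by (rule exI[of _ "A \<inter> W"]) (use A W in auto)
qed

text \<open>The piece is found by a knockout: the \<open>b\<close>-th division compares the smallest of the first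
  gap functions with the next one, and only has to be right when exactly one of them vanishes.\<close>

theorem reducible_to_rDiv_power:
  fixes Q :: "(baire, baire) problem" and p :: "baire \<Rightarrow> 'x::metric_space" and P :: "nat \<Rightarrow> 'x \<Rightarrow> (nat \<Rightarrow> real) set"
  assumes \<nu>: "surj \<nu>" and p: "continuous_on (inputs Q) p" and K: "K > 0"
    and sel: "\<And>s. s < K \<Longrightarrow> \<exists>N u v F. robust_selector (P s) N u v F"
    and closed: "\<And>s. s < K \<Longrightarrow> closed {x. P s x \<noteq> {}}"
    and cover: "\<And>w. w \<in> inputs Q \<Longrightarrow> \<exists>s<K. P s (p w) \<noteq> {}"
    and out: "\<And>w z s y. \<lbrakk>w \<in> inputs Q; s < K; y \<in> P s (p w);
        \<And>i. i < d \<Longrightarrow> real_name \<nu> (component d i z) (y i)\<rbrakk> \<Longrightarrow> z \<in> outputs Q w"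
  shows "\<exists>N\<ge>1. Q \<le>\<^sub>2 problem_power (rDiv \<nu>) N"
proof -
  have "\<forall>s. \<exists>N u v F. s < K \<longrightarrow> robust_selector (P s) N u v F" using sel by blast
  then obtain N u v F where rs: "\<And>s. s < K \<Longrightarrow> robust_selector (P s) (N s) (u s) (v s) (F s)" by metis
  obtain C :: "nat \<Rightarrow> baire set" where C: "clopen_base C" using clopen_base_baire by blast
  define Z where "Z s = {x. P s x \<noteq> {}}" for s
  \<comment> \<open>The gap of piece \<open>s\<close>. The default 1 keeps a piece that is empty at
    every parameter from having gap 0.\<close>
  define e where "e s x = (if Z s = {} then 1 else infdist x (Z s))" for s x
  have e0: "e s x \<ge> 0" for s x by (simp add: e_def infdist_nonneg)
  have e_iff: "e s x = 0 \<longleftrightarrow> P s x \<noteq> {}" if "s < K" for s x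
  proof (cases "Z s = {}")
    case True
    then have "x \<notin> Z s" by blast
    then show ?thesis using True by (simp add: e_def Z_def)
  next
    case False
    have "closed (Z s)" using closed[OF that] by (simp add: Z_def)
    from in_closed_iff_infdist_zero[OF this False, of x] have "infdist x (Z s) = 0 \<longleftrightarrow> x \<in> Z s" by blast
    moreover have "e s x = infdist x (Z s)" using False by (simp add: e_def)
    moreover have "x \<in> Z s \<longleftrightarrow> P s x \<noteq> {}" by (simp add: Z_def)
    ultimately show ?thesis by simp
  qed
  have conte: "continuous_on UNIV (e s)" for s
    unfolding e_def by (intro continuous_on_if_const continuous_on_infdist continuous_on_id continuous_on_const)
  define pm where "pm s x = rec_nat (e 0 x) (\<lambda>s m. min m (e (Suc s) x)) s" for s x
  have pm: "pm 0 x = e 0 x" "pm (Suc s) x = min (pm s x) (e (Suc s) x)" for s x by (simp_all add: pm_def)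
  have pm0: "pm s x \<ge> 0" for s x by (induction s) (simp_all add: pm e0)
  have pm_le: "pm s x \<le> e t x" if "t \<le> s" for s t x
    using that
  proof (induction s)
    case (Suc s)
    have "pm (Suc s) x \<le> pm s x" "pm (Suc s) x \<le> e (Suc s) x" by (simp_all add: pm)
    then show ?case using Suc by (cases "t = Suc s") auto
  qed (simp add: pm)
  have contpm: "continuous_on UNIV (pm s)" for s
  proof (induction s)
    case 0
    have "pm 0 = e 0" by (simp add: pm fun_eq_iff)
    then show ?case using conte by simp
  next
    case (Suc s)
    have "pm (Suc s) = (\<lambda>x. min (pm s x) (e (Suc s) x))" by (simp add: pm fun_eq_iff)
    then show ?case using continuous_on_min[OF Suc conte] by simp
  qed
  \<comment> \<open>Row 0 holds the comparisons of the knockout, row \<open>Suc s\<close> the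
    divisions of the selector for piece \<open>s\<close>. Losing pieces are asked about as well,
    because the winner emerges only from the answers.\<close>
  define U where "U a b x = (case a of 0 \<Rightarrow> pm b x | Suc s \<Rightarrow> if s < K then u s b x else 0)" for a b x
  define V where "V a b x = (case a of 0 \<Rightarrow> pm b x + e (Suc b) x | Suc s \<Rightarrow> if s < K then v s b x else 0)" for a b x
  have U: "U 0 b = pm b" "U (Suc s) b = (if s < K then u s b else (\<lambda>_. 0))"
    and V: "V 0 b = (\<lambda>x. pm b x + e (Suc b) x)" "V (Suc s) b = (if s < K then v s b else (\<lambda>_. 0))" for s b
    by (auto simp: U_def V_def)
  have UV: "continuous_on UNIV (U a b) \<and> continuous_on UNIV (V a b) \<and> 0 \<le> U a b x \<and> U a b x \<le> V a b x" for a b x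
  proof (cases a)
    case 0
    then show ?thesis using contpm conte by (simp add: U V pm0 e0 continuous_on_add)
  next
    case (Suc s)
    then show ?thesis using rs[of s] by (cases "s < K") (simp_all add: U V robust_selector_def)
  qed
  \<comment> \<open>The common length of the rows exceeds \<open>K\<close> and every
    \<open>N s\<close>; division \<open>a * M + b\<close> is entry \<open>b\<close> of row
    \<open>a\<close>.\<close>
  define M where "M = Suc (K + (\<Sum>s<K. N s))"
  define L where "L = Suc K * M"
  have MN: "N s < M" if "s < K" for s
    using member_le_sum[of s "{..<K}" N] that by (simp add: M_def)
  have L: "a * M + b < L" if "a \<le> K" "b < M" for a b
  proof -
    have "a * M + b < Suc a * M" using that by simp
    also have "\<dots> \<le> L" unfolding L_def using that by (intro mult_le_mono1) simp
    finally show ?thesis .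
  qed
  have L0: "L > 0" by (simp add: L_def M_def)
  have dm: "(a * M + b) div M = a" "(a * M + b) mod M = b" if "b < M" for a b using that by auto
  have contp: "continuous_on (inputs Q) (\<lambda>w. U a b (p w))" "continuous_on (inputs Q) (\<lambda>w. V a b (p w))" for a b
    using UV by (auto intro: continuous_on_compose2[OF _ p])
  have "\<exists>H. continuous_on (inputs Q) H \<and> (\<forall>w\<in>inputs Q. real_name \<nu> (H w) (U a b (p w)))" for a b
    using continuous_name[OF \<nu> C contp(1)] by metis
  then obtain HU where HU: "\<And>a b. continuous_on (inputs Q) (HU a b)"
      "\<And>a b w. w \<in> inputs Q \<Longrightarrow> real_name \<nu> (HU a b w) (U a b (p w))" by metis
  have "\<exists>H. continuous_on (inputs Q) H \<and> (\<forall>w\<in>inputs Q. real_name \<nu> (H w) (V a b (p w)))" for a b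
    using continuous_name[OF \<nu> C contp(2)] by metis
  then obtain HV where HV: "\<And>a b. continuous_on (inputs Q) (HV a b)"
      "\<And>a b w. w \<in> inputs Q \<Longrightarrow> real_name \<nu> (HV a b w) (V a b (p w))" by metis
  define pair where "pair w k = tuple 2 (\<lambda>j. if j = 0 then HU (k div M) (k mod M) w else HV (k div M) (k mod M) w)" for w k
  define G where "G w = pack L (pair w)" for w
  have contG: "continuous_on (inputs Q) G"
  proof -
    have "continuous_on (inputs Q) (\<lambda>w. if j = 0 then HU a b w else HV a b w)" for a b and j :: nat
      using HU(1) HV(1) by (cases "j = 0") auto
    then show ?thesis unfolding G_def pair_def by (intro continuous_on_pack continuous_on_tuple)
  qed
  have slotG: "slot L k (G w) = pair w k" if "k < L" for k w unfolding G_def by (rule slot_pack[OF that])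
  have pair: "component 2 0 (pair w k) = HU (k div M) (k mod M) w"
    "component 2 (Suc 0) (pair w k) = HV (k div M) (k mod M) w" for w k
    by (simp_all add: pair_def component_tuple)
  have GQ: "G w \<in> inputs (problem_power (rDiv \<nu>) L)" if w: "w \<in> inputs Q" for w
    unfolding power_slots(1)[OF L0]
  proof (intro allI impI)
    fix k assume "k < L"
    have "\<exists>x y. real_name \<nu> (HU a b w) x \<and> real_name \<nu> (HV a b w) y \<and> 0 \<le> x \<and> x \<le> y" for a b
      using HU(2)[OF w] HV(2)[OF w] UV by blast
    then show "slot L k (G w) \<in> inputs (rDiv \<nu>)" using \<open>k < L\<close> by (simp add: slotG rDiv_def pair)
  qed
  define D where "D = {(w, z). w \<in> inputs Q \<and> z \<in> outputs (problem_power (rDiv \<nu>) L) (G w)}"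
  define val where "val x a b = (if a \<le> K \<and> b < M then name_value \<nu> (slot L (a * M + b) (snd x)) else 0)"
    for x :: "baire \<times> baire" and a b
  have answer: "real_name \<nu> (slot L (a * M + b) (snd x)) (val x a b) \<and>
      (V a b (p (fst x)) > 0 \<longrightarrow> val x a b = U a b (p (fst x)) / V a b (p (fst x)))"
    if x: "x \<in> D" and ab: "a \<le> K" "b < M" for x a b
  proof -
    obtain w z where wz: "x = (w, z)" "w \<in> inputs Q" "z \<in> outputs (problem_power (rDiv \<nu>) L) (G w)"
      using x by (auto simp: D_def)
    have "slot L (a * M + b) z \<in> outputs (rDiv \<nu>) (pair w (a * M + b))"
      using wz(3) L[OF ab] slotG[OF L[OF ab]] unfolding power_slots(2)[OF L0] by metis
    then obtain x1 x2 r where r: "real_name \<nu> (HU a b w) x1" "real_name \<nu> (HV a b w) x2"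
        "real_name \<nu> (slot L (a * M + b) z) r" "x2 > 0 \<longrightarrow> r = x1 / x2"
      unfolding rDiv_def by (auto simp: pair dm[OF ab(2)] mod_less[OF ab(2)])
    moreover have "x1 = U a b (p w)" "x2 = V a b (p w)"
      using r(1,2) HU(2)[OF wz(2)] HV(2)[OF wz(2)] real_name_unique by blast+
    moreover have "val x a b = r" using ab r(3) by (simp add: val_def wz name_value)
    ultimately show ?thesis by (simp add: wz)
  qed
  have contval: "continuous_on D (\<lambda>x. val x a b)" for a b
  proof (cases "a \<le> K \<and> b < M")
    case True
    have "continuous_on D (\<lambda>x. slot L (a * M + b) (snd x))"
      by (intro continuous_on_slot continuous_on_snd continuous_on_id)
    then show ?thesis unfolding continuous_on_def
      using continuous_on_named_value[of D _ \<nu> "\<lambda>x. val x a b"] answer True by (auto simp: continuous_on_def)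
  qed (auto simp: val_def)
  \<comment> \<open>Applied to entries of index 2, which are within 1/4 of the quotient. This
    separates quotient 1, where only the new piece has gap 0, from quotient 0, where the new gap
    alone is positive.\<close>
  define dec where "dec t b \<longleftrightarrow> real_of_rat (\<nu> (t b)) > 1 / 2" for t :: baire and b
  define champ where "champ t b = rec_nat 0 (\<lambda>b s. if dec t b then Suc b else s) b" for t b
  have champ: "champ t 0 = 0" "champ t (Suc b) = (if dec t b then Suc b else champ t b)" for t b
    by (simp_all add: champ_def)
  have champ_le: "champ t b \<le> b" for t b by (induction b) (auto simp: champ)
  have champ_cong: "champ t b = champ t' b" if "\<forall>i<b. t i = t' i" for t t' b
    using that by (induction b) (auto simp: champ dec_def)
  define entries where "entries x b = slot L b (snd x) 2" for x :: "baire \<times> baire" and b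
  \<comment> \<open>If both compared gaps vanish, the quotient is arbitrary but either decision is
    right; if neither does, the premise fails.\<close>
  have champ_ok: "e (champ (entries x) b) (p (fst x)) = 0" if x: "x \<in> D" and "b < K" "pm b (p (fst x)) = 0" for x b
    using that(2,3)
  proof (induction b)
    case 0
    then show ?case by (simp add: champ pm)
  next
    case (Suc b)
    define E where "E = e (Suc b) (p (fst x))"
    define m where "m = pm b (p (fst x))"
    have b: "b < M" using Suc.prems(1) by (simp add: M_def)
    note ans = answer[OF x, of 0 b]
    have near: "\<bar>real_of_rat (\<nu> (entries x b)) - val x 0 b\<bar> \<le> 1 / 4"
    proof -
      have "real_name \<nu> (slot L b (snd x)) (val x 0 b)" using ans b by simp
      then have "\<bar>real_of_rat (\<nu> (slot L b (snd x) 2)) - val x 0 b\<bar> \<le> (1 / 2) ^ 2" unfolding real_name_def ..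
      then show ?thesis by (simp add: entries_def power2_eq_square)
    qed
    then have near: "real_of_rat (\<nu> (entries x b)) \<le> val x 0 b + 1 / 4" "val x 0 b - 1 / 4 \<le> real_of_rat (\<nu> (entries x b))"
      by linarith+
    have v: "m + E > 0 \<longrightarrow> val x 0 b = m / (m + E)" using ans b by (simp add: U V m_def E_def)
    have nn: "m \<ge> 0" "E \<ge> 0" by (simp_all add: m_def E_def pm0 e0)
    have min0: "min m E = 0" using Suc.prems(2) by (simp add: pm m_def E_def)
    show ?case
    proof (cases "dec (entries x) b")
      case True
      have "E = 0"
      proof (rule ccontr)
        assume "E \<noteq> 0"
        then have "m = 0" "E > 0" using min0 nn by (auto simp: min_def split: if_splits)
        then have "val x 0 b = 0" using v by simp
        then show False using True near by (simp add: dec_def)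
      qed
      then show ?thesis using True by (simp add: champ E_def)
    next
      case False
      have "m = 0"
      proof (rule ccontr)
        assume "m \<noteq> 0"
        then have "E = 0" "m > 0" using min0 nn by (auto simp: min_def split: if_splits)
        then have "val x 0 b = 1" using v by simp
        then show False using False near by (simp add: dec_def)
      qed
      then show ?thesis using False Suc.IH Suc.prems(1) by (simp add: champ m_def)
    qed
  qed
  define s where "s x = champ (entries x) (K - 1)" for x
  have sK: "s x < K" for x using champ_le[of "entries x" "K - 1"] K by (simp add: s_def)
  have s_ok: "P (s x) (p (fst x)) \<noteq> {}" if x: "x \<in> D" for x
  proof -
    have "fst x \<in> inputs Q" using x by (auto simp: D_def)
    then obtain t where t: "t < K" "P t (p (fst x)) \<noteq> {}" using cover by blast
    then have "pm (K - 1) (p (fst x)) = 0"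
      using pm_le[of t "K - 1" "p (fst x)"] pm0[of "K - 1" "p (fst x)"] e_iff[OF t(1), of "p (fst x)"] by simp
    then have "e (s x) (p (fst x)) = 0" unfolding s_def using K by (intro champ_ok[OF x]) auto
    then show ?thesis using e_iff[OF sK] by blast
  qed
  \<comment> \<open>The winner is read off finitely many natural numbers. It may differ between
    names of the same reals, which a multi-valued problem permits.\<close>
  have s_loc: "\<exists>W. open W \<and> x \<in> W \<and> (\<forall>y\<in>W \<inter> D. s y = s x)" if "x \<in> D" for x
  proof -
    define W where "W = (\<Inter>b\<in>{..<K - 1}. {y. entries y b \<in> {entries x b}})"
    have "open {y. entries y b \<in> {c}}" for b c
    proof -
      have "continuous_on UNIV (\<lambda>y. entries y b)" unfolding entries_def
        by (rule continuous_on_product_then_coordinatewise[OF continuous_on_slot[OF continuous_on_snd[OF continuous_on_id]]])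
      then show ?thesis using open_vimage[of "{c}" "\<lambda>y. entries y b"] by (simp add: vimage_def open_discrete)
    qed
    then have "open W" unfolding W_def by (intro open_INT) auto
    moreover have "s y = s x" if "y \<in> W" for y
      unfolding s_def by (rule champ_cong) (use that in \<open>auto simp: W_def\<close>)
    moreover have "x \<in> W" by (simp add: W_def)
    ultimately show ?thesis by blast
  qed
  define h where "h i t x = F t (p (fst x), (\<lambda>b. val x (Suc t) b)) i" for i t x
  have answers: "division_answers (N t) (u t) (v t) (p (fst x)) (\<lambda>b. val x (Suc t) b)" if "x \<in> D" "t < K" for x t
    unfolding division_answers_def
  proof (intro allI impI)
    fix k assume "k < N t" "0 < v t k (p (fst x))"
    then show "val x (Suc t) k = u t k (p (fst x)) / v t k (p (fst x))"
      using answer[OF that(1), of "Suc t" k] that(2) MN[OF that(2)] by (simp add: U V)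
  qed
  have conth: "continuous_on D (\<lambda>x. h i (s x) x)" for i
  proof (rule continuous_on_pieces[OF s_loc])
    fix x assume "x \<in> D"
    define D' where "D' = {y \<in> D. s y = s x}"
    have F: "continuous_on {(q, r). P (s x) q \<noteq> {} \<and> division_answers (N (s x)) (u (s x)) (v (s x)) q r} (F (s x))"
      using rs[OF sK[of x]] by (simp add: robust_selector_def)
    have "continuous_on D' (\<lambda>y. F (s x) (p (fst y), (\<lambda>b. val y (Suc (s x)) b)))"
    proof (rule continuous_on_compose2[OF F])
      have "continuous_on D' (\<lambda>y. p (fst y))"
        by (rule continuous_on_compose2[OF p]) (auto simp: D'_def D_def intro!: continuous_on_fst continuous_on_id)
      moreover have "continuous_on D' (\<lambda>y b. val y (Suc (s x)) b)"
        by (intro continuous_on_coordinatewise_then_product continuous_on_subset[OF contval]) (auto simp: D'_def)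
      ultimately show "continuous_on D' (\<lambda>y. (p (fst y), (\<lambda>b. val y (Suc (s x)) b)))" by (rule continuous_on_Pair)
      show "(\<lambda>y. (p (fst y), (\<lambda>b. val y (Suc (s x)) b))) ` D' \<subseteq>
          {(q, r). P (s x) q \<noteq> {} \<and> division_answers (N (s x)) (u (s x)) (v (s x)) q r}"
      proof safe
        fix w z assume "(w, z) \<in> D'"
        then have y: "(w, z) \<in> D" "s (w, z) = s x" by (auto simp: D'_def)
        show "division_answers (N (s x)) (u (s x)) (v (s x)) (p (fst (w, z))) (\<lambda>b. val (w, z) (Suc (s x)) b)"
          using answers[OF y(1) sK[of x]] .
        assume "P (s x) (p (fst (w, z))) = {}"
        then show False using s_ok[OF y(1)] y(2) by simp
      qed
    qed
    then show "continuous_on {y \<in> D. s y = s x} (h i (s x))"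
      unfolding h_def D'_def[symmetric] by (rule continuous_on_product_then_coordinatewise)
  qed
  obtain H where H: "continuous_on D H" "\<And>x i. x \<in> D \<Longrightarrow> i < d \<Longrightarrow> real_name \<nu> (component d i (H x)) (h i (s x) x)"
    using continuous_tuple_name[OF \<nu> clopen_base_Times[OF C C], of d D "\<lambda>i x. h i (s x) x"] conth by blast
  have "Q \<le>\<^sub>2 problem_power (rDiv \<nu>) L"
  proof (rule reducibleI[OF contG GQ])
    show "continuous_on {(w, z). w \<in> inputs Q \<and> z \<in> outputs (problem_power (rDiv \<nu>) L) (G w)} H"
      using H(1) by (simp add: D_def)
    fix w z assume w: "w \<in> inputs Q" and z: "z \<in> outputs (problem_power (rDiv \<nu>) L) (G w)"
    then have x: "(w, z) \<in> D" by (simp add: D_def)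
    let ?y = "F (s (w, z)) (p w, (\<lambda>b. val (w, z) (Suc (s (w, z))) b))"
    show "H (w, z) \<in> outputs Q w"
    proof (rule out[OF w sK])
      show "?y \<in> P (s (w, z)) (p w)"
        using rs[OF sK[of "(w, z)"]] s_ok[OF x] answers[OF x sK[of "(w, z)"]] by (simp add: robust_selector_def)
      show "real_name \<nu> (component d i (H (w, z))) (?y i)" if "i < d" for i
        using H(2)[OF x that] by (simp add: h_def)
    qed
  qed
  then show ?thesis using L0 by (intro exI[of _ L]) auto
qed

section \<open>Robust division from correlated equilibria\<close>

lemma continuous_game_name:
  fixes a b :: "nat \<Rightarrow> nat \<Rightarrow> 'a::topological_space \<Rightarrow> real" and C :: "nat \<Rightarrow> 'a set"
  assumes \<nu>: "surj \<nu>" and C: "clopen_base C"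
    and a: "\<And>i j. i < n \<Longrightarrow> j < m \<Longrightarrow> continuous_on S (a i j)"
    and b: "\<And>i j. i < n \<Longrightarrow> j < m \<Longrightarrow> continuous_on S (b i j)"
  obtains N where "continuous_on S N"
    "\<And>x. x \<in> S \<Longrightarrow> game_name \<nu> n m (N x) (Matrix.mat n m (\<lambda>(i, j). a i j x)) (Matrix.mat n m (\<lambda>(i, j). b i j x))"
proof -
  define h where "h k = (if k < n * m then a (k div m) (k mod m) else b ((k - n * m) div m) ((k - n * m) mod m))" for k
  have idx: "k div m < n \<and> k mod m < m" if "k < n * m" for k
    using that by (cases "m = 0") (auto simp: less_mult_imp_div_less)
  have "continuous_on S (h k)" if "k < 2 * n * m" for k
    using that idx[of k] idx[of "k - n * m"] a b by (auto simp: h_def)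
  then obtain N where N: "continuous_on S N"
      "\<And>x j. x \<in> S \<Longrightarrow> j < 2 * n * m \<Longrightarrow> real_name \<nu> (component (2 * n * m) j (N x)) (h j x)"
    using continuous_tuple_name[OF \<nu> C, of "2 * n * m" S h] by blast
  define N' where "N' x k = (if k = 0 then n else if k = 1 then m else N x (k - 2))" for x k
  have "continuous_on S N'"
  proof (rule continuous_on_coordinatewise_then_product)
    fix k show "continuous_on S (\<lambda>x. N' x k)"
      using continuous_on_product_then_coordinatewise[OF N(1), of "k - 2"]
      by (cases "k = 0"; cases "k = 1") (simp_all add: N'_def)
  qed
  moreover have shift: "(\<lambda>k. N' x (k + 2)) = N x" for x by (auto simp: N'_def)
  have lt: "i * m + j < n * m" if "i < n" "j < m" for i j
  proof -
    have "i * m + j < Suc i * m" using that by simp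
    also have "\<dots> \<le> n * m" using that by (intro mult_le_mono1) simp
    finally show ?thesis .
  qed
  have "game_name \<nu> n m (N' x) (Matrix.mat n m (\<lambda>(i, j). a i j x)) (Matrix.mat n m (\<lambda>(i, j). b i j x))" if x: "x \<in> S" for x
    unfolding game_name_def shift
  proof (intro conjI allI impI)
    fix i j assume ij: "i < n" "j < m"
    have d: "(i * m + j) div m = i" "(i * m + j) mod m = j" using ij by auto
    show "real_name \<nu> (component (2 * n * m) (i * m + j) (N x)) (Matrix.mat n m (\<lambda>(i, j). a i j x) $$ (i, j))"
      using N(2)[OF x, of "i * m + j"] lt[OF ij] ij d by (simp add: h_def)
    show "real_name \<nu> (component (2 * n * m) (n * m + (i * m + j)) (N x)) (Matrix.mat n m (\<lambda>(i, j). b i j x) $$ (i, j))"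
    proof -
      have "n * m + (i * m + j) < 2 * n * m" using lt[OF ij] by (simp only: mult.assoc)
      from N(2)[OF x this] show ?thesis using ij d by (simp add: h_def)
    qed
  qed (auto simp: N'_def)
  ultimately show thesis using that by blast
qed

lemma game_name_entries:
  assumes "game_name \<nu> n m w A B" "i < n" "j < m"
  shows "A $$ (i, j) = name_value \<nu> (component (2 * n * m) (i * m + j) (\<lambda>k. w (k + 2)))"
    and "B $$ (i, j) = name_value \<nu> (component (2 * n * m) (n * m + (i * m + j)) (\<lambda>k. w (k + 2)))"
proof -
  have "real_name \<nu> (component (2 * n * m) (i * m + j) (\<lambda>k. w (k + 2))) (A $$ (i, j))"
    "real_name \<nu> (component (2 * n * m) (n * m + (i * m + j)) (\<lambda>k. w (k + 2))) (B $$ (i, j))"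
    using assms unfolding game_name_def by blast+
  from this[THEN name_value] show
    "A $$ (i, j) = name_value \<nu> (component (2 * n * m) (i * m + j) (\<lambda>k. w (k + 2)))"
    "B $$ (i, j) = name_value \<nu> (component (2 * n * m) (n * m + (i * m + j)) (\<lambda>k. w (k + 2)))"
    by simp_all
qed

lemma game_name_unique:
  assumes "game_name \<nu> n m w A B" "game_name \<nu> n m w A' B'"
  shows "A = A' \<and> B = B'"
proof -
  have "A \<in> carrier_mat n m" "A' \<in> carrier_mat n m" "B \<in> carrier_mat n m" "B' \<in> carrier_mat n m"
    using assms by (simp_all add: game_name_def)
  then show ?thesis using game_name_entries[OF assms(1)] game_name_entries[OF assms(2)]
    by (intro conjI eq_matI) simp_all
qed

text \<open>For positive payoffs the four incentive constraints chain to
  \<open>c01 \<le> c10\<close> and \<open>c10 \<le> c01\<close>, so all hold with equality; if a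
  payoff is zero, nonnegativity gives the same two equations. They turn the mass of the first column
  times \<open>\<alpha> + a\<close> into \<open>a\<close> times the total mass.\<close>

lemma two_by_two_correlated:
  fixes \<alpha> a c00 c01 c10 c11 :: real
  assumes "0 \<le> \<alpha>" "0 \<le> a" "a * c01 \<le> \<alpha> * c00" "\<alpha> * c10 \<le> a * c11" "\<alpha> * c00 \<le> a * c10" "a * c11 \<le> \<alpha> * c01"
    and nn: "0 \<le> c00" "0 \<le> c01" "0 \<le> c10" "0 \<le> c11" and sum: "c00 + c01 + c10 + c11 = 1"
  shows "(c00 + c10) * (\<alpha> + a) = a"
proof -
  have "\<alpha> * c00 = a * c01 \<and> \<alpha> * c10 = a * c11"
  proof (cases "\<alpha> = 0 \<or> a = 0")
    case True
    moreover have "0 \<le> \<alpha> * c00" "0 \<le> \<alpha> * c10" "0 \<le> a * c01" "0 \<le> a * c11" using assms by simp_all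
    ultimately show ?thesis using assms(3-6) by (elim disjE) simp_all
  next
    case False
    then have pos: "0 < \<alpha>" "0 < a" using assms(1,2) by simp_all
    have "a * c01 \<le> a * c10" "\<alpha> * c10 \<le> \<alpha> * c01" using assms(3-6) by linarith+
    then have "c01 = c10" using pos by simp
    then show ?thesis using assms(3-6) by simp
  qed
  then have "(c00 + c10) * (\<alpha> + a) = a * (c00 + c01 + c10 + c11)" by (simp add: algebra_simps)
  then show ?thesis by (simp add: sum)
qed

section \<open>Sums of division games indexed by bit strings\<close>

lemma flip_bit_less: "k < N \<Longrightarrow> i < 2 ^ N \<Longrightarrow> flip_bit k i < 2 ^ N" for i :: nat
  by (metis take_bit_flip_bit_eq take_bit_nat_eq_self_iff not_le)

lemma sum_bit_split:
  fixes C :: "nat \<Rightarrow> real"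
  shows "(\<Sum>j<M. h (bit j k) * C j) = h False * (\<Sum>j\<in>{j. j < M \<and> \<not> bit j k}. C j) + h True * (\<Sum>j\<in>{j. j < M \<and> bit j k}. C j)"
proof -
  have "{..<M} = {j. j < M \<and> \<not> bit j k} \<union> {j. j < M \<and> bit j k}" by auto
  then have "(\<Sum>j<M. h (bit j k) * C j) =
      (\<Sum>j\<in>{j. j < M \<and> \<not> bit j k} \<union> {j. j < M \<and> bit j k}. h (bit j k) * C j)" by (rule arg_cong)
  also have "\<dots> = (\<Sum>j\<in>{j. j < M \<and> \<not> bit j k}. h (bit j k) * C j) + (\<Sum>j\<in>{j. j < M \<and> bit j k}. h (bit j k) * C j)"
    by (rule sum.union_disjoint) auto
  finally show ?thesis by (simp add: sum_distrib_left)
qed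

text \<open>The game in which a fraction \<open>a / (\<alpha> + a)\<close> is the weight of the first column.\<close>

definition division_payoff :: "real \<Rightarrow> real \<Rightarrow> bool \<Rightarrow> bool \<Rightarrow> real" where
  "division_payoff \<alpha> a e f = (if e = f then if e then a else \<alpha> else 0)"

text \<open>In the sum of \<open>N\<close> such games, indexed by the bits of the strategies, the condition on
  deviations that flip bit \<open>k\<close> only involves the \<open>k\<close>-th game.\<close>

lemma correlated_sum_of_divisions:
  fixes C :: "nat \<Rightarrow> nat \<Rightarrow> real" and \<alpha> a :: "nat \<Rightarrow> real" and N :: nat
  defines "M \<equiv> 2 ^ N" and "A \<equiv> \<lambda>i j. \<Sum>k<N. division_payoff (\<alpha> k) (a k) (bit (i::nat) k) (bit (j::nat) k)"
  assumes nn: "\<And>i j. i < M \<Longrightarrow> j < M \<Longrightarrow> 0 \<le> C i j" and sum1: "(\<Sum>i<M. \<Sum>j<M. C i j) = 1"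
    and row: "\<And>i l. i < M \<Longrightarrow> l < M \<Longrightarrow> (\<Sum>j<M. A l j * C i j) \<le> (\<Sum>j<M. A i j * C i j)"
    and col: "\<And>j l. j < M \<Longrightarrow> l < M \<Longrightarrow> (\<Sum>i<M. A i j * C i j) \<le> (\<Sum>i<M. A i l * C i j)"
    and k: "k < N" and \<alpha>: "0 \<le> \<alpha> k" "0 \<le> a k"
  shows "(\<Sum>i<M. \<Sum>j\<in>{j. j < M \<and> \<not> bit j k}. C i j) * (\<alpha> k + a k) = a k"
proof -
  define g where "g = division_payoff (\<alpha> k) (a k)"
  define rest where "rest i j = (\<Sum>l\<in>{..<N} - {k}. division_payoff (\<alpha> l) (a l) (bit (i::nat) l) (bit (j::nat) l))" for i j
  have A: "A i j = g (bit i k) (bit j k) + rest i j" for i j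
    unfolding A_def rest_def g_def using k by (subst sum.remove[of _ k]) auto
  have rest: "rest (flip_bit k i) j = rest i j" "rest i (flip_bit k j) = rest i j" for i j
    unfolding rest_def by (auto intro!: sum.cong simp: bit_flip_bit_iff)
  have flip: "A (flip_bit k i) j = g (\<not> bit i k) (bit j k) + rest i j"
    "A i (flip_bit k j) = g (bit i k) (\<not> bit j k) + rest i j" for i j
    unfolding A rest by (simp_all add: bit_flip_bit_iff)
  have fl: "flip_bit k i < M" if "i < M" for i using flip_bit_less[OF k] that by (simp add: M_def)
  \<comment> \<open>Strategies are grouped by bit \<open>k\<close>, and \<open>c\<close> is the
    induced two-by-two distribution. The part \<open>rest\<close> is the same before and after the
    flip and cancels, so the constraints summed over a group are those of the \<open>k\<close>-th
    game for \<open>c\<close>.\<close>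
  define R where "R e = {i. i < M \<and> bit i k = e}" for e
  define c where "c e f = (\<Sum>i\<in>R e. \<Sum>j\<in>R f. C i j)" for e f
  have R: "R True = {j. j < M \<and> bit j k}" "R False = {j. j < M \<and> \<not> bit j k}" by (auto simp: R_def)
  have finR: "finite (R e)" for e by (auto simp: R_def)
  have r: "g (\<not> e) False * c e False + g (\<not> e) True * c e True \<le> g e False * c e False + g e True * c e True" for e
  proof -
    have "(\<Sum>j<M. g (\<not> e) (bit j k) * C i j) \<le> (\<Sum>j<M. g e (bit j k) * C i j)" if "i \<in> R e" for i
    proof -
      have "(\<Sum>j<M. A (flip_bit k i) j * C i j) \<le> (\<Sum>j<M. A i j * C i j)"
        using row[of i "flip_bit k i"] fl that by (auto simp: R_def)
      moreover have "A (flip_bit k i) j = g (\<not> e) (bit j k) + rest i j" "A i j = g e (bit j k) + rest i j" for j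
        using that by (simp_all add: flip(1) A[of i] R_def)
      ultimately show ?thesis by (simp add: distrib_right sum.distrib)
    qed
    then have "(\<Sum>i\<in>R e. \<Sum>j<M. g (\<not> e) (bit j k) * C i j) \<le> (\<Sum>i\<in>R e. \<Sum>j<M. g e (bit j k) * C i j)"
      by (rule sum_mono)
    then show ?thesis by (simp add: sum_bit_split[of "g _"] R[symmetric] sum.distrib sum_distrib_left[symmetric] c_def)
  qed
  have c_swap: "c e f = (\<Sum>j\<in>R f. \<Sum>i\<in>R e. C i j)" for e f unfolding c_def by (rule sum.swap)
  have cc: "g False f * c False f + g True f * c True f \<le> g False (\<not> f) * c False f + g True (\<not> f) * c True f" for f
  proof -
    have "(\<Sum>i<M. g (bit i k) f * C i j) \<le> (\<Sum>i<M. g (bit i k) (\<not> f) * C i j)" if "j \<in> R f" for j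
    proof -
      have "(\<Sum>i<M. A i j * C i j) \<le> (\<Sum>i<M. A i (flip_bit k j) * C i j)"
        using col[of j "flip_bit k j"] fl that by (auto simp: R_def)
      moreover have "A i (flip_bit k j) = g (bit i k) (\<not> f) + rest i j" "A i j = g (bit i k) f + rest i j" for i
        using that by (simp_all add: flip(2) A[of _ j] R_def)
      ultimately show ?thesis by (simp add: distrib_right sum.distrib)
    qed
    then have "(\<Sum>j\<in>R f. \<Sum>i<M. g (bit i k) f * C i j) \<le> (\<Sum>j\<in>R f. \<Sum>i<M. g (bit i k) (\<not> f) * C i j)"
      by (rule sum_mono)
    then show ?thesis
      by (simp add: sum_bit_split[of "\<lambda>e. g e _"] R[symmetric] sum.distrib sum_distrib_left[symmetric] c_swap)
  qed
  have cnn: "0 \<le> c e f" for e f unfolding c_def using nn by (auto simp: R_def intro!: sum_nonneg)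
  have split: "(\<Sum>i<M. H i) = (\<Sum>i\<in>R False. H i) + (\<Sum>i\<in>R True. H i)" for H :: "nat \<Rightarrow> real"
    using sum_bit_split[of "\<lambda>_. 1" k H M] by (simp add: R)
  have "c False False + c False True + c True False + c True True = 1"
    using sum1 by (simp add: split sum.distrib c_def)
  then have "(c False False + c True False) * (\<alpha> k + a k) = a k"
    using two_by_two_correlated[of "\<alpha> k" "a k" "c False True" "c False False" "c True False" "c True True"]
      \<alpha> r[of False] r[of True] cc[of False] cc[of True] cnn by (simp add: g_def division_payoff_def)
  then show ?thesis by (simp add: split[of "\<lambda>i. \<Sum>j\<in>_. C i j"] R[symmetric] c_def)
qed

lemma correlated_functions:
  "correlated_equilibrium n m (Matrix.mat n m (\<lambda>(i, j). a i j)) (Matrix.mat n m (\<lambda>(i, j). b i j))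
      (Matrix.mat n m (\<lambda>(i, j). c i j)) \<longleftrightarrow>
    (\<forall>i<n. \<forall>j<m. 0 \<le> c i j) \<and> (\<Sum>i<n. \<Sum>j<m. c i j) = 1 \<and>
    (\<forall>i<n. \<forall>l<n. (\<Sum>j<m. a l j * c i j) \<le> (\<Sum>j<m. a i j * c i j)) \<and>
    (\<forall>j<m. \<forall>l<m. (\<Sum>i<n. b i l * c i j) \<le> (\<Sum>i<n. b i j * c i j))"
proof -
  let ?A = "Matrix.mat n m (\<lambda>(i, j). a i j)" and ?B = "Matrix.mat n m (\<lambda>(i, j). b i j)"
    and ?C = "Matrix.mat n m (\<lambda>(i, j). c i j)"
  have "(\<Sum>i<n. \<Sum>j<m. ?C $$ (i, j)) = (\<Sum>i<n. \<Sum>j<m. c i j)" by (intro sum.cong) simp_all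
  moreover have "(\<Sum>j<m. ?A $$ (l, j) * ?C $$ (i, j)) = (\<Sum>j<m. a l j * c i j)" if "i < n" "l < n" for i l
    using that by (intro sum.cong) simp_all
  moreover have "(\<Sum>i<n. ?B $$ (i, l) * ?C $$ (i, j)) = (\<Sum>i<n. b i l * c i j)" if "j < m" "l < m" for j l
    using that by (intro sum.cong) simp_all
  ultimately show ?thesis unfolding correlated_equilibrium_def by auto
qed

theorem rDiv_power_le_ZCorr:
  assumes \<nu>: "surj \<nu>" and N: "N > 0"
  shows "problem_power (rDiv \<nu>) N \<le>\<^sub>2 ZCorr_size \<nu> (2 ^ N) (2 ^ N)"
proof -
  define M :: nat where "M = 2 ^ N"
  obtain C :: "nat \<Rightarrow> baire set" where C: "clopen_base C" using clopen_base_baire by blast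
  let ?P = "problem_power (rDiv \<nu>) N"
  define num where "num k w = name_value \<nu> (component 2 0 (slot N k w))" for k w
  define den where "den k w = name_value \<nu> (component 2 1 (slot N k w))" for k w
  have nd: "real_name \<nu> (component 2 0 (slot N k w)) (num k w) \<and> real_name \<nu> (component 2 1 (slot N k w)) (den k w) \<and>
      0 \<le> num k w \<and> num k w \<le> den k w" if "w \<in> inputs ?P" "k < N" for w k
  proof -
    have "slot N k w \<in> inputs (rDiv \<nu>)" using that power_slots(1)[OF N] by blast
    then obtain x y where "real_name \<nu> (component 2 0 (slot N k w)) x" "real_name \<nu> (component 2 1 (slot N k w)) y"
      "0 \<le> x" "x \<le> y" by (auto simp: rDiv_def)
    then show ?thesis by (simp add: num_def den_def name_value)
  qed
  have cont: "continuous_on (inputs ?P) (num k)" "continuous_on (inputs ?P) (den k)" if "k < N" for k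
    unfolding num_def den_def using nd that
    by (auto intro!: continuous_on_name_value continuous_on_component continuous_on_slot continuous_on_id)
  \<comment> \<open>A division of \<open>x\<close> by \<open>y\<close> becomes the game with
    diagonal payoffs \<open>y - x\<close> and \<open>x\<close>: both are nonnegative on the domain
    of \<open>rDiv\<close>, and their sum is the denominator.\<close>
  define A where "A i j w = (\<Sum>k<N. division_payoff (den k w - num k w) (num k w) (bit (i::nat) k) (bit (j::nat) k))" for i j w
  have contA: "continuous_on (inputs ?P) (A i j)" for i j
    unfolding A_def
  proof (intro continuous_on_sum)
    fix k assume "k \<in> {..<N}"
    then show "continuous_on (inputs ?P) (\<lambda>w. division_payoff (den k w - num k w) (num k w) (bit i k) (bit j k))"
      using cont[of k] unfolding division_payoff_def
      by (cases "bit i k = bit j k"; cases "bit i k") (simp_all add: continuous_on_diff)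
  qed
  obtain G where G: "continuous_on (inputs ?P) G"
      "\<And>w. w \<in> inputs ?P \<Longrightarrow> game_name \<nu> M M (G w) (Matrix.mat M M (\<lambda>(i, j). A i j w)) (Matrix.mat M M (\<lambda>(i, j). - A i j w))"
    using continuous_game_name[where a = A and b = "\<lambda>i j w. - A i j w" and n = M and m = M,
        OF \<nu> C contA continuous_on_minus[OF contA]] by blast
  have neg: "Matrix.mat M M (\<lambda>(i, j). - A i j w) = - Matrix.mat M M (\<lambda>(i, j). A i j w)" for w
    by (rule eq_matI) auto
  let ?Q = "ZCorr_size \<nu> M M"
  let ?D = "{(w, z). w \<in> inputs ?P \<and> z \<in> outputs ?Q (G w)}"
  have GQ: "G w \<in> inputs ?Q" if "w \<in> inputs ?P" for w
    using G(2)[OF that] unfolding neg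
    by (auto simp: ZCorr_size_def restriction_def zero_sum_names_def Corr_size_def)
  define E where "E z i j = name_value \<nu> (component (M * M) (i * M + j) z)" for z i j
  have corr: "correlated_equilibrium M M (Matrix.mat M M (\<lambda>(i, j). A i j w)) (Matrix.mat M M (\<lambda>(i, j). - A i j w)) X \<and>
      (\<forall>i<M. \<forall>j<M. E z i j = X $$ (i, j) \<and> real_name \<nu> (component (M * M) (i * M + j) z) (E z i j))"
    if wz: "(w, z) \<in> ?D" and X: "X = Matrix.mat M M (\<lambda>(i, j). E z i j)" for w z X
  proof -
    obtain A' B' X' where *: "game_name \<nu> M M (G w) A' B'" "correlated_equilibrium M M A' B' X'" "matrix_name \<nu> M M z X'"
      using wz by (auto simp: ZCorr_size_def restriction_def Corr_size_def)
    have E: "E z i j = X' $$ (i, j)" if "i < M" "j < M" for i j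
      using *(3) that by (simp add: E_def matrix_name_def name_value)
    have dims: "A' \<in> carrier_mat M M" "B' \<in> carrier_mat M M" "X' \<in> carrier_mat M M"
      using * by (auto simp: game_name_def correlated_equilibrium_def)
    have "w \<in> inputs ?P" using wz by simp
    note g = G(2)[OF this]
    have a: "A' = Matrix.mat M M (\<lambda>(i, j). A i j w)" and b: "B' = Matrix.mat M M (\<lambda>(i, j). - A i j w)"
      using game_name_unique[OF *(1) g] by simp_all
    have x: "X' = X" using dims(3) E unfolding X by (intro eq_matI) auto
    have "E z i j = X $$ (i, j) \<and> real_name \<nu> (component (M * M) (i * M + j) z) (E z i j)"
      if ij: "i < M" "j < M" for i j
    proof -
      have "real_name \<nu> (component (M * M) (i * M + j) z) (X' $$ (i, j))"
        using *(3) ij unfolding matrix_name_def by blast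
      then show ?thesis unfolding E[OF ij] x by simp
    qed
    then show ?thesis using *(2) unfolding a b x by blast
  qed
  define y where "y k = (\<lambda>(w :: baire, z). \<Sum>i<M. \<Sum>j\<in>{j. j < M \<and> \<not> bit j k}. E z i j)" for k
  have contE: "continuous_on ?D (\<lambda>x. E (snd x) i j)" if "i < M" "j < M" for i j
    unfolding E_def
  proof (rule continuous_on_name_value)
    show "continuous_on ?D (\<lambda>x. component (M * M) (i * M + j) (snd x))"
      by (intro continuous_on_component continuous_on_snd continuous_on_id)
    show "\<exists>y. real_name \<nu> (component (M * M) (i * M + j) (snd x)) y" if "x \<in> ?D" for x
    proof -
      have "(fst x, snd x) \<in> ?D" using that by auto
      from corr[OF this refl] show ?thesis using \<open>i < M\<close> \<open>j < M\<close> by blast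
    qed
  qed
  have conty: "continuous_on ?D (y k)" for k
  proof -
    have "y k = (\<lambda>x. \<Sum>i<M. \<Sum>j\<in>{j. j < M \<and> \<not> bit j k}. E (snd x) i j)"
      by (simp add: y_def fun_eq_iff)
    moreover have "continuous_on ?D (\<lambda>x. \<Sum>i<M. \<Sum>j\<in>{j. j < M \<and> \<not> bit j k}. E (snd x) i j)"
      by (intro continuous_on_sum contE) simp_all
    ultimately show ?thesis by simp
  qed
  \<comment> \<open>Multiplied out, the identity also covers denominator zero, where it leaves the
    value free just as \<open>rDiv\<close> does.\<close>
  have yk: "y k (w, z) * den k w = num k w" if wz: "(w, z) \<in> ?D" and k: "k < N" for w z k
  proof -
    from corr[OF wz refl] have ce: "correlated_equilibrium M M (Matrix.mat M M (\<lambda>(i, j). A i j w))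
        (Matrix.mat M M (\<lambda>(i, j). - A i j w)) (Matrix.mat M M (\<lambda>(i, j). E z i j))" by blast
    note ce = ce[unfolded correlated_functions sum_negf mult_minus_left neg_le_iff_le]
    have "(\<Sum>i<2^N. \<Sum>j\<in>{j. j < 2^N \<and> \<not> bit j k}. E z i j) * ((den k w - num k w) + num k w) = num k w"
    proof (rule correlated_sum_of_divisions[where \<alpha> = "\<lambda>k. den k w - num k w" and a = "\<lambda>k. num k w" and N = N])
      show "0 \<le> den k w - num k w" "0 \<le> num k w" using nd[OF _ k, of w] wz by auto
    qed (use ce k in \<open>simp_all add: A_def[symmetric] M_def[symmetric]\<close>)
    then show ?thesis by (simp add: y_def M_def)
  qed
  have "\<exists>H. continuous_on ?D H \<and> (\<forall>x\<in>?D. real_name \<nu> (H x) (y k x))" for k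
    by (rule continuous_name[OF \<nu> clopen_base_Times[OF C C] conty[of k]]) blast
  from choice[OF allI, OF this] obtain H where
    H': "\<forall>k. continuous_on ?D (H k) \<and> (\<forall>x\<in>?D. real_name \<nu> (H k x) (y k x))" ..
  then have H: "continuous_on ?D (H k)" for k by (rule allE) (rule conjunct1)
  have H2: "real_name \<nu> (H k x) (y k x)" if "x \<in> ?D" for k x
    using H'[THEN spec, of k, THEN conjunct2, THEN bspec, OF that] .
  show ?thesis unfolding M_def[symmetric]
  proof (rule reducibleI[where G = G and F = "\<lambda>x. pack N (\<lambda>k. H k x)"])
    show "continuous_on ?D (\<lambda>x. pack N (\<lambda>k. H k x))" by (intro continuous_on_pack H)
    fix w z assume w: "w \<in> inputs ?P" and z: "z \<in> outputs ?Q (G w)"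
    show "pack N (\<lambda>k. H k (w, z)) \<in> outputs ?P w"
      unfolding power_slots(2)[OF N]
    proof (intro allI impI)
      fix k assume k: "k < N"
      have wz: "(w, z) \<in> ?D" using w z by blast
      show "slot N k (pack N (\<lambda>k. H k (w, z))) \<in> outputs (rDiv \<nu>) (slot N k w)"
      proof -
        have "y k (w, z) = num k w / den k w" if "den k w > 0" using yk[OF wz k] that by (simp add: eq_divide_eq)
        then show ?thesis unfolding slot_pack[OF k] rDiv_def using nd[OF w k] H2[OF wz, of k]
          by (cases "den k w > 0") auto
      qed
    qed
  qed (fact G(1), fact GQ)
qed

section \<open>Equilibria of games\<close>

lemma sum_lessThan_add: "(\<Sum>k<n + m. f k) = (\<Sum>k<n. f k) + (\<Sum>j<m. f (n + j))" for f :: "nat \<Rightarrow> real"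
  by (induction m) auto

text \<open>Complementary slackness: the nonnegative numbers \<open>x k * (v - c k)\<close> sum to
  zero, so each of them vanishes.\<close>

lemma best_response_support:
  fixes x c :: "nat \<Rightarrow> real"
  assumes x: "\<And>i. i < n \<Longrightarrow> 0 \<le> x i" "(\<Sum>i<n. x i) = 1"
    and best: "\<And>i. i < n \<Longrightarrow> c i \<le> (\<Sum>k<n. x k * c k)" and i: "i < n"
  shows "x i * c i = x i * (\<Sum>k<n. x k * c k)"
proof -
  define v where "v = (\<Sum>k<n. x k * c k)"
  have "(\<Sum>k<n. x k * (v - c k)) = (\<Sum>k<n. x k) * v - v"
    by (simp add: v_def right_diff_distrib sum_subtractf sum_distrib_right)
  then have "(\<Sum>k<n. x k * (v - c k)) = 0" using x(2) by simp
  then have "\<forall>k\<in>{..<n}. x k * (v - c k) = 0"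
    using x(1) best by (subst (asm) sum_nonneg_eq_0_iff) (auto simp: v_def)
  then show ?thesis using i by (auto simp: v_def right_diff_distrib)
qed

lemma mixed_payoff:
  fixes A :: "real mat"
  assumes "A \<in> carrier_mat n m" "x \<in> carrier_vec n" "y \<in> carrier_vec m"
  shows "scalar_prod x (A *\<^sub>v y) = (\<Sum>i<n. x $ i * (\<Sum>j<m. A $$ (i, j) * y $ j))"
    and "scalar_prod x (A *\<^sub>v y) = (\<Sum>j<m. y $ j * (\<Sum>i<n. A $$ (i, j) * x $ i))"
proof -
  show 1: "scalar_prod x (A *\<^sub>v y) = (\<Sum>i<n. x $ i * (\<Sum>j<m. A $$ (i, j) * y $ j))"
    using assms by (auto simp: scalar_prod_def lessThan_atLeast0 intro!: sum.cong)
  show "scalar_prod x (A *\<^sub>v y) = (\<Sum>j<m. y $ j * (\<Sum>i<n. A $$ (i, j) * x $ i))"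
    unfolding 1 sum_distrib_left by (subst sum.swap) (intro sum.cong refl, simp add: algebra_simps)
qed

lemma nash_equilibrium_iff:
  assumes A: "A \<in> carrier_mat n m" and B: "B \<in> carrier_mat n m"
  shows "nash_equilibrium n m A B x y \<longleftrightarrow> x \<in> mixed_strategies n \<and> y \<in> mixed_strategies m \<and>
    (\<forall>i<n. (\<Sum>j<m. A $$ (i, j) * y $ j) \<le> (\<Sum>k<n. x $ k * (\<Sum>j<m. A $$ (k, j) * y $ j))) \<and>
    (\<forall>j<m. (\<Sum>i<n. B $$ (i, j) * x $ i) \<le> (\<Sum>k<m. y $ k * (\<Sum>i<n. B $$ (i, k) * x $ i)))"
proof (cases "x \<in> mixed_strategies n \<and> y \<in> mixed_strategies m")
  case True
  then have xy: "x \<in> carrier_vec n" "y \<in> carrier_vec m" by (auto simp: mixed_strategies_def)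
  \<comment> \<open>Payoffs of mixed strategies are averages of pure ones, so it suffices to test
    deviations to unit vectors.\<close>
  have pure: "(\<forall>x'\<in>mixed_strategies k. (\<Sum>i<k. x' $ i * c i) \<le> v) \<longleftrightarrow> (\<forall>i<k. c i \<le> v)" for k c and v :: real
  proof
    assume *: "\<forall>x'\<in>mixed_strategies k. (\<Sum>i<k. x' $ i * c i) \<le> v"
    show "\<forall>i<k. c i \<le> v"
    proof (intro allI impI)
      fix i assume i: "i < k"
      have "(\<Sum>l<k. (if l = i then 1 else 0) * c l) = c i" for c :: "nat \<Rightarrow> real"
        using i by (subst sum.cong[OF refl, of _ _ "\<lambda>l. if l = i then c l else 0"]) auto
      note delta = this
      have "Matrix.vec k (\<lambda>l. if l = i then 1 else 0) \<in> mixed_strategies k"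
        using delta[of "\<lambda>_. 1"] by (auto simp: mixed_strategies_def)
      then have "(\<Sum>l<k. Matrix.vec k (\<lambda>l. if l = i then 1 else 0) $ l * c l) \<le> v" using * by blast
      then show "c i \<le> v" using delta[of c] by simp
    qed
  next
    assume *: "\<forall>i<k. c i \<le> v"
    show "\<forall>x'\<in>mixed_strategies k. (\<Sum>i<k. x' $ i * c i) \<le> v"
    proof
      fix x' assume x': "x' \<in> mixed_strategies k"
      have "(\<Sum>i<k. x' $ i * c i) \<le> (\<Sum>i<k. x' $ i * v)"
        using x' * by (intro sum_mono mult_left_mono) (auto simp: mixed_strategies_def)
      also have "\<dots> = v" using x' by (simp add: mixed_strategies_def sum_distrib_right[symmetric])
      finally show "(\<Sum>i<k. x' $ i * c i) \<le> v" .
    qed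
  qed
  have "(\<forall>x'\<in>mixed_strategies n. scalar_prod x' (A *\<^sub>v y) \<le> scalar_prod x (A *\<^sub>v y)) \<longleftrightarrow>
      (\<forall>x'\<in>mixed_strategies n. (\<Sum>i<n. x' $ i * (\<Sum>j<m. A $$ (i, j) * y $ j)) \<le>
        (\<Sum>k<n. x $ k * (\<Sum>j<m. A $$ (k, j) * y $ j)))"
    using mixed_payoff(1)[OF A _ xy(2)] xy(1) by (intro ball_cong refl) (auto simp: mixed_strategies_def)
  moreover have "(\<forall>y'\<in>mixed_strategies m. scalar_prod x (B *\<^sub>v y') \<le> scalar_prod x (B *\<^sub>v y)) \<longleftrightarrow>
      (\<forall>y'\<in>mixed_strategies m. (\<Sum>j<m. y' $ j * (\<Sum>i<n. B $$ (i, j) * x $ i)) \<le>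
        (\<Sum>k<m. y $ k * (\<Sum>i<n. B $$ (i, k) * x $ i)))"
    using mixed_payoff(2)[OF B xy(1)] xy(2) by (intro ball_cong refl) (auto simp: mixed_strategies_def)
  ultimately show ?thesis unfolding nash_equilibrium_def pure using True by simp
qed (auto simp: nash_equilibrium_def)

text \<open>The equilibria with supports in \<open>S\<close> and \<open>T\<close> in which all strategies in \<open>S\<close> and \<open>T\<close> are best
  responses form a polytope. A point \<open>z\<close> lists the two strategies, a parameter \<open>p\<close> the entries of
  the two matrices.\<close>

definition support_constraints ::
  "nat \<Rightarrow> nat \<Rightarrow> nat set \<Rightarrow> nat set \<Rightarrow> ((nat \<Rightarrow> (nat \<Rightarrow> real) \<Rightarrow> real) \<times> ((nat \<Rightarrow> real) \<Rightarrow> real)) list" where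
  "support_constraints n m S T =
    map (\<lambda>i. (\<lambda>k p. if k = i then -1 else 0, \<lambda>p. 0)) [0..<n + m] @
    map (\<lambda>i. (\<lambda>k p. if k = i then 1 else 0, \<lambda>p. 1)) [0..<n + m] @
    [(\<lambda>k p. if k < n then 1 else 0, \<lambda>p. 1), (\<lambda>k p. if k < n then -1 else 0, \<lambda>p. -1),
     (\<lambda>k p. if n \<le> k then 1 else 0, \<lambda>p. 1), (\<lambda>k p. if n \<le> k then -1 else 0, \<lambda>p. -1)] @
    map (\<lambda>i. (\<lambda>k p. if k = i then 1 else 0, \<lambda>p. 0)) (filter (\<lambda>i. i \<notin> S) [0..<n]) @
    map (\<lambda>j. (\<lambda>k p. if k = n + j then 1 else 0, \<lambda>p. 0)) (filter (\<lambda>j. j \<notin> T) [0..<m]) @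
    map (\<lambda>(i, l). (\<lambda>k p. if n \<le> k then p (l * m + (k - n)) - p (i * m + (k - n)) else 0, \<lambda>p. 0))
      (filter (\<lambda>(i, l). i \<in> S) (List.product [0..<n] [0..<n])) @
    map (\<lambda>(j, l). (\<lambda>k p. if k < n then p (n * m + (k * m + l)) - p (n * m + (k * m + j)) else 0, \<lambda>p. 0))
      (filter (\<lambda>(j, l). j \<in> T) (List.product [0..<m] [0..<m]))"

lemma lin_first: "lin (n + m) (\<lambda>k p. if k < n then f k p else 0, b) p z = (\<Sum>i<n. f i p * z i) - b p"
  by (simp add: lin_def sum_lessThan_add)

lemma lin_second: "lin (n + m) (\<lambda>k p. if n \<le> k then f k p else 0, b) p z = (\<Sum>j<m. f (n + j) p * z (n + j)) - b p"
  by (simp add: lin_def sum_lessThan_add)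

lemma lin_unit: "i < n \<Longrightarrow> lin n (\<lambda>k p. if k = i then c else 0, b) p z = c * z i - b p"
  by (simp add: lin_def if_distrib[of "\<lambda>x. x * _"] sum.delta cong: if_cong)

lemma support_polytope:
  "z \<in> polyhedron (n + m) (support_constraints n m S T) p \<longleftrightarrow>
    (\<forall>i\<ge>n + m. z i = 0) \<and> (\<forall>i<n + m. 0 \<le> z i) \<and> (\<forall>i<n + m. z i \<le> 1) \<and>
    (\<Sum>i<n. z i) = 1 \<and> (\<Sum>j<m. z (n + j)) = 1 \<and>
    (\<forall>i<n. i \<notin> S \<longrightarrow> z i \<le> 0) \<and> (\<forall>j<m. j \<notin> T \<longrightarrow> z (n + j) \<le> 0) \<and>
    (\<forall>i<n. \<forall>l<n. i \<in> S \<longrightarrow> (\<Sum>j<m. p (l * m + j) * z (n + j)) \<le> (\<Sum>j<m. p (i * m + j) * z (n + j))) \<and>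
    (\<forall>j<m. \<forall>l<m. j \<in> T \<longrightarrow>
      (\<Sum>i<n. p (n * m + (i * m + l)) * z i) \<le> (\<Sum>i<n. p (n * m + (i * m + j)) * z i))"
proof -
  have bx: "(\<forall>c\<in>set (map (\<lambda>i. (\<lambda>k p. if k = i then d else 0, \<lambda>p. b)) [0..<n + m]). lin (n + m) c p z \<le> 0) \<longleftrightarrow>
      (\<forall>i<n + m. d * z i \<le> b)" for d b
    by (auto simp: lin_unit)
  have s1: "(\<forall>c\<in>set (map (\<lambda>i. (\<lambda>k p. if k = i then 1 else 0, \<lambda>p. 0)) (filter (\<lambda>i. i \<notin> S) [0..<n])). lin (n + m) c p z \<le> 0)
      \<longleftrightarrow> (\<forall>i<n. i \<notin> S \<longrightarrow> z i \<le> 0)"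
    by (auto simp: lin_unit)
  have s2: "(\<forall>c\<in>set (map (\<lambda>j. (\<lambda>k p. if k = n + j then 1 else 0, \<lambda>p. 0)) (filter (\<lambda>j. j \<notin> T) [0..<m])). lin (n + m) c p z \<le> 0)
      \<longleftrightarrow> (\<forall>j<m. j \<notin> T \<longrightarrow> z (n + j) \<le> 0)"
    by (auto simp: lin_unit)
  have r1: "(\<forall>c\<in>set (map (\<lambda>(i, l). (\<lambda>k p. if n \<le> k then p (l * m + (k - n)) - p (i * m + (k - n)) else 0, \<lambda>p. 0))
      (filter (\<lambda>(i, l). i \<in> S) (List.product [0..<n] [0..<n]))). lin (n + m) c p z \<le> 0) \<longleftrightarrow>
    (\<forall>i<n. \<forall>l<n. i \<in> S \<longrightarrow> (\<Sum>j<m. p (l * m + j) * z (n + j)) \<le> (\<Sum>j<m. p (i * m + j) * z (n + j)))"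
    by (auto simp: lin_second left_diff_distrib sum_subtractf)
  have r2: "(\<forall>c\<in>set (map (\<lambda>(j, l). (\<lambda>k p. if k < n then p (n * m + (k * m + l)) - p (n * m + (k * m + j)) else 0, \<lambda>p. 0))
      (filter (\<lambda>(j, l). j \<in> T) (List.product [0..<m] [0..<m]))). lin (n + m) c p z \<le> 0) \<longleftrightarrow>
    (\<forall>j<m. \<forall>l<m. j \<in> T \<longrightarrow> (\<Sum>i<n. p (n * m + (i * m + l)) * z i) \<le> (\<Sum>i<n. p (n * m + (i * m + j)) * z i))"
    by (auto simp: lin_first left_diff_distrib sum_subtractf)
  have e: "(\<forall>c\<in>set [(\<lambda>k p. if k < n then 1 else 0, \<lambda>p. 1), (\<lambda>k p. if k < n then -1 else 0, \<lambda>p. -1),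
     (\<lambda>k p. if n \<le> k then 1 else 0, \<lambda>p. 1), (\<lambda>k p. if n \<le> k then -1 else 0, \<lambda>p. -1)]. lin (n + m) c p z \<le> 0) \<longleftrightarrow>
     (\<Sum>i<n. z i) = 1 \<and> (\<Sum>j<m. z (n + j)) = 1"
    by (auto simp: lin_first lin_second sum_negf)
  show ?thesis
    unfolding polyhedron_def support_constraints_def set_append ball_Un mem_Collect_eq bx s1 s2 r1 r2 e by auto
qed

lemma polyhedra_support: "polyhedra (n + m) (support_constraints n m S T)"
proof
  have coord: "continuous_on UNIV (\<lambda>p :: nat \<Rightarrow> real. p i)" for i by (rule continuous_on_product_coordinates)
  show "continuous_on UNIV (fst c i)" if "c \<in> set (support_constraints n m S T)" for c i
    using that unfolding support_constraints_def
    by (auto intro!: continuous_on_if_const continuous_on_const continuous_on_diff coord)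
  show "continuous_on UNIV (snd c)" if "c \<in> set (support_constraints n m S T)" for c
    using that unfolding support_constraints_def by (auto intro!: continuous_on_const)
  show "z i \<in> {0..1}" if "z \<in> polyhedron (n + m) (support_constraints n m S T) p" for p z i
    using that unfolding support_polytope by (cases "i < n + m") (auto simp: not_less)
qed

text \<open>The actual supports of one equilibrium work: by complementary slackness every strategy
  played with positive weight is a best response.\<close>

lemma support_cover:
  assumes "n > 0" "m > 0"
  shows "\<exists>S\<subseteq>{..<n}. \<exists>T\<subseteq>{..<m}. polyhedron (n + m) (support_constraints n m S T) p \<noteq> {}"
proof -
  define A where "A i j = p (i * m + j)" for i j
  define B where "B i j = p (n * m + (i * m + j))" for i j
  obtain x y where x: "\<And>i. i < n \<Longrightarrow> 0 \<le> x i" "(\<Sum>i<n. x i) = 1" and y: "\<And>j. j < m \<Longrightarrow> 0 \<le> y j" "(\<Sum>j<m. y j) = 1"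
    and best: "\<And>i. i < n \<Longrightarrow> (\<Sum>j<m. A i j * y j) \<le> (\<Sum>k<n. x k * (\<Sum>j<m. A k j * y j))"
      "\<And>j. j < m \<Longrightarrow> (\<Sum>i<n. B i j * x i) \<le> (\<Sum>k<m. y k * (\<Sum>i<n. B i k * x i))"
    using nash_exists[OF assms, of A B] by blast
  define z where "z k = (if k < n then x k else if k < n + m then y (k - n) else 0)" for k
  define S where "S = {i. i < n \<and> x i > 0}"
  define T where "T = {j. j < m \<and> y j > 0}"
  have z: "i < n \<Longrightarrow> z i = x i" "j < m \<Longrightarrow> z (n + j) = y j" for i j by (auto simp: z_def)
  have le1: "x i \<le> 1" "y j \<le> 1" if "i < n" "j < m" for i j
    using member_le_sum[of i "{..<n}" x] member_le_sum[of j "{..<m}" y] x y that by auto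
  have "z \<in> polyhedron (n + m) (support_constraints n m S T) p"
    unfolding support_polytope
  proof (intro conjI allI impI)
    show "0 \<le> z i" if "i < n + m" for i using that x y by (auto simp: z_def)
    show "z i \<le> 1" if "i < n + m" for i using that le1 assms by (auto simp: z_def)
    show "z i \<le> 0" if "i < n" "i \<notin> S" for i using that by (auto simp: z S_def)
    show "z (n + j) \<le> 0" if "j < m" "j \<notin> T" for j using that by (auto simp: z T_def)
    show "(\<Sum>i<n. z i) = 1" "(\<Sum>j<m. z (n + j)) = 1" using x y by (simp_all add: z)
    fix i l assume il: "i < n" "l < n" "i \<in> S"
    have "(\<Sum>j<m. A i j * y j) = (\<Sum>k<n. x k * (\<Sum>j<m. A k j * y j))"
      using best_response_support[OF x best(1) il(1)] il(3) by (simp add: S_def)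
    then show "(\<Sum>j<m. p (l * m + j) * z (n + j)) \<le> (\<Sum>j<m. p (i * m + j) * z (n + j))"
      using best(1)[OF il(2)] by (simp add: z A_def)
  next
    fix j l assume jl: "j < m" "l < m" "j \<in> T"
    have "(\<Sum>i<n. B i j * x i) = (\<Sum>k<m. y k * (\<Sum>i<n. B i k * x i))"
      using best_response_support[OF y best(2) jl(1)] jl(3) by (simp add: T_def)
    then show "(\<Sum>i<n. p (n * m + (i * m + l)) * z i) \<le> (\<Sum>i<n. p (n * m + (i * m + j)) * z i)"
      using best(2)[OF jl(2)] by (simp add: z B_def)
  qed (auto simp: z_def)
  moreover have "S \<subseteq> {..<n}" "T \<subseteq> {..<m}" by (auto simp: S_def T_def)
  ultimately show ?thesis by blast
qed

text \<open>Converse of complementary slackness: all weight sits on maximisers of \<open>c\<close>,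
  so the average is the maximum.\<close>

lemma support_best:
  fixes x c :: "nat \<Rightarrow> real"
  assumes "\<And>i. i < n \<Longrightarrow> 0 \<le> x i" "(\<Sum>i<n. x i) = 1" "\<And>i. i < n \<Longrightarrow> i \<notin> S \<Longrightarrow> x i \<le> 0"
    and "\<And>i l. i < n \<Longrightarrow> l < n \<Longrightarrow> i \<in> S \<Longrightarrow> c l \<le> c i" and l: "l < n"
  shows "c l \<le> (\<Sum>k<n. x k * c k)"
proof -
  have "c l = (\<Sum>k<n. x k * c l)" using assms(2) by (simp add: sum_distrib_right[symmetric])
  also have "\<dots> \<le> (\<Sum>k<n. x k * c k)"
  proof (rule sum_mono)
    fix k assume "k \<in> {..<n}"
    then show "x k * c l \<le> x k * c k"
      using assms(1)[of k] assms(3)[of k] assms(4)[of k l] l by (cases "k \<in> S") (auto intro!: mult_left_mono)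
  qed
  finally show ?thesis .
qed

theorem Nash_size_le_rDiv_power:
  assumes \<nu>: "surj \<nu>" and nm: "n > 0" "m > 0"
  shows "\<exists>N\<ge>1. Nash_size \<nu> n m \<le>\<^sub>2 problem_power (rDiv \<nu>) N"
proof -
  define K where "K = card (Pow {..<n} \<times> Pow {..<m})"
  obtain c where c: "bij_betw c {..<K} (Pow {..<n} \<times> Pow {..<m})"
    unfolding K_def using ex_bij_betw_nat_finite[of "Pow {..<n} \<times> Pow {..<m}"] by (auto simp: atLeast0LessThan)
  define P where "P s = polyhedron (n + m) (support_constraints n m (fst (c s)) (snd (c s)))" for s
  \<comment> \<open>The payoffs of both matrices, padded with zeros to a sequence, so that the
    parameters of all game sizes share one metric space.\<close>
  define p where "p w k = (if k < 2 * n * m then name_value \<nu> (component (2 * n * m) k (\<lambda>i. w (i + 2))) else 0)" for w k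
  let ?Q = "Nash_size \<nu> n m"
  have lt: "i * m + j < n * m" if "i < n" "j < m" for i j
  proof -
    have "i * m + j < Suc i * m" using that by simp
    also have "\<dots> \<le> n * m" using that by (intro mult_le_mono1) simp
    finally show ?thesis .
  qed
  have entries: "A $$ (i, j) = p w (i * m + j)" "B $$ (i, j) = p w (n * m + (i * m + j))"
    if "game_name \<nu> n m w A B" "i < n" "j < m" for w A B i j
  proof -
    have 1: "i * m + j < 2 * n * m" and 2: "n * m + (i * m + j) < 2 * n * m"
      using lt[OF that(2,3)] by (simp_all only: mult.assoc)
    show "A $$ (i, j) = p w (i * m + j)" "B $$ (i, j) = p w (n * m + (i * m + j))"
      unfolding p_def if_P[OF 1] if_P[OF 2] by (fact game_name_entries[OF that])+
  qed
  have contp: "continuous_on (inputs ?Q) p"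
  proof (rule continuous_on_coordinatewise_then_product)
    fix k
    show "continuous_on (inputs ?Q) (\<lambda>w. p w k)"
    proof (cases "k < 2 * n * m")
      case True
      have "\<exists>y. real_name \<nu> (component (2 * n * m) k (\<lambda>i. w (i + 2))) y" if w: "w \<in> inputs ?Q" for w
      proof -
        obtain A B where g: "game_name \<nu> n m w A B" using w by (auto simp: Nash_size_def)
        define k' where "k' = (if k < n * m then k else k - n * m)"
        have k': "k' < n * m" using True by (auto simp: k'_def)
        then have ij: "k' div m < n" "k' mod m < m" using nm by (auto simp: less_mult_imp_div_less)
        have "k = k' div m * m + k' mod m \<or> k = n * m + (k' div m * m + k' mod m)" by (auto simp: k'_def)
        moreover have "real_name \<nu> (component (2 * n * m) (k' div m * m + k' mod m) (\<lambda>i. w (i + 2))) (A $$ (k' div m, k' mod m))"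
          "real_name \<nu> (component (2 * n * m) (n * m + (k' div m * m + k' mod m)) (\<lambda>i. w (i + 2))) (B $$ (k' div m, k' mod m))"
          using g ij unfolding game_name_def by blast+
        ultimately show ?thesis by metis
      qed
      moreover have "continuous_on (inputs ?Q) (\<lambda>w. component (2 * n * m) k (\<lambda>i. w (i + 2)))"
        by (intro continuous_on_component continuous_on_coordinatewise_then_product)
           (rule continuous_on_product_then_coordinatewise[OF continuous_on_id])
      ultimately show ?thesis using True by (simp add: p_def continuous_on_name_value)
    qed (simp add: p_def)
  qed
  show ?thesis
  proof (rule reducible_to_rDiv_power[OF \<nu> contp, of K P "n + m"])
    show "0 < K" unfolding K_def by (subst card_gt_0_iff) auto
    fix s assume "s < K"
    show "\<exists>N u v F. robust_selector (P s) N u v F" unfolding P_def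
      by (rule polyhedra.robust_selector[OF polyhedra_support])
    show "closed {x. P s x \<noteq> {}}" unfolding P_def
      by (rule polyhedra.closed_nonempty[OF polyhedra_support])
  next
    fix w
    obtain S T where ST: "S \<subseteq> {..<n}" "T \<subseteq> {..<m}" "polyhedron (n + m) (support_constraints n m S T) (p w) \<noteq> {}"
      using support_cover[OF nm, of "p w"] by (elim exE conjE)
    have "(S, T) \<in> c ` {..<K}" using ST(1,2) bij_betw_imp_surj_on[OF c] by simp
    then obtain s where s: "s < K" "c s = (S, T)" by auto
    have "P s (p w) \<noteq> {}" using ST(3) unfolding P_def s(2) fst_conv snd_conv .
    with s(1) show "\<exists>s<K. P s (p w) \<noteq> {}" by (intro exI conjI)
  next
    fix w z s y
    assume w: "w \<in> inputs ?Q" and y: "y \<in> P s (p w)"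
      and name: "\<And>i. i < n + m \<Longrightarrow> real_name \<nu> (component (n + m) i z) (y i)"
    obtain A B where g: "game_name \<nu> n m w A B" using w by (auto simp: Nash_size_def)
    then have carrier: "A \<in> carrier_mat n m" "B \<in> carrier_mat n m" by (auto simp: game_name_def)
    note y' = y[unfolded P_def support_polytope]
    define x1 where "x1 = Matrix.vec n y"
    define x2 where "x2 = Matrix.vec m (\<lambda>j. y (n + j))"
    have "nash_equilibrium n m A B x1 x2"
      unfolding nash_equilibrium_iff[OF carrier]
    proof (intro conjI allI impI)
      show "x1 \<in> mixed_strategies n" "x2 \<in> mixed_strategies m"
        using y' by (auto simp: x1_def x2_def mixed_strategies_def)
      fix i assume "i < n"
      then have "(\<Sum>j<m. p w (i * m + j) * y (n + j)) \<le> (\<Sum>k<n. y k * (\<Sum>j<m. p w (k * m + j) * y (n + j)))"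
        using y' by (intro support_best[where S = "fst (c s)"]) auto
      then show "(\<Sum>j<m. A $$ (i, j) * x2 $ j) \<le> (\<Sum>k<n. x1 $ k * (\<Sum>j<m. A $$ (k, j) * x2 $ j))"
        using \<open>i < n\<close> by (simp add: x1_def x2_def entries[OF g])
    next
      fix j assume "j < m"
      then have "(\<Sum>i<n. p w (n * m + (i * m + j)) * y i) \<le>
          (\<Sum>k<m. y (n + k) * (\<Sum>i<n. p w (n * m + (i * m + k)) * y i))"
        using y' by (intro support_best[where S = "snd (c s)" and x = "\<lambda>j. y (n + j)"]) auto
      then show "(\<Sum>i<n. B $$ (i, j) * x1 $ i) \<le> (\<Sum>k<m. x2 $ k * (\<Sum>i<n. B $$ (i, k) * x1 $ i))"
        using \<open>j < m\<close> by (simp add: x1_def x2_def entries[OF g])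
    qed
    moreover have "strategies_name \<nu> n m z x1 x2"
      using name by (auto simp: strategies_name_def x1_def x2_def)
    ultimately show "z \<in> outputs ?Q w" using g by (auto simp: Nash_size_def)
  qed
qed

text \<open>In the product distribution the constraints of row \<open>i\<close> carry the factor
  \<open>x $ i\<close>, which vanishes unless \<open>i\<close> is a best response; columns behave
  likewise.\<close>

lemma nash_imp_correlated:
  assumes A: "A \<in> carrier_mat n m" and B: "B \<in> carrier_mat n m" and nash: "nash_equilibrium n m A B x y"
  shows "correlated_equilibrium n m A B (Matrix.mat n m (\<lambda>(i, j). x $ i * y $ j))"
proof -
  have x: "\<And>i. i < n \<Longrightarrow> 0 \<le> x $ i" "(\<Sum>i<n. x $ i) = 1" and y: "\<And>j. j < m \<Longrightarrow> 0 \<le> y $ j" "(\<Sum>j<m. y $ j) = 1"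
    and best: "\<And>i. i < n \<Longrightarrow> (\<Sum>j<m. A $$ (i, j) * y $ j) \<le> (\<Sum>k<n. x $ k * (\<Sum>j<m. A $$ (k, j) * y $ j))"
      "\<And>j. j < m \<Longrightarrow> (\<Sum>i<n. B $$ (i, j) * x $ i) \<le> (\<Sum>k<m. y $ k * (\<Sum>i<n. B $$ (i, k) * x $ i))"
    using nash unfolding nash_equilibrium_iff[OF A B] by (auto simp: mixed_strategies_def)
  have row: "(\<Sum>j<m. A $$ (l, j) * (x $ i * y $ j)) = x $ i * (\<Sum>j<m. A $$ (l, j) * y $ j)" for i l
    by (simp add: sum_distrib_left mult_ac)
  have col: "(\<Sum>i<n. B $$ (i, k) * (x $ i * y $ j)) = y $ j * (\<Sum>i<n. B $$ (i, k) * x $ i)" for j k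
    by (simp add: sum_distrib_left mult_ac)
  have total: "(\<Sum>i<n. \<Sum>j<m. x $ i * y $ j) = 1"
    using x(2) y(2) by (simp add: sum_distrib_left[symmetric])
  have r: "x $ i * (\<Sum>j<m. A $$ (l, j) * y $ j) \<le> x $ i * (\<Sum>j<m. A $$ (i, j) * y $ j)" if "i < n" "l < n" for i l
  proof -
    have "x $ i * (\<Sum>j<m. A $$ (l, j) * y $ j) \<le> x $ i * (\<Sum>k<n. x $ k * (\<Sum>j<m. A $$ (k, j) * y $ j))"
      by (rule mult_left_mono[OF best(1)[OF that(2)] x(1)[OF that(1)]])
    also have "\<dots> = x $ i * (\<Sum>j<m. A $$ (i, j) * y $ j)"
      by (rule best_response_support[OF x best(1) that(1), symmetric])
    finally show ?thesis .
  qed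
  have c: "y $ j * (\<Sum>i<n. B $$ (i, k) * x $ i) \<le> y $ j * (\<Sum>i<n. B $$ (i, j) * x $ i)" if "j < m" "k < m" for j k
  proof -
    have "y $ j * (\<Sum>i<n. B $$ (i, k) * x $ i) \<le> y $ j * (\<Sum>l<m. y $ l * (\<Sum>i<n. B $$ (i, l) * x $ i))"
      by (rule mult_left_mono[OF best(2)[OF that(2)] y(1)[OF that(1)]])
    also have "\<dots> = y $ j * (\<Sum>i<n. B $$ (i, j) * x $ i)"
      by (rule best_response_support[OF y best(2) that(1), symmetric])
    finally show ?thesis .
  qed
  show ?thesis
    unfolding correlated_equilibrium_def
  proof (intro conjI allI impI)
    show "(\<Sum>i<n. \<Sum>j<m. Matrix.mat n m (\<lambda>(i, j). x $ i * y $ j) $$ (i, j)) = 1" using total by simp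
  qed (use x y r c in \<open>auto simp: row col\<close>)
qed

text \<open>The input is passed on unchanged, so one reduction serves every class \<open>X\<close>
  of names, in particular all games and the zero-sum games.\<close>

theorem Corr_le_Nash_restricted:
  assumes \<nu>: "surj \<nu>" and nm: "n > 0" "m > 0"
  shows "restriction (Corr_size \<nu> n m) X \<le>\<^sub>2 restriction (Nash_size \<nu> n m) X"
proof -
  obtain C :: "nat \<Rightarrow> baire set" where C: "clopen_base C" using clopen_base_baire by blast
  let ?P = "restriction (Corr_size \<nu> n m) X" and ?Q = "restriction (Nash_size \<nu> n m) X"
  define D where "D = {(w, z). w \<in> inputs ?P \<and> z \<in> outputs ?Q (id w)}"
  define val where "val k x = name_value \<nu> (component (n + m) k (snd x))" for k and x :: "baire \<times> baire"
  have nash: "\<exists>A B x y. game_name \<nu> n m w A B \<and> nash_equilibrium n m A B x y \<and>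
      (\<forall>i<n. val i (w, z) = x $ i) \<and> (\<forall>j<m. val (n + j) (w, z) = y $ j)" and
    named: "k < n + m \<Longrightarrow> \<exists>r. real_name \<nu> (component (n + m) k z) r" if wz: "(w, z) \<in> D" for w z k
  proof -
    obtain A B x y where *: "game_name \<nu> n m w A B" "nash_equilibrium n m A B x y" "strategies_name \<nu> n m z x y"
      using wz by (auto simp: D_def restriction_def Nash_size_def)
    then show "\<exists>A B x y. game_name \<nu> n m w A B \<and> nash_equilibrium n m A B x y \<and>
      (\<forall>i<n. val i (w, z) = x $ i) \<and> (\<forall>j<m. val (n + j) (w, z) = y $ j)"
      by (intro exI[of _ A] exI[of _ B] exI[of _ x] exI[of _ y]) (auto simp: val_def strategies_name_def name_value)
    assume k: "k < n + m"
    show "\<exists>r. real_name \<nu> (component (n + m) k z) r"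
    proof (cases "k < n")
      case False
      then have "k = n + (k - n)" "k - n < m" using k by auto
      then show ?thesis using *(3) unfolding strategies_name_def by metis
    qed (use *(3) in \<open>auto simp: strategies_name_def\<close>)
  qed
  have contval: "continuous_on D (val k)" if "k < n + m" for k
    unfolding val_def using named that
    by (intro continuous_on_name_value continuous_on_component continuous_on_snd continuous_on_id) force
  have "continuous_on D (\<lambda>x. val (k div m) x * val (n + k mod m) x)" if "k < n * m" for k
    using that nm by (intro continuous_on_mult contval) (auto simp: less_mult_imp_div_less intro: trans_less_add1)
  then obtain H where H: "continuous_on D H"
      "\<And>x k. x \<in> D \<Longrightarrow> k < n * m \<Longrightarrow> real_name \<nu> (component (n * m) k (H x)) (val (k div m) x * val (n + k mod m) x)"
    using continuous_tuple_name[OF \<nu> clopen_base_Times[OF C C], of "n * m" D "\<lambda>k x. val (k div m) x * val (n + k mod m) x"]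
    by blast
  show ?thesis
  proof (rule reducibleI[where G = id and F = H])
    show "continuous_on {(w, z). w \<in> inputs ?P \<and> z \<in> outputs ?Q (id w)} H" using H(1) by (simp add: D_def)
    show "id w \<in> inputs ?Q" if "w \<in> inputs ?P" for w
      using that by (auto simp: restriction_def Nash_size_def Corr_size_def)
    fix w z assume "w \<in> inputs ?P" "z \<in> outputs ?Q (id w)"
    then have wz: "(w, z) \<in> D" by (simp add: D_def)
    obtain A B x y where *: "game_name \<nu> n m w A B" "nash_equilibrium n m A B x y"
      "\<And>i. i < n \<Longrightarrow> val i (w, z) = x $ i" "\<And>j. j < m \<Longrightarrow> val (n + j) (w, z) = y $ j"
      using nash[OF wz] by blast
    have lt: "i * m + j < n * m" if "i < n" "j < m" for i j
    proof -
      have "i * m + j < Suc i * m" using that by simp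
      also have "\<dots> \<le> n * m" using that by (intro mult_le_mono1) simp
      finally show ?thesis .
    qed
    have "matrix_name \<nu> n m (H (w, z)) (Matrix.mat n m (\<lambda>(i, j). x $ i * y $ j))"
      unfolding matrix_name_def
    proof (intro allI impI)
      fix i j assume ij: "i < n" "j < m"
      then have "(i * m + j) div m = i" "(i * m + j) mod m = j" by auto
      then show "real_name \<nu> (component (n * m) (i * m + j) (H (w, z))) (Matrix.mat n m (\<lambda>(i, j). x $ i * y $ j) $$ (i, j))"
        using H(2)[OF wz lt[OF ij]] ij *(3,4) by simp
    qed
    moreover have "correlated_equilibrium n m A B (Matrix.mat n m (\<lambda>(i, j). x $ i * y $ j))"
      using *(1,2) by (intro nash_imp_correlated) (auto simp: game_name_def)
    ultimately show "H (w, z) \<in> outputs ?P w" using *(1) by (auto simp: restriction_def Corr_size_def)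
  qed (intro continuous_on_id')
qed

section \<open>Closing the cycle of reductions\<close>

lemma restriction_UNIV: "restriction P UNIV = P"
  by (simp add: restriction_def)

lemma restriction_le: "restriction P X \<le>\<^sub>2 P"
  by (rule reducibleI[where G = id and F = snd])
     (auto simp: restriction_def intro: continuous_on_snd continuous_on_id continuous_on_id')

lemma open_singleton_pair: "open {i :: nat \<times> nat}"
proof -
  have "{i} = {fst i} \<times> {snd i}" by auto
  then show ?thesis by (metis open_Times open_discrete)
qed

lemma game_supremum_le:
  assumes "\<And>n m. n > 0 \<Longrightarrow> m > 0 \<Longrightarrow> P n m \<le>\<^sub>2 Q n m"
  shows "problem_supremum ({1..} \<times> {1..}) (\<lambda>(n, m). P n m) \<le>\<^sub>2
    problem_supremum ({1..} \<times> {1..}) (\<lambda>(n :: nat, m :: nat). Q n m)"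
proof (rule reducible_supremum[OF open_singleton_pair])
  fix i :: "nat \<times> nat" assume "i \<in> {1..} \<times> {1..}"
  then show "\<exists>j\<in>{1..} \<times> {1..}. (\<lambda>(n, m). P n m) i \<le>\<^sub>2 (\<lambda>(n, m). Q n m) j"
    using assms[of "fst i" "snd i"] by (intro bexI[of _ i]) (auto simp: case_prod_beta)
qed

theorem corollary33:
  fixes \<nu> :: "nat \<Rightarrow> rat"
  assumes "rat_numbering \<nu>"
  shows "ZCorr \<nu> \<equiv>\<^sub>2 Corr \<nu> \<and>
         Corr \<nu> \<equiv>\<^sub>2 ZNash \<nu> \<and>
         ZNash \<nu> \<equiv>\<^sub>2 Nash \<nu> \<and>
         Nash \<nu> \<equiv>\<^sub>2 problem_supremum {1..} (problem_power (rDiv \<nu>))"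
proof -
  let ?R = "problem_supremum {1..} (problem_power (rDiv \<nu>))"
  have \<nu>: "surj \<nu>" using assms by (simp add: rat_numbering_def bij_def)
  have 1: "ZCorr \<nu> \<le>\<^sub>2 Corr \<nu>" unfolding ZCorr_def Corr_def
    by (rule game_supremum_le) (simp add: ZCorr_size_def restriction_le)
  have 2: "Corr \<nu> \<le>\<^sub>2 Nash \<nu>" unfolding Nash_def Corr_def
    by (rule game_supremum_le) (rule Corr_le_Nash_restricted[OF \<nu>, where X = UNIV, unfolded restriction_UNIV])
  have 3: "ZCorr \<nu> \<le>\<^sub>2 ZNash \<nu>" unfolding ZNash_def ZCorr_def
    by (rule game_supremum_le) (simp add: ZNash_size_def ZCorr_size_def Corr_le_Nash_restricted[OF \<nu>])
  have 4: "ZNash \<nu> \<le>\<^sub>2 Nash \<nu>" unfolding ZNash_def Nash_def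
    by (rule game_supremum_le) (simp add: ZNash_size_def restriction_le)
  have 5: "Nash \<nu> \<le>\<^sub>2 ?R" unfolding Nash_def
  proof (rule reducible_supremum[OF open_singleton_pair])
    fix i :: "nat \<times> nat" assume "i \<in> {1..} \<times> {1..}"
    then show "\<exists>N\<in>{1..}. (\<lambda>(n, m). Nash_size \<nu> n m) i \<le>\<^sub>2 problem_power (rDiv \<nu>) N"
      using Nash_size_le_rDiv_power[OF \<nu>, of "fst i" "snd i"] by (auto simp: case_prod_beta)
  qed
  have 6: "?R \<le>\<^sub>2 ZCorr \<nu>" unfolding ZCorr_def
  proof (rule reducible_supremum)
    fix N :: nat assume "N \<in> {1..}"
    then have "problem_power (rDiv \<nu>) N \<le>\<^sub>2 ZCorr_size \<nu> (2 ^ N) (2 ^ N)"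
      by (intro rDiv_power_le_ZCorr[OF \<nu>]) simp
    then show "\<exists>j\<in>{1..} \<times> {1..}. problem_power (rDiv \<nu>) N \<le>\<^sub>2 (\<lambda>(n, m). ZCorr_size \<nu> n m) j"
      by (intro bexI[of _ "(2 ^ N, 2 ^ N)"]) simp_all
  qed (rule open_discrete)
  \<comment> \<open>This return from the most general problem to the most special one supplies every
    remaining direction.\<close>
  have 7: "Nash \<nu> \<le>\<^sub>2 ZCorr \<nu>" by (rule reducible_trans[OF 5 6])
  show ?thesis unfolding equivalent_def
    using 1 4 5 reducible_trans[OF 2 7] reducible_trans[OF 2 reducible_trans[OF 7 3]]
      reducible_trans[OF 4 reducible_trans[OF 7 1]] reducible_trans[OF 7 3] reducible_trans[OF 6 reducible_trans[OF 3 4]]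
    by blast
qed

end
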